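(* For every $n\ge 1$ there is a constant $c_n>0$ depending only on $n$ such that, for all $0<\delta<1$, all $1\le p<\infty$, every $w\in A_\infty$, every $u\in L^1_{\mathrm{loc}}(\mathbb{R}^n)$ and every cube $Q$ in $\mathbb{R}^n$, $$\inf_{c\in\mathbb{R}}\left(\int_Q|u(x)-c|^p\,w(x)\,dx\right)^{\frac1p}\le c_n\,p\,(1-\delta)^{\frac1p}\,[w]_{A_\infty}\left(\int_Q\int_Q\frac{|u(x)-u(y)|^p}{|x-y|^{n+\delta p}}\,dy\,M_{\delta p,Q}(w)(x)\,dx\right)^{\frac1p}.$$
   Context: A cube in $\mathbb{R}^n$ is a cartesian product of $n$ intervals of the same side length $\ell(Q)$. A weight is a function $w\in L^1_{\mathrm{loc}}(\mathbb{R}^n)$ with $w(x)>0$ for a.e. $x$; $w(Q)=\int_Q w\,dx$. For $1<q<\infty$, $w\in A_q$ means $\sup_Q \left(\frac1{|Q|}\int_Q w\,dx\right)\left(\frac1{|Q|}\int_Q w^{1-q'}\,dx\right)^{q-1}<\infty$ (sup over all cubes, $q'=q/(q-1)$); $w\in A_1$ means there is $C>0$ with $\frac1{|Q|}\int_Q w\,dx\le C\operatorname{ess\,inf}_{Q}w$ for all cubes $Q$. $A_\infty=\bigcup_{1\le q<\infty}A_q$ and $[w]_{A_\infty}=\sup_Q\frac1{w(Q)}\int_Q M(w\chi_Q)(x)\,dx$, where $Mf(x)=\sup_{R\ni x}\frac1{|R|}\int_R|f|\,dy$ (sup over all cubes $R$ containing $x$). For $\alpha\ge0$ and a cube $Q_0$,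 the local fractional maximal function is $M_{\alpha,Q_0}f(x)=\sup \ell(R)^\alpha\frac1{|R|}\int_R|f(y)|\,dy$, $x\in Q_0$, the supremum over all cubes $R\subset Q_0$ with $x\in R$. *)

theory Defs
  imports "HOL-Analysis.Analysis"
begin

text \<open>
  All integrals of nonnegative functions are taken in \<^typ>\<open>ennreal\<close> with respect to Lebesgue
  measure, so that every quantity below has a value in $[0,\infty]$.
\<close>

(* Only used with exponents a > 0; for such a, the value at 0 is 0 because 0 powr a = 0. *)
definition epowr :: "ennreal \<Rightarrow> real \<Rightarrow> ennreal" where
  "epowr x a = (if x = top then top else ennreal (enn2real x powr a))"

(* The intervals may be open, closed or half-open; the side length l is positive and finite. *)
definition cube :: "real \<Rightarrow> (real ^ 'n::finite) set \<Rightarrow> bool" where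
  "cube l Q \<longleftrightarrow> 0 < l \<and>
    (\<exists>J :: 'n \<Rightarrow> real set. (\<forall>i. is_interval (J i) \<and> emeasure lborel (J i) = ennreal l) \<and>
       Q = {x. \<forall>i. x $ i \<in> J i})"

definition cubes :: "(real ^ 'n::finite) set set" where
  "cubes = {Q. \<exists>l. cube l Q}"

definition average :: "(real ^ 'n::finite) set \<Rightarrow> (real ^ 'n \<Rightarrow> ennreal) \<Rightarrow> ennreal" where
  "average Q g = (\<integral>\<^sup>+x\<in>Q. g x \<partial>lebesgue) / emeasure lebesgue Q"

definition locally_integrable :: "(real ^ 'n::finite \<Rightarrow> real) \<Rightarrow> bool" where
  "locally_integrable f \<longleftrightarrow> (\<forall>K. compact K \<longrightarrow> set_integrable lebesgue K f)"

definition weight :: "(real ^ 'n::finite \<Rightarrow> real) \<Rightarrow> bool" where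
  "weight w \<longleftrightarrow> locally_integrable w \<and> (AE x in lebesgue. 0 < w x)"

definition weight_measure :: "(real ^ 'n::finite \<Rightarrow> real) \<Rightarrow> (real ^ 'n) set \<Rightarrow> ennreal" where
  "weight_measure w Q = (\<integral>\<^sup>+x\<in>Q. ennreal (w x) \<partial>lebesgue)"

definition ess_inf_on :: "(real ^ 'n::finite) set \<Rightarrow> (real ^ 'n \<Rightarrow> real) \<Rightarrow> ennreal" where
  "ess_inf_on Q w = Sup {m. AE x in lebesgue. x \<in> Q \<longrightarrow> m \<le> ennreal (w x)}"

definition A1_class :: "(real ^ 'n::finite \<Rightarrow> real) set" where
  "A1_class = {w. weight w \<and>
     (\<exists>C>0. \<forall>Q\<in>cubes. average Q (\<lambda>x. ennreal (w x)) \<le> ennreal C * ess_inf_on Q w)}"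

(* For 1 < q; the exponent of the dual weight is 1 - q' with q' = q / (q - 1). *)
definition Aq_class :: "real \<Rightarrow> (real ^ 'n::finite \<Rightarrow> real) set" where
  "Aq_class q = {w. weight w \<and>
     (SUP Q\<in>cubes. average Q (\<lambda>x. ennreal (w x)) *
        epowr (average Q (\<lambda>x. ennreal (w x powr (1 - q / (q - 1))))) (q - 1)) < top}"

definition A_infinity :: "(real ^ 'n::finite \<Rightarrow> real) set" where
  "A_infinity = A1_class \<union> (\<Union>q\<in>{1<..}. Aq_class q)"

definition maximal :: "(real ^ 'n::finite \<Rightarrow> real) \<Rightarrow> real ^ 'n \<Rightarrow> ennreal" where
  "maximal f x = (SUP R\<in>{R\<in>cubes. x \<in> R}. average R (\<lambda>y. ennreal \<bar>f y\<bar>))"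

definition A_infinity_const :: "(real ^ 'n::finite \<Rightarrow> real) \<Rightarrow> ennreal" where
  "A_infinity_const w =
     (SUP Q\<in>cubes. (\<integral>\<^sup>+x\<in>Q. maximal (\<lambda>y. w y * indicator Q y) x \<partial>lebesgue) / weight_measure w Q)"

definition local_fractional_maximal ::
  "real \<Rightarrow> (real ^ 'n::finite) set \<Rightarrow> (real ^ 'n \<Rightarrow> real) \<Rightarrow> real ^ 'n \<Rightarrow> ennreal" where
  "local_fractional_maximal \<alpha> Q\<^sub>0 f x =
     Sup {ennreal (l powr \<alpha>) * average R (\<lambda>y. ennreal \<bar>f y\<bar>) | l R. cube l R \<and> R \<subseteq> Q\<^sub>0 \<and> x \<in> R}"

end

theory Submission
  imports Defs "HOL-Probability.Distribution_Functions"
begin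

text \<open>
  The inequality combines an unweighted estimate, which produces the factor $1-\delta$, with a
  decay estimate for the weight, which produces the factor $p\,[w]_{A_\infty}$.

  Unweighted part.  Let $R$ be convex of diameter at most $d$ in $\mathbb{R}^n$.  Cutting the segment
  from $x$ to $y$ into $K$ equal pieces and using convexity of $t^p$ gives
  $D = \int_R\int_R |v(x)-v(y)|^p \le K^{n+p} \int_{|h|\le d/K} \int |v(z+h)-v(z)|^p\,dz\,dh$,
  with constant one, so nothing accumulates when $K$ runs through the powers of two.  Multiplying
  by $K^{-p(1-\delta)} = K^{n+\delta p}/K^{n+p}$ and summing over $K = 2^k$ produces
  $D/(1-2^{-p(1-\delta)})$ on the left and the Gagliardo integral on the right, and
  $1-2^{-p(1-\delta)} \le p(1-\delta)$ is the required gain (\<open>fractional_poincare_convex\<close>).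
  It follows that a dyadic cell $R$ on which $v$ has mean oscillation larger than $t$ satisfies
  $t^p |R| \le C^p (1-\delta)\,\ell(R)^{\delta p} \int_R\int_R |v(x)-v(y)|^p/|x-y|^{n+\delta p}$.
  Multiplying by the mean of $w$ over $R$ brings in the fractional maximal function of $w$, and a sum
  over the disjoint maximal cells of this kind bounds $t^p\,w(\Omega_t)$, where $\Omega_t$ is the
  union of the oscillating cells (\<open>weight_oscillating_le_energy\<close>).

  Weighted part.  Let $S_c$ be the union of the dyadic cells on which the mean of $v$ exceeds $c$.
  Every maximal cell $R$ of $S_c$ that is not contained in $\Omega_t$ has at least half of its volume
  outside $S_{c+d}$, where $d = (2^n+2)t$.  So $w(R)$ is at most twice the integral over
  $R \cap (S_c - S_{c+d})$ of the dyadic maximal function of $w$.  The slices for $c, c+d, c+2d, \ldots$ are disjoint and the integral of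
  the maximal function over a cell is at most $[w]_{A_\infty}$ times the weight of the cell, hence
  $N\,w(S_{c+Nd} - \Omega_t) \le 2 [w]_{A_\infty} w(S_c)$ (\<open>weight_superlevel_decay\<close>).
  With $N$ about $8[w]_{A_\infty}$ the weight drops by the factor four; choosing $t$ so that $Nd$ is the
  fraction $1/p$ of the level, the loss $(1+1/p)^p \le 3$ is absorbed by this factor four, and a weak
  type inequality with constant of order $(p\,[w]_{A_\infty})^p$ results
  (\<open>weak_type_from_oscillating_cells\<close>).

  Strong type.  The weak type inequality is applied to the truncations of $u$ between the levels
  $c+\varepsilon 2^k$ and $c+\varepsilon 2^{k+1}$, where $c$ is a median of $u$ with respect to $w$.
  The increments of the truncations add up to at most the increment of $u$, so their energies add up to
  at most the energy of $u$ (\<open>weighted_poincare\<close>).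

  If $[w]_{A_\infty} = \infty$, the right-hand side is infinite unless the energy vanishes, and then the
  unweighted part shows that $u$ is constant almost everywhere on the cube.
\<close>

section \<open>Averages and mean oscillation\<close>

lemma emeasure_Union_mono_disjoint:
  assumes "countable F" "disjoint F" "F \<subseteq> sets M" "sets N = sets M"
    and le: "\<And>R. R \<in> F \<Longrightarrow> emeasure M R \<le> emeasure N R"
  shows "emeasure M (\<Union>F) \<le> emeasure N (\<Union>F)"
proof -
  have dis: "disjoint_family_on (\<lambda>R. R) F"
    using assms(2) by (auto simp: disjoint_family_on_def disjoint_def)
  have "emeasure M (\<Union>((\<lambda>R. R) ` F)) = (\<integral>\<^sup>+R. emeasure M R \<partial>count_space F)"
    using assms dis by (intro emeasure_UN_countable) auto
  moreover have "emeasure N (\<Union>((\<lambda>R. R) ` F)) = (\<integral>\<^sup>+R. emeasure N R \<partial>count_space F)"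
    using assms dis by (intro emeasure_UN_countable) auto
  moreover have "(\<integral>\<^sup>+R. emeasure M R \<partial>count_space F) \<le> (\<integral>\<^sup>+R. emeasure N R \<partial>count_space F)"
    using le by (intro nn_integral_mono) auto
  ultimately show ?thesis by simp
qed

lemma set_nn_integral_Union_mono_disjoint:
  fixes f g :: "'a::euclidean_space \<Rightarrow> ennreal"
  assumes "countable F" "disjoint F" "F \<subseteq> sets borel"
    and [measurable]: "f \<in> borel_measurable borel" "g \<in> borel_measurable borel"
    and le: "\<And>R. R \<in> F \<Longrightarrow> (\<integral>\<^sup>+x\<in>R. f x \<partial>lborel) \<le> (\<integral>\<^sup>+x\<in>R. g x \<partial>lborel)"
  shows "(\<integral>\<^sup>+x\<in>\<Union>F. f x \<partial>lborel) \<le> (\<integral>\<^sup>+x\<in>\<Union>F. g x \<partial>lborel)"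
proof -
  have U: "\<Union>F \<in> sets borel" using assms(1,3) by (intro sets.countable_Union) auto
  have "emeasure (density lborel f) (\<Union>F) \<le> emeasure (density lborel g) (\<Union>F)"
    using assms by (intro emeasure_Union_mono_disjoint) (auto simp: emeasure_density subset_iff)
  then show ?thesis using U by (simp add: emeasure_density)
qed

definition mean :: "('a::euclidean_space \<Rightarrow> real) \<Rightarrow> 'a set \<Rightarrow> real" where
  "mean f R = (LINT x:R|lborel. f x) / measure lborel R"

lemma set_integrable_bounded:
  fixes f :: "'a::euclidean_space \<Rightarrow> real"
  assumes "R \<in> sets borel" "emeasure lborel R < top" "f \<in> borel_measurable borel" "\<And>x. \<bar>f x\<bar> \<le> b"
  shows "set_integrable lborel R f"
  unfolding set_integrable_def using assms
  by (intro integrableI_bounded_set_indicator[where B=b]) auto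

lemma mean_diff:
  fixes f :: "'a::euclidean_space \<Rightarrow> real"
  assumes R: "R \<in> sets borel" "emeasure lborel R < top" "0 < measure lborel R"
    and f: "f \<in> borel_measurable borel" "\<And>x. \<bar>f x\<bar> \<le> b"
  shows "(mean f R - c) * measure lborel R = (LINT x:R|lborel. f x - c)"
proof -
  have "set_integrable lborel R (\<lambda>_. c)"
    using R by (intro set_integrable_bounded[where b="\<bar>c\<bar>"]) auto
  then have "(LINT x:R|lborel. f x - c) = (LINT x:R|lborel. f x) - (LINT x:R|lborel. c)"
    using set_integrable_bounded[OF R(1,2) f] by (intro set_integral_diff) auto
  also have "(LINT x:R|lborel. c) = c * measure lborel R"
    using R by (simp add: set_integral_const)
  finally have "(LINT x:R|lborel. f x - c) = (LINT x:R|lborel. f x) - c * measure lborel R" .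
  moreover have "mean f R * measure lborel R = (LINT x:R|lborel. f x)"
    using R(3) by (simp add: mean_def)
  ultimately show ?thesis by (simp add: left_diff_distrib)
qed

text \<open>
  The only way in which averages are compared below: a change of the average from $c$ costs at least
  that much mean deviation from $c$.  Applied on a subset of a larger set it yields both the stability of
  averages between parent and child cells and the smallness of the set of cells with much larger average.
\<close>

lemma mean_deviation:
  fixes f :: "'a::euclidean_space \<Rightarrow> real"
  assumes R: "R \<in> sets borel" "emeasure lborel R < top" "0 < measure lborel R"
    and f: "f \<in> borel_measurable borel" "\<And>x. \<bar>f x\<bar> \<le> b"
  shows "ennreal (\<bar>mean f R - c\<bar> * measure lborel R) \<le> (\<integral>\<^sup>+x\<in>R. ennreal \<bar>f x - c\<bar> \<partial>lborel)"
proof -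
  have "\<bar>f x - c\<bar> \<le> b + \<bar>c\<bar>" for x using f(2)[of x] by linarith
  then have int: "set_integrable lborel R (\<lambda>x. f x - c)"
    using R f(1) by (intro set_integrable_bounded[where b="b + \<bar>c\<bar>"]) auto
  have "\<bar>mean f R - c\<bar> * measure lborel R = \<bar>LINT x:R|lborel. f x - c\<bar>"
    using mean_diff[OF R f, of c, symmetric] R(3) by (simp add: abs_mult)
  then have "ennreal (\<bar>mean f R - c\<bar> * measure lborel R)
      = ennreal (norm (LINT x:R|lborel. f x - c))" by simp
  also have "\<dots> \<le> (\<integral>\<^sup>+x. norm (indicator R x *\<^sub>R (f x - c)) \<partial>lborel)"
    unfolding set_lebesgue_integral_def
    using int integral_norm_bound_ennreal unfolding set_integrable_def by blast
  also have "\<dots> = (\<integral>\<^sup>+x\<in>R. ennreal \<bar>f x - c\<bar> \<partial>lborel)"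
    by (intro nn_integral_cong) (auto split: split_indicator)
  finally show ?thesis .
qed

text \<open>
  Adding the bound $b$ makes the integrand nonnegative, so that the average of a signed function can be
  handled by measures and their countable additivity.
\<close>

lemma nn_integral_shift_eq_mean:
  fixes f :: "'a::euclidean_space \<Rightarrow> real"
  assumes R: "R \<in> sets borel" "emeasure lborel R < top" "0 < measure lborel R"
    and f: "f \<in> borel_measurable borel" "\<And>x. \<bar>f x\<bar> \<le> b"
  shows "(\<integral>\<^sup>+x\<in>R. ennreal (f x + b) \<partial>lborel) = ennreal ((mean f R + b) * measure lborel R)"
proof -
  have pos: "0 \<le> f x + b" for x using f(2)[of x] by auto
  have "\<bar>f x + b\<bar> \<le> 2*b" for x using f(2)[of x] by auto
  then have int: "set_integrable lborel R (\<lambda>x. f x + b)"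
    using R f by (intro set_integrable_bounded[where b="2*b"]) auto
  have "(\<integral>\<^sup>+x\<in>R. ennreal (f x + b) \<partial>lborel)
      = (\<integral>\<^sup>+x. ennreal (indicator R x *\<^sub>R (f x + b)) \<partial>lborel)"
    by (intro nn_integral_cong) (auto split: split_indicator)
  also have "\<dots> = ennreal (LINT x:R|lborel. f x + b)"
    unfolding set_lebesgue_integral_def using int pos
    by (intro nn_integral_eq_integral) (auto simp: set_integrable_def)
  also have "(LINT x:R|lborel. f x + b) = (mean f R + b) * measure lborel R"
    using mean_diff[OF R f, of "-b"] by simp
  finally show ?thesis .
qed

lemma mean_oscillation_le_double_integral:
  fixes f :: "'a::euclidean_space \<Rightarrow> real"
  assumes R: "R \<in> sets borel" "emeasure lborel R < top" "0 < measure lborel R"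
    and f: "f \<in> borel_measurable borel" "\<And>x. \<bar>f x\<bar> \<le> b"
  shows "(\<integral>\<^sup>+x\<in>R. ennreal \<bar>f x - mean f R\<bar> \<partial>lborel) * ennreal (measure lborel R)
    \<le> (\<integral>\<^sup>+x\<in>R. (\<integral>\<^sup>+y\<in>R. ennreal \<bar>f x - f y\<bar> \<partial>lborel) \<partial>lborel)"
proof -
  note [measurable] = R(1) f(1)
  have "(\<integral>\<^sup>+x\<in>R. ennreal \<bar>f x - mean f R\<bar> \<partial>lborel) * ennreal (measure lborel R)
    = (\<integral>\<^sup>+x. ennreal (\<bar>mean f R - f x\<bar> * measure lborel R) * indicator R x \<partial>lborel)"
    by (subst nn_integral_multc[symmetric])
       (auto intro!: nn_integral_cong simp: ennreal_mult' abs_minus_commute mult_ac)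
  also have "\<dots> \<le> (\<integral>\<^sup>+x\<in>R. (\<integral>\<^sup>+y\<in>R. ennreal \<bar>f x - f y\<bar> \<partial>lborel) \<partial>lborel)"
    using mean_deviation[OF R f] 
    by (intro nn_integral_mono mult_right_mono) (auto simp: abs_minus_commute)
  finally show ?thesis .
qed

section \<open>Trees of cells\<close>

text \<open>
  Everything that the weighted argument uses about the dyadic subcubes of a cube: nested partitions
  \<open>cell k\<close> of a base set in which volume shrinks by the factor \<open>\<theta>\<close> at each step and which
  eventually enter every neighbourhood of a point.  Here \<open>cell k x\<close> is the cell of generation
  \<open>k\<close> that contains the point \<open>x\<close>.
\<close>

locale cell_tree =
  fixes base :: "'a::euclidean_space set" and cell :: "nat \<Rightarrow> 'a \<Rightarrow> 'a set" and \<theta> :: real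
  assumes base_nonempty: "base \<noteq> {}"
    and cell_0: "x \<in> base \<Longrightarrow> cell 0 x = base"
    and mem_cell: "x \<in> base \<Longrightarrow> x \<in> cell k x"
    and cell_Suc: "x \<in> base \<Longrightarrow> cell (Suc k) x \<subseteq> cell k x"
    and cell_eq: "x \<in> base \<Longrightarrow> y \<in> cell k x \<Longrightarrow> cell k y = cell k x"
    and countable_cells': "countable {cell k x | k x. x \<in> base}"
    and cell_borel: "x \<in> base \<Longrightarrow> cell k x \<in> sets borel"
    and base_finite: "emeasure lborel base < top"
    and cell_pos: "x \<in> base \<Longrightarrow> 0 < measure lborel (cell k x)"
    and cell_ratio: "x \<in> base \<Longrightarrow> measure lborel (cell k x) = \<theta> * measure lborel (cell (Suc k) x)"
    and ratio_gt_1: "1 < \<theta>"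
    and cell_small: "x \<in> base \<Longrightarrow> open U \<Longrightarrow> x \<in> U \<Longrightarrow> \<exists>k. cell k x \<subseteq> U"
begin

definition cells :: "'a set set" where
  "cells = {cell k x | k x. x \<in> base}"

definition maximal_cells :: "'a set set \<Rightarrow> 'a set set" where
  "maximal_cells C = {R \<in> C. \<forall>S\<in>C. R \<subseteq> S \<longrightarrow> S = R}"

definition superlevel :: "('a \<Rightarrow> real) \<Rightarrow> real \<Rightarrow> 'a set" where
  "superlevel f c = \<Union>{R \<in> cells. c < mean f R}"

definition oscillating :: "('a \<Rightarrow> real) \<Rightarrow> real \<Rightarrow> 'a set set" where
  "oscillating f t = {R \<in> cells.
     ennreal (t * measure lborel R) < (\<integral>\<^sup>+x\<in>R. ennreal \<bar>f x - mean f R\<bar> \<partial>lborel)}"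

lemma countable_cells: "countable cells"
  using countable_cells' unfolding cells_def .

lemma cell_antimono: "x \<in> base \<Longrightarrow> j \<le> k \<Longrightarrow> cell k x \<subseteq> cell j x"
  by (rule lift_Suc_antimono_le[of "\<lambda>k. cell k x"]) (use cell_Suc in auto)

lemma cell_subset_base: "x \<in> base \<Longrightarrow> cell k x \<subseteq> base"
  using cell_antimono[of x 0 k] cell_0 by auto

lemma cellsD:
  assumes "R \<in> cells"
  shows "R \<in> sets borel" "R \<subseteq> base" "emeasure lborel R < top" "0 < measure lborel R"
    and "emeasure lborel R = ennreal (measure lborel R)"
proof -
  obtain k x where R: "R = cell k x" and x: "x \<in> base" using assms by (auto simp: cells_def)
  show 1: "R \<in> sets borel" "R \<subseteq> base" "0 < measure lborel R"
    using R x cell_borel cell_subset_base cell_pos by auto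
  have "base \<in> sets borel" using cell_borel[OF x, of 0] cell_0[OF x] by simp
  then show "emeasure lborel R < top"
    using 1(2) base_finite emeasure_mono[of R base lborel] by (auto intro: le_less_trans)
  then show "emeasure lborel R = ennreal (measure lborel R)"
    by (intro emeasure_eq_ennreal_measure) auto
qed

lemma base_in_cells: "base \<in> cells"
  using base_nonempty cell_0 by (fastforce simp: cells_def)

lemma base_borel [measurable]: "base \<in> sets borel"
  using cellsD(1)[OF base_in_cells] .

lemma cells_as_cell: "R \<in> cells \<Longrightarrow> z \<in> R \<Longrightarrow> \<exists>k. R = cell k z"
  using cell_eq by (fastforce simp: cells_def)

lemma cells_nested:
  assumes "R \<in> cells" "S \<in> cells" "R \<inter> S \<noteq> {}"
  shows "R \<subseteq> S \<or> S \<subseteq> R"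
proof -
  obtain z where z: "z \<in> R" "z \<in> S" using assms(3) by auto
  obtain j k where "R = cell j z" "S = cell k z"
    using cells_as_cell[OF assms(1) z(1)] cells_as_cell[OF assms(2) z(2)] by auto
  moreover have "z \<in> base" using assms(1) z cellsD(2) by auto
  ultimately show ?thesis using cell_antimono[of z j k] cell_antimono[of z k j] by (meson nat_le_linear)
qed

lemma cells_parent:
  assumes "R \<in> cells" "R \<noteq> base"
  obtains P where "P \<in> cells" "R \<subseteq> P" "P \<noteq> R" "measure lborel P = \<theta> * measure lborel R"
proof -
  obtain k x where R: "R = cell k x" and x: "x \<in> base" using assms by (auto simp: cells_def)
  have "k \<noteq> 0" using R assms(2) cell_0[OF x] by metis
  then obtain j where k: "k = Suc j" using not0_implies_Suc by blast
  have m: "measure lborel (cell j x) = \<theta> * measure lborel R" using cell_ratio[OF x, of j] R k by simp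
  have "cell j x \<noteq> R"
  proof
    assume "cell j x = R"
    then have "(\<theta> - 1) * measure lborel R = 0" using m by (simp add: algebra_simps)
    then show False using ratio_gt_1 cellsD(4)[OF assms(1)] by simp
  qed
  moreover have "cell j x \<in> cells" using x by (auto simp: cells_def)
  moreover have "R \<subseteq> cell j x" using R k cell_Suc x by auto
  ultimately show thesis using that m by blast
qed

lemma maximal_cells_subset: "maximal_cells C \<subseteq> C"
  by (auto simp: maximal_cells_def)

lemma maximal_cells_disjoint:
  assumes "C \<subseteq> cells"
  shows "disjoint (maximal_cells C)"
proof (rule disjointI)
  fix R S assume RS: "R \<in> maximal_cells C" "S \<in> maximal_cells C" "R \<noteq> S"
  show "R \<inter> S = {}"
  proof (rule ccontr)
    assume "R \<inter> S \<noteq> {}"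
    then have "R \<subseteq> S \<or> S \<subseteq> R" using cells_nested RS(1,2) assms maximal_cells_subset by blast
    then show False using RS by (auto simp: maximal_cells_def)
  qed
qed

lemma maximal_cells_countable: "C \<subseteq> cells \<Longrightarrow> countable (maximal_cells C)"
  using countable_cells maximal_cells_subset by (meson countable_subset)

lemma maximal_cells_borel: "C \<subseteq> cells \<Longrightarrow> maximal_cells C \<subseteq> sets borel"
  using cellsD(1) maximal_cells_subset by blast

lemma Union_cells_borel: "C \<subseteq> cells \<Longrightarrow> \<Union>C \<in> sets borel"
  using cellsD(1) countable_subset[OF _ countable_cells] by (intro sets.countable_Union) auto

text \<open>
  Of two cells that meet one contains the other, so the cells through a point form a chain indexed by
  the generation.  The least generation whose cell belongs to the family gives a maximal member: every
  family of cells has the same union as its disjoint subfamily of maximal members.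
\<close>

lemma maximal_cells_Union:
  assumes "C \<subseteq> cells"
  shows "\<Union>(maximal_cells C) = \<Union>C"
proof (intro equalityI subsetI)
  fix x assume "x \<in> \<Union>C"
  then obtain R where R: "R \<in> C" "x \<in> R" by auto
  then have x: "x \<in> base" using assms cellsD(2) by blast
  have ex: "\<exists>k. cell k x \<in> C" using cells_as_cell[of R x] R assms by auto
  define k where "k = (LEAST k. cell k x \<in> C)"
  have k: "cell k x \<in> C" unfolding k_def using ex by (rule LeastI_ex)
  have "S = cell k x" if S: "S \<in> C" "cell k x \<subseteq> S" for S
  proof -
    have "x \<in> S" using S mem_cell[OF x] by auto
    then obtain j where j: "S = cell j x" using cells_as_cell S assms by blast
    have "k \<le> j" unfolding k_def using S j by (auto intro: Least_le)
    then show ?thesis using cell_antimono[OF x] j S by auto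
  qed
  then show "x \<in> \<Union>(maximal_cells C)"
    using k mem_cell[OF x] by (auto simp: maximal_cells_def)
qed (auto simp: maximal_cells_def)

lemma superlevel_borel [measurable]: "superlevel f c \<in> sets borel"
  unfolding superlevel_def by (rule Union_cells_borel) auto

lemma oscillating_borel [measurable]: "\<Union>(oscillating f t) \<in> sets borel"
  unfolding oscillating_def by (rule Union_cells_borel) auto

lemma superlevel_subset_base: "superlevel f c \<subseteq> base"
  unfolding superlevel_def using cellsD(2) by auto

lemma superlevel_antimono: "c \<le> d \<Longrightarrow> superlevel f d \<subseteq> superlevel f c"
  unfolding superlevel_def by force

end


context cell_tree
begin

section \<open>Decay of the weight of superlevel sets\<close>

lemma superlevel_eq_Union_maximal:
  "superlevel f c = \<Union>(maximal_cells {R \<in> cells. c < mean f R})"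
  unfolding superlevel_def by (subst maximal_cells_Union) auto

text \<open>
  The parent of a maximal cell has average at most $c$, and since the cell contains a point outside the
  oscillating cells, the parent has mean oscillation at most $t$.  Passing to the child multiplies the
  oscillation by at most the volume ratio \<open>\<theta>\<close>.
\<close>

lemma maximal_cell_mean_le:
  assumes f: "f \<in> borel_measurable borel" "\<And>x. \<bar>f x\<bar> \<le> b"
    and base: "mean f base \<le> c" and t: "0 < t"
    and R: "R \<in> maximal_cells {R \<in> cells. c < mean f R}"
    and z: "z \<in> R" "z \<notin> \<Union>(oscillating f t)"
  shows "mean f R \<le> c + \<theta> * t"
proof -
  have Rc: "R \<in> cells" "c < mean f R" using R by (auto simp: maximal_cells_def)
  then have "R \<noteq> base" using base by auto
  then obtain P where P: "P \<in> cells" "R \<subseteq> P" "P \<noteq> R" "measure lborel P = \<theta> * measure lborel R"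
    using cells_parent Rc by metis
  have mP: "mean f P \<le> c" using R P by (auto simp: maximal_cells_def not_less[symmetric])
  have "ennreal (\<bar>mean f R - mean f P\<bar> * measure lborel R) \<le> (\<integral>\<^sup>+x\<in>R. ennreal \<bar>f x - mean f P\<bar> \<partial>lborel)"
    using cellsD[OF Rc(1)] f by (intro mean_deviation) auto
  also have "\<dots> \<le> (\<integral>\<^sup>+x\<in>P. ennreal \<bar>f x - mean f P\<bar> \<partial>lborel)"
    using P(2) by (intro nn_integral_mono) (auto split: split_indicator)
  also have "\<dots> \<le> ennreal (t * measure lborel P)"
    using z P by (auto simp: oscillating_def not_less)
  finally have "\<bar>mean f R - mean f P\<bar> * measure lborel R \<le> t * \<theta> * measure lborel R"
    using P t ratio_gt_1 by (subst (asm) ennreal_le_iff) auto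
  then have "\<bar>mean f R - mean f P\<bar> \<le> t * \<theta>" using cellsD(4)[OF Rc(1)] by simp
  then show ?thesis using mP by (simp add: mult.commute)
qed

text \<open>
  By the previous lemma the average over $R$ is at most $c + \theta t$, so inside $R$ the next superlevel set
  is a disjoint union of cells on which the average exceeds that of $R$ by $2t$.  Their total volume is
  bounded by the oscillation of $R$, at most $t |R|$, divided by $2t$.
\<close>

lemma next_superlevel_half:
  assumes f: "f \<in> borel_measurable borel" "\<And>x. \<bar>f x\<bar> \<le> b"
    and base: "mean f base \<le> c" and t: "0 < t"
    and R: "R \<in> maximal_cells {R \<in> cells. c < mean f R}"
    and good: "\<not> R \<subseteq> \<Union>(oscillating f t)"
  shows "2 * emeasure lborel (R \<inter> superlevel f (c + (\<theta> + 2) * t)) \<le> emeasure lborel R"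
proof -
  note [measurable] = f(1)
  let ?C = "{R \<in> cells. c + (\<theta> + 2) * t < mean f R}"
  define F where "F = {S \<in> maximal_cells ?C. S \<subseteq> R}"
  obtain z where z: "z \<in> R" "z \<notin> \<Union>(oscillating f t)" using good by auto
  have Rc: "R \<in> cells" "c < mean f R" using R by (auto simp: maximal_cells_def)
  note mR = maximal_cell_mean_le[OF f base t R z]
  have oscR: "(\<integral>\<^sup>+x\<in>R. ennreal \<bar>f x - mean f R\<bar> \<partial>lborel) \<le> ennreal (t * measure lborel R)"
    using z Rc by (auto simp: oscillating_def not_less)
  have F_cells: "F \<subseteq> cells" unfolding F_def maximal_cells_def by auto
  have F_eq: "\<Union>F = R \<inter> superlevel f (c + (\<theta> + 2) * t)"
  proof (intro equalityI subsetI)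
    fix x assume x: "x \<in> R \<inter> superlevel f (c + (\<theta> + 2) * t)"
    then obtain S where S: "S \<in> maximal_cells ?C" "x \<in> S" 
      by (auto simp: superlevel_eq_Union_maximal)
    have Sc: "S \<in> cells" "c + (\<theta> + 2) * t < mean f S" using S by (auto simp: maximal_cells_def)
    have "0 < (\<theta> + 2) * t" using t ratio_gt_1 by (intro mult_pos_pos) auto
    then have "c < mean f S" using Sc(2) by linarith
    then have "R \<subseteq> S \<Longrightarrow> S = R" using R Sc by (auto simp: maximal_cells_def)
    then have "S \<subseteq> R" using cells_nested[OF Sc(1) Rc(1)] S x by auto
    then show "x \<in> \<Union>F" using S by (auto simp: F_def)
  qed (auto simp: F_def superlevel_eq_Union_maximal)
  have "(\<integral>\<^sup>+x\<in>\<Union>F. ennreal (2 * t) \<partial>lborel) \<le> (\<integral>\<^sup>+x\<in>\<Union>F. ennreal \<bar>f x - mean f R\<bar> \<partial>lborel)"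
  proof (rule set_nn_integral_Union_mono_disjoint)
    show "countable F" using F_cells countable_cells countable_subset by blast
    show "disjoint F" using maximal_cells_disjoint[of ?C] unfolding F_def disjoint_def by auto
    show "F \<subseteq> sets borel" using F_cells cellsD(1) by blast
    fix S assume "S \<in> F"
    then have S: "S \<in> cells" "c + (\<theta> + 2) * t < mean f S" by (auto simp: F_def maximal_cells_def)
    have "2 * t \<le> \<bar>mean f S - mean f R\<bar>" using S(2) mR by (simp add: algebra_simps)
    then have "ennreal (2 * t * measure lborel S) \<le> ennreal (\<bar>mean f S - mean f R\<bar> * measure lborel S)"
      by (intro ennreal_leI mult_right_mono) auto
    also have "\<dots> \<le> (\<integral>\<^sup>+x\<in>S. ennreal \<bar>f x - mean f R\<bar> \<partial>lborel)"
      using cellsD[OF S(1)] f by (intro mean_deviation) auto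
    finally show "(\<integral>\<^sup>+x\<in>S. ennreal (2 * t) \<partial>lborel) \<le> (\<integral>\<^sup>+x\<in>S. ennreal \<bar>f x - mean f R\<bar> \<partial>lborel)"
      using cellsD[OF S(1)] t by (simp add: nn_integral_cmult_indicator ennreal_mult')
  qed auto
  also have "\<dots> \<le> (\<integral>\<^sup>+x\<in>R. ennreal \<bar>f x - mean f R\<bar> \<partial>lborel)"
    by (intro nn_integral_mono) (auto simp: F_def split: split_indicator)
  also note oscR
  finally have "ennreal (2*t) * emeasure lborel (\<Union>F) \<le> ennreal t * emeasure lborel R"
    using cellsD[OF Rc(1)] t Union_cells_borel[OF F_cells]
    by (simp add: nn_integral_cmult_indicator ennreal_mult')
  moreover have "ennreal (2*t) = ennreal t * 2" using t by (simp add: ennreal_mult' mult.commute)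
  ultimately have "ennreal t * (2 * emeasure lborel (\<Union>F)) \<le> ennreal t * emeasure lborel R"
    by (simp add: mult.assoc)
  then have "2 * emeasure lborel (\<Union>F) \<le> emeasure lborel R"
    using t by (simp add: ennreal_mult_le_mult_iff)
  then show ?thesis by (simp add: F_eq)
qed

definition cell_average :: "('a \<Rightarrow> ennreal) \<Rightarrow> 'a set \<Rightarrow> ennreal" where
  "cell_average w R = (\<integral>\<^sup>+x\<in>R. w x \<partial>lborel) / emeasure lborel R"

text \<open>
  The dyadic maximal function relative to a cell \<open>P\<close>.  Being a countable supremum it is Borel
  measurable, so its integrals over disjoint sets add up.  For dyadic cubes it lies below the maximal function over
  all cubes.
\<close>

definition cell_maximal :: "('a \<Rightarrow> ennreal) \<Rightarrow> 'a set \<Rightarrow> 'a \<Rightarrow> ennreal" where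
  "cell_maximal w P x = (SUP S\<in>{S\<in>cells. S \<subseteq> P}. cell_average w S * indicator S x)"

lemma cell_maximal_borel [measurable]: "cell_maximal w P \<in> borel_measurable borel"
  unfolding cell_maximal_def
proof (rule borel_measurable_SUP)
  show "countable {S\<in>cells. S \<subseteq> P}" using countable_cells by (rule countable_subset[rotated]) auto
  fix S assume "S \<in> {S\<in>cells. S \<subseteq> P}"
  then have [measurable]: "S \<in> sets borel" using cellsD(1) by auto
  show "(\<lambda>x. cell_average w S * indicator S x) \<in> borel_measurable borel" by measurable
qed

lemma cell_maximal_ge: "S \<in> cells \<Longrightarrow> S \<subseteq> P \<Longrightarrow> x \<in> S \<Longrightarrow> cell_average w S \<le> cell_maximal w P x"
  unfolding cell_maximal_def by (rule SUP_upper2[of S]) auto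

lemma cell_average_mult:
  assumes "R \<in> cells" shows "cell_average w R * emeasure lborel R = (\<integral>\<^sup>+x\<in>R. w x \<partial>lborel)"
  using cellsD[OF assms] by (simp add: cell_average_def ennreal_divide_times ennreal_mult_divide_eq)

text \<open>
  On a maximal cell $R$ of level $c$ the weight of $R$ is its average times $|R|$, the average is a lower
  bound for the maximal function on $R$, and at least half of $R$ survives outside the next superlevel set.
\<close>

lemma weight_le_maximal_on_slice:
  assumes f: "f \<in> borel_measurable borel" "\<And>x. \<bar>f x\<bar> \<le> b"
    and w [measurable]: "w \<in> borel_measurable borel"
    and base: "mean f base \<le> c" and t: "0 < t"
    and P: "P \<in> cells" 
    and P_max: "\<And>R. R \<in> cells \<Longrightarrow> c < mean f R \<Longrightarrow> P \<subseteq> R \<Longrightarrow> R = P"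
  shows "(\<integral>\<^sup>+x\<in>P \<inter> superlevel f c - \<Union>(oscillating f t). w x \<partial>lborel)
    \<le> 2 * (\<integral>\<^sup>+x\<in>P \<inter> superlevel f c - superlevel f (c + (\<theta> + 2) * t). cell_maximal w P x \<partial>lborel)"
proof -
  let ?C = "{R \<in> cells. c < mean f R}" and ?S = "superlevel f (c + (\<theta> + 2) * t)"
  let ?g = "\<lambda>x. 2 * cell_maximal w P x * indicator (- ?S) x"
  define G where "G = {R \<in> maximal_cells ?C. R \<subseteq> P \<and> \<not> R \<subseteq> \<Union>(oscillating f t)}"
  have G_cells: "G \<subseteq> cells" unfolding G_def maximal_cells_def by auto
  have cover: "P \<inter> superlevel f c - \<Union>(oscillating f t) \<subseteq> \<Union>G"
  proof
    fix x assume x: "x \<in> P \<inter> superlevel f c - \<Union>(oscillating f t)"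
    then obtain R where R: "R \<in> maximal_cells ?C" "x \<in> R" by (auto simp: superlevel_eq_Union_maximal)
    have Rc: "R \<in> cells" "c < mean f R" using R by (auto simp: maximal_cells_def)
    have "R \<subseteq> P" using cells_nested[OF Rc(1) P] P_max[OF Rc] R x by auto
    then show "x \<in> \<Union>G" using R x by (auto simp: G_def)
  qed
  have "(\<integral>\<^sup>+x\<in>P \<inter> superlevel f c - \<Union>(oscillating f t). w x \<partial>lborel) \<le> (\<integral>\<^sup>+x\<in>\<Union>G. w x \<partial>lborel)"
    using cover by (intro nn_integral_mono) (auto split: split_indicator)
  also have "\<dots> \<le> (\<integral>\<^sup>+x\<in>\<Union>G. ?g x \<partial>lborel)"
  proof (rule set_nn_integral_Union_mono_disjoint)
    show "countable G" using G_cells countable_cells countable_subset by blast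
    show "disjoint G" using maximal_cells_disjoint[of ?C] unfolding G_def disjoint_def by auto
    show "G \<subseteq> sets borel" using G_cells cellsD(1) by blast
    fix R assume "R \<in> G"
    then have R: "R \<in> maximal_cells ?C" "R \<in> cells" "R \<subseteq> P" "\<not> R \<subseteq> \<Union>(oscillating f t)"
      using G_cells by (auto simp: G_def)
    note cR = cellsD[OF R(2)] and [measurable] = cellsD(1)[OF R(2)]
    have half: "2 * emeasure lborel (R \<inter> ?S) \<le> emeasure lborel R"
      by (rule next_superlevel_half[OF f base t R(1,4)])
    have "emeasure lborel R = emeasure lborel (R \<inter> ?S) + emeasure lborel (R - ?S)"
      by (subst plus_emeasure) (auto intro!: arg_cong[where f="emeasure lborel"])
    then have "2 * emeasure lborel (R \<inter> ?S) + emeasure lborel R 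
        \<le> 2 * emeasure lborel (R \<inter> ?S) + 2 * emeasure lborel (R - ?S)"
      using half by (simp add: mult_2 add_ac add_mono)
    moreover have "2 * emeasure lborel (R \<inter> ?S) \<noteq> top" using half cR(3) by (auto simp: top_unique)
    ultimately have vol: "emeasure lborel R \<le> 2 * emeasure lborel (R - ?S)"
      by (simp add: ennreal_add_left_cancel_le)
    have "(\<integral>\<^sup>+x\<in>R. w x \<partial>lborel) = cell_average w R * emeasure lborel R"
      using cell_average_mult[OF R(2)] by simp
    also have "\<dots> \<le> cell_average w R * (2 * emeasure lborel (R - ?S))"
      using vol by (intro mult_left_mono) auto
    also have "\<dots> = (\<integral>\<^sup>+x. 2 * cell_average w R * indicator (R - ?S) x \<partial>lborel)"
      by (subst nn_integral_cmult_indicator) (auto simp: mult_ac)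
    also have "\<dots> \<le> (\<integral>\<^sup>+x\<in>R. ?g x \<partial>lborel)"
      using cell_maximal_ge[OF R(2,3)]
      by (intro nn_integral_mono) (auto split: split_indicator intro!: mult_left_mono)
    finally show "(\<integral>\<^sup>+x\<in>R. w x \<partial>lborel) \<le> (\<integral>\<^sup>+x\<in>R. ?g x \<partial>lborel)" .
  qed auto
  also have "\<dots> \<le> (\<integral>\<^sup>+x. 2 * (cell_maximal w P x * indicator (P \<inter> superlevel f c - ?S) x) \<partial>lborel)"
    by (intro nn_integral_mono)
       (auto split: split_indicator simp: G_def superlevel_eq_Union_maximal)
  also have "\<dots> = 2 * (\<integral>\<^sup>+x\<in>P \<inter> superlevel f c - ?S. cell_maximal w P x \<partial>lborel)"
    using cellsD(1)[OF P] by (intro nn_integral_cmult) auto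
  finally show ?thesis .
qed

text \<open>
  The slices between consecutive levels are disjoint, so the integrals of the maximal function over $N$ of
  them add up to at most its integral over $P$, while each dominates half the weight of the smallest set.
\<close>

lemma weight_superlevel_decay_in_cell:
  assumes f: "f \<in> borel_measurable borel" "\<And>x. \<bar>f x\<bar> \<le> b"
    and w [measurable]: "w \<in> borel_measurable borel"
    and base: "mean f base \<le> c" and t: "0 < t"
    and P: "P \<in> maximal_cells {R \<in> cells. c < mean f R}"
  shows "of_nat N * (\<integral>\<^sup>+x\<in>P \<inter> superlevel f (c + of_nat N * ((\<theta> + 2) * t)) - \<Union>(oscillating f t). w x \<partial>lborel)
    \<le> 2 * (\<integral>\<^sup>+x\<in>P. cell_maximal w P x \<partial>lborel)"
proof -
  define d where "d = (\<theta> + 2) * t"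
  have d: "0 < d" unfolding d_def using t ratio_gt_1 by (intro mult_pos_pos) auto
  define A where "A i = superlevel f (c + of_nat i * d)" for i :: nat
  have A_anti: "A j \<subseteq> A i" if "i \<le> j" for i j
    unfolding A_def using that d by (intro superlevel_antimono) (auto intro!: mult_right_mono)
  have A_borel [measurable]: "A i \<in> sets borel" for i unfolding A_def by simp
  have Pc: "P \<in> cells" using P by (auto simp: maximal_cells_def)
  note [measurable] = cellsD(1)[OF Pc]
  let ?O = "\<Union>(oscillating f t)"
  have step: "(\<integral>\<^sup>+x\<in>P \<inter> A N - ?O. w x \<partial>lborel)
      \<le> 2 * (\<integral>\<^sup>+x\<in>P \<inter> A i - A (Suc i). cell_maximal w P x \<partial>lborel)" if "i \<le> N" for i N
  proof -
    have *: "c \<le> c + of_nat i * d" using d by simp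
    have "(\<integral>\<^sup>+x\<in>P \<inter> A N - ?O. w x \<partial>lborel) \<le> (\<integral>\<^sup>+x\<in>P \<inter> A i - ?O. w x \<partial>lborel)"
      using A_anti[OF that] by (intro nn_integral_mono) (auto split: split_indicator)
    also have "\<dots> \<le> 2 * (\<integral>\<^sup>+x\<in>P \<inter> superlevel f (c + of_nat i * d) 
        - superlevel f ((c + of_nat i * d) + (\<theta> + 2) * t). cell_maximal w P x \<partial>lborel)"
      unfolding A_def
    proof (rule weight_le_maximal_on_slice[OF f w _ t Pc])
      show "mean f base \<le> c + of_nat i * d" using base * by simp
      show "R = P" if "R \<in> cells" "c + of_nat i * d < mean f R" "P \<subseteq> R" for R
        using P that * by (auto simp: maximal_cells_def)
    qed
    also have "(c + of_nat i * d) + (\<theta> + 2) * t = c + of_nat (Suc i) * d"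
      by (simp add: d_def algebra_simps)
    finally show ?thesis unfolding A_def .
  qed
  have "of_nat N * (\<integral>\<^sup>+x\<in>P \<inter> A N - ?O. w x \<partial>lborel) = (\<Sum>i<N. (\<integral>\<^sup>+x\<in>P \<inter> A N - ?O. w x \<partial>lborel))"
    by simp
  also have "\<dots> \<le> (\<Sum>i<N. 2 * (\<integral>\<^sup>+x\<in>P \<inter> A i - A (Suc i). cell_maximal w P x \<partial>lborel))"
    by (intro sum_mono step) auto
  also have "\<dots> = 2 * (\<Sum>i<N. (\<integral>\<^sup>+x\<in>P \<inter> A i - A (Suc i). cell_maximal w P x \<partial>lborel))"
    by (simp add: sum_distrib_left)
  also have "(\<Sum>i<N. (\<integral>\<^sup>+x\<in>P \<inter> A i - A (Suc i). cell_maximal w P x \<partial>lborel))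
      \<le> (\<integral>\<^sup>+x\<in>P - A N. cell_maximal w P x \<partial>lborel)"
  proof (induction N)
    case (Suc N)
    have "(\<Sum>i<Suc N. (\<integral>\<^sup>+x\<in>P \<inter> A i - A (Suc i). cell_maximal w P x \<partial>lborel))
      \<le> (\<integral>\<^sup>+x\<in>P - A N. cell_maximal w P x \<partial>lborel) + (\<integral>\<^sup>+x\<in>P \<inter> A N - A (Suc N). cell_maximal w P x \<partial>lborel)"
      using Suc by (simp add: add_right_mono)
    also have "\<dots> = (\<integral>\<^sup>+x. cell_maximal w P x * indicator (P - A N) x 
        + cell_maximal w P x * indicator (P \<inter> A N - A (Suc N)) x \<partial>lborel)"
      by (subst nn_integral_add) auto
    also have "\<dots> \<le> (\<integral>\<^sup>+x\<in>P - A (Suc N). cell_maximal w P x \<partial>lborel)"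
      using A_anti[of N "Suc N"] by (intro nn_integral_mono) (auto split: split_indicator)
    finally show ?case .
  qed simp
  also have "\<dots> \<le> (\<integral>\<^sup>+x\<in>P. cell_maximal w P x \<partial>lborel)"
    by (intro nn_integral_mono) (auto split: split_indicator)
  finally show ?thesis unfolding A_def d_def by (simp add: mult_left_mono)
qed

text \<open>
  The hypothesis on \<open>W\<close> is the Fujii-Wilson form of the $A_\infty$ condition, restricted to cells.
\<close>

lemma weight_superlevel_decay:
  assumes f: "f \<in> borel_measurable borel" "\<And>x. \<bar>f x\<bar> \<le> b"
    and w [measurable]: "w \<in> borel_measurable borel"
    and W: "\<And>P. P \<in> cells \<Longrightarrow> (\<integral>\<^sup>+x\<in>P. cell_maximal w P x \<partial>lborel) \<le> W * (\<integral>\<^sup>+x\<in>P. w x \<partial>lborel)"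
    and base: "mean f base \<le> c" and t: "0 < t"
  shows "of_nat N * (\<integral>\<^sup>+x\<in>superlevel f (c + of_nat N * ((\<theta> + 2) * t)) - \<Union>(oscillating f t). w x \<partial>lborel)
    \<le> 2 * W * (\<integral>\<^sup>+x\<in>superlevel f c. w x \<partial>lborel)"
proof -
  let ?F = "maximal_cells {R \<in> cells. c < mean f R}"
  let ?A = "superlevel f (c + of_nat N * ((\<theta> + 2) * t)) - \<Union>(oscillating f t)"
  have UF: "\<Union>?F = superlevel f c" by (simp add: superlevel_eq_Union_maximal)
  have sub: "superlevel f (c + of_nat N * ((\<theta> + 2) * t)) \<subseteq> superlevel f c"
    using t ratio_gt_1 by (intro superlevel_antimono) auto
  have "(\<integral>\<^sup>+x\<in>\<Union>?F. of_nat N * w x * indicator ?A x \<partial>lborel) \<le> (\<integral>\<^sup>+x\<in>\<Union>?F. 2 * W * w x \<partial>lborel)"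
  proof (rule set_nn_integral_Union_mono_disjoint)
    fix P assume P: "P \<in> ?F"
    then have Pc: "P \<in> cells" by (auto simp: maximal_cells_def)
    note [measurable] = cellsD(1)[OF Pc]
    have "(\<integral>\<^sup>+x\<in>P. of_nat N * w x * indicator ?A x \<partial>lborel) 
        = (\<integral>\<^sup>+x. of_nat N * (w x * indicator (P \<inter> superlevel f (c + of_nat N * ((\<theta> + 2) * t)) - \<Union>(oscillating f t)) x) \<partial>lborel)"
      by (intro nn_integral_cong) (auto split: split_indicator)
    also have "\<dots> = of_nat N * (\<integral>\<^sup>+x\<in>P \<inter> superlevel f (c + of_nat N * ((\<theta> + 2) * t)) - \<Union>(oscillating f t). w x \<partial>lborel)"
      by (intro nn_integral_cmult) auto
    also have "\<dots> \<le> 2 * (\<integral>\<^sup>+x\<in>P. cell_maximal w P x \<partial>lborel)"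
      by (rule weight_superlevel_decay_in_cell[OF f w base t P])
    also have "\<dots> \<le> 2 * (W * (\<integral>\<^sup>+x\<in>P. w x \<partial>lborel))"
      by (intro mult_left_mono W Pc) auto
    also have "\<dots> = (\<integral>\<^sup>+x\<in>P. 2 * W * w x \<partial>lborel)"
      by (subst nn_integral_cmult[symmetric]) (auto simp: nn_integral_cmult[symmetric] mult_ac)
    finally show "(\<integral>\<^sup>+x\<in>P. of_nat N * w x * indicator ?A x \<partial>lborel) \<le> (\<integral>\<^sup>+x\<in>P. 2 * W * w x \<partial>lborel)" .
  qed (use maximal_cells_countable maximal_cells_disjoint maximal_cells_borel in auto)
  moreover have "(\<integral>\<^sup>+x\<in>\<Union>?F. of_nat N * w x * indicator ?A x \<partial>lborel) = of_nat N * (\<integral>\<^sup>+x\<in>?A. w x \<partial>lborel)"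
    unfolding UF using sub
    by (subst nn_integral_cmult[symmetric]) (auto split: split_indicator intro!: nn_integral_cong dest: subsetD)
  moreover have "(\<integral>\<^sup>+x\<in>\<Union>?F. 2 * W * w x \<partial>lborel) = 2 * W * (\<integral>\<^sup>+x\<in>superlevel f c. w x \<partial>lborel)"
    unfolding UF by (subst nn_integral_cmult[symmetric]) (auto simp: mult.assoc)
  ultimately show ?thesis by simp
qed

lemma abs_mean_le:
  assumes R: "R \<in> cells" and f: "f \<in> borel_measurable borel" and bd: "\<And>x. \<bar>f x\<bar> \<le> b"
  shows "\<bar>mean f R\<bar> \<le> b"
proof -
  have b: "0 \<le> b" using bd[of undefined] by simp
  have "ennreal (\<bar>mean f R - 0\<bar> * measure lborel R) \<le> (\<integral>\<^sup>+x\<in>R. ennreal \<bar>f x - 0\<bar> \<partial>lborel)"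
    using cellsD[OF R] f bd by (intro mean_deviation) auto
  also have "\<dots> \<le> (\<integral>\<^sup>+x\<in>R. ennreal b \<partial>lborel)"
    using bd by (intro nn_integral_mono mult_right_mono ennreal_leI) auto
  also have "\<dots> = ennreal (b * measure lborel R)"
    using cellsD[OF R] b by (simp add: nn_integral_cmult_indicator ennreal_mult'')
  finally have "\<bar>mean f R\<bar> * measure lborel R \<le> b * measure lborel R"
    using b by (subst (asm) ennreal_le_iff) auto
  then show ?thesis using cellsD(4)[OF R] by simp
qed

text \<open>
  A one-sided substitute for the differentiation theorem.  The exceptional set $Z$ is covered by disjoint
  cells that meet $Z$ and lie in an open set hardly larger than $Z$.  On each of these cells the average of
  $f$ is at most $c$, whereas $f > c$ on $Z$; so the integral of $f - c$ over $Z$ is at most $(c+b)$ times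
  the excess volume.
\<close>

lemma AE_le_outside_superlevel:
  assumes f [measurable]: "f \<in> borel_measurable borel" and bd: "\<And>x. \<bar>f x\<bar> \<le> b"
  shows "AE x in lborel. x \<in> base \<longrightarrow> c < f x \<longrightarrow> x \<in> superlevel f c"
proof -
  define Z where "Z = {x \<in> base. c < f x} - superlevel f c"
  have Z_borel [measurable]: "Z \<in> sets borel" unfolding Z_def by measurable
  have Zf: "emeasure lborel Z < top"
    using base_finite emeasure_mono[of Z base lborel] by (auto simp: Z_def intro: le_less_trans)
  have cb: "0 \<le> c + b" if nonempty: "Z \<noteq> {}"
  proof (rule ccontr)
    assume neg: "\<not> 0 \<le> c + b"
    obtain x where x: "x \<in> Z" using nonempty by auto
    have "\<bar>mean f base\<bar> \<le> b" by (rule abs_mean_le[OF base_in_cells f bd])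
    then have "c < mean f base" using neg by simp
    then have "base \<subseteq> superlevel f c" using base_in_cells by (auto simp: superlevel_def)
    then show False using x by (auto simp: Z_def)
  qed
  have small: "(\<integral>\<^sup>+x\<in>Z. ennreal (f x - c) \<partial>lborel) \<le> ennreal (c + b) * ennreal e" if e: "0 < e" for e
  proof (cases "Z = {}")
    case False
    note cb = cb[OF False]
    obtain U where U: "open U" "Z \<subseteq> U" "emeasure lborel (U - Z) < ennreal e"
      using outer_regular_lborel[of Z e] e by auto
    define C where "C = {R \<in> cells. R \<subseteq> U \<and> R \<inter> Z \<noteq> {}}"
    have C: "C \<subseteq> cells" by (auto simp: C_def)
    have CZ: "Z \<subseteq> \<Union>C"
    proof
      fix x assume x: "x \<in> Z"
      then have xb: "x \<in> base" by (auto simp: Z_def)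
      obtain k where "cell k x \<subseteq> U" using cell_small[OF xb U(1)] x U(2) by auto
      then show "x \<in> \<Union>C" using x xb mem_cell[OF xb, of k] by (auto simp: C_def cells_def)
    qed
    let ?V = "\<Union>C"
    have V [measurable]: "?V \<in> sets borel" using Union_cells_borel[OF C] .
    have "(\<integral>\<^sup>+x\<in>\<Union>(maximal_cells C). ennreal (f x + b) \<partial>lborel) \<le> (\<integral>\<^sup>+x\<in>\<Union>(maximal_cells C). ennreal (c + b) \<partial>lborel)"
    proof (rule set_nn_integral_Union_mono_disjoint)
      fix R assume "R \<in> maximal_cells C"
      then have R: "R \<in> cells" "R \<inter> Z \<noteq> {}" by (auto simp: maximal_cells_def C_def)
      have "mean f R \<le> c" using R by (auto simp: Z_def superlevel_def not_less[symmetric])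
      then have "(mean f R + b) * measure lborel R \<le> (c + b) * measure lborel R"
        by (intro mult_right_mono) auto
      then show "(\<integral>\<^sup>+x\<in>R. ennreal (f x + b) \<partial>lborel) \<le> (\<integral>\<^sup>+x\<in>R. ennreal (c + b) \<partial>lborel)"
        using cellsD[OF R(1)] nn_integral_shift_eq_mean[OF cellsD(1,3,4)[OF R(1)] f bd] cb
        by (simp add: nn_integral_cmult_indicator ennreal_mult'[symmetric] ennreal_leI)
    qed (use C maximal_cells_countable maximal_cells_disjoint maximal_cells_borel in auto)
    then have le: "(\<integral>\<^sup>+x\<in>?V. ennreal (f x + b) \<partial>lborel) \<le> ennreal (c + b) * emeasure lborel ?V"
      using maximal_cells_Union[OF C] by (simp add: nn_integral_cmult_indicator)
    have "(\<integral>\<^sup>+x\<in>Z. ennreal (f x - c) \<partial>lborel) + ennreal (c + b) * emeasure lborel Z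
        = (\<integral>\<^sup>+x. ennreal (f x - c) * indicator Z x + ennreal (c + b) * indicator Z x \<partial>lborel)"
      by (subst nn_integral_add) (auto simp: nn_integral_cmult_indicator)
    also have "\<dots> \<le> (\<integral>\<^sup>+x\<in>?V. ennreal (f x + b) \<partial>lborel)"
      using CZ cb by (intro nn_integral_mono)
        (auto split: split_indicator simp: Z_def ennreal_plus[symmetric] simp del: ennreal_plus)
    also note le
    also have "emeasure lborel ?V \<le> emeasure lborel (Z \<union> (U - Z))"
      using U(1) by (intro emeasure_mono) (auto simp: C_def)
    also have "\<dots> \<le> emeasure lborel Z + emeasure lborel (U - Z)"
      using U(1) by (intro emeasure_subadditive) auto
    also have "\<dots> \<le> emeasure lborel Z + ennreal e" using U(3) by (intro add_left_mono) auto
    finally have "ennreal (c + b) * emeasure lborel Z + (\<integral>\<^sup>+x\<in>Z. ennreal (f x - c) \<partial>lborel)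
       \<le> ennreal (c + b) * emeasure lborel Z + ennreal (c + b) * ennreal e"
      by (simp add: distrib_left add.commute mult_left_mono)
    moreover have "ennreal (c + b) * emeasure lborel Z \<noteq> top"
      using Zf by (auto simp: ennreal_mult_eq_top_iff)
    ultimately show ?thesis by (simp add: ennreal_add_left_cancel_le)
  qed simp
  have "(\<integral>\<^sup>+x\<in>Z. ennreal (f x - c) \<partial>lborel) = 0"
  proof -
    have "(\<integral>\<^sup>+x\<in>Z. ennreal (f x - c) \<partial>lborel) \<le> ennreal e" if "0 < e" for e
    proof -
      have "(\<integral>\<^sup>+x\<in>Z. ennreal (f x - c) \<partial>lborel) \<le> ennreal (c + b) * ennreal (e / (\<bar>c + b\<bar> + 1))"
        using that by (intro small) auto
      also have "\<dots> \<le> ennreal \<bar>c + b\<bar> * ennreal (e / (\<bar>c + b\<bar> + 1))"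
        by (intro mult_right_mono ennreal_leI) auto
      also have "\<dots> = ennreal (\<bar>c + b\<bar> * (e / (\<bar>c + b\<bar> + 1)))"
        using that by (simp add: ennreal_mult'' flip: times_divide_eq_right)
      also have "\<dots> \<le> ennreal e" using that by (intro ennreal_leI) (simp add: field_simps)
      finally show ?thesis .
    qed
    then show ?thesis
      using ennreal_le_epsilon[of 0 "\<integral>\<^sup>+x\<in>Z. ennreal (f x - c) \<partial>lborel"] by auto
  qed
  then have "AE x in lborel. ennreal (f x - c) * indicator Z x = 0"
    by (subst (asm) nn_integral_0_iff_AE) auto
  then show ?thesis
    by eventually_elim (auto simp: Z_def split: split_indicator_asm if_splits)
qed

end


section \<open>A weak type inequality\<close>

lemma one_plus_inverse_powr_le:
  fixes p :: real assumes "1 \<le> p" shows "(1 + 1/p) powr p \<le> 3"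
proof -
  have "(1 + 1/p) powr p \<le> exp (1/p) powr p"
    using assms exp_ge_add_one_self[of "1/p"] by (intro powr_mono2) auto
  also have "\<dots> = exp 1" using assms by (simp add: powr_def)
  also have "\<dots> \<le> 3" by (rule exp_le)
  finally show ?thesis .
qed

text \<open>
  Moving from the level $r$ to $r(1+1/p)$ costs at most a factor $3$ in $r^p$ and gains a factor $4$ in
  $F$.  So the supremum $S$ of $r^p F(r)$, which is finite because $F$ is bounded and vanishes for large
  $r$, satisfies $S \le \frac34 S + 3X$.
\<close>

lemma good_lambda_iteration:
  fixes F :: "real \<Rightarrow> real"
  assumes p: "1 \<le> p" and F: "\<And>r. 0 \<le> F r" "\<And>r. F r \<le> V" "\<And>r. L < r \<Longrightarrow> F r = 0"
    and step: "\<And>r. 0 < r \<Longrightarrow> F (r * (1 + 1/p)) \<le> F r / 4 + X / r powr p"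
    and r: "0 < r"
  shows "r powr p * F r \<le> 12 * X"
proof -
  have V: "0 \<le> V" using F(1,2)[of 0] by linarith
  define S where "S = (SUP s\<in>{0<..}. s powr p * F s)"
  have bdd: "bdd_above ((\<lambda>s. s powr p * F s) ` {0<..})"
  proof (rule bdd_aboveI2)
    fix s :: real assume s: "s \<in> {0<..}"
    show "s powr p * F s \<le> \<bar>L\<bar> powr p * V"
    proof (cases "L < s")
      case False
      then have "s powr p \<le> \<bar>L\<bar> powr p" using s p by (intro powr_mono2) auto
      then show ?thesis using F V by (intro mult_mono) auto
    qed (use F V in simp)
  qed
  have upper: "s powr p * F s \<le> S" if "0 < s" for s
    unfolding S_def using that bdd by (intro cSUP_upper) auto
  have "s powr p * F s \<le> 3 * (S / 4 + X)" if s: "0 < s" for s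
  proof -
    define q where "q = s / (1 + 1/p)"
    have pp: "0 < 1 + 1/p" using p by (simp add: add_pos_nonneg)
    have q: "0 < q" "s = q * (1 + 1/p)" using s pp by (auto simp: q_def)
    have nn: "0 \<le> q powr p * F s" using F by simp
    have qp: "0 < q powr p" using q by simp
    have "q powr p * F s \<le> q powr p * (F q / 4 + X / q powr p)"
      using step[OF q(1)] q(2) by (intro mult_left_mono) auto
    also have "\<dots> = (q powr p * F q) / 4 + X" using qp by (simp add: distrib_left)
    also have "\<dots> \<le> S / 4 + X" using upper[OF q(1)] by simp
    finally have 1: "q powr p * F s \<le> S / 4 + X" .
    have "s powr p * F s = (1 + 1/p) powr p * (q powr p * F s)"
      unfolding q(2) using q(1) pp by (subst powr_mult) auto
    also have "\<dots> \<le> 3 * (q powr p * F s)"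
      using one_plus_inverse_powr_le[OF p] nn by (intro mult_right_mono)
    also have "\<dots> \<le> 3 * (S / 4 + X)" using 1 by (intro mult_left_mono) auto
    finally show ?thesis .
  qed
  then have "S \<le> 3 * (S / 4 + X)" unfolding S_def by (intro cSUP_least) auto
  then have "S \<le> 12 * X" by (simp add: field_simps)
  then show ?thesis by (rule order_trans[OF upper[OF r]])
qed

context cell_tree
begin

lemma superlevel_bounded_eq_empty:
  assumes f: "f \<in> borel_measurable borel" "\<And>x. \<bar>f x\<bar> \<le> b" and c: "b < c"
  shows "superlevel f c = {}"
proof -
  have "\<not> c < mean f R" if "R \<in> cells" for R
    using abs_mean_le[OF that f] c by linarith
  then show ?thesis by (auto simp: superlevel_def)
qed

text \<open>
  The choice of parameters: $N$ between $8W$ and $9W$ turns the decay estimate into a gain of $4$, and $t$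
  is such that $N$ steps of height $(\theta+2)t$ raise the level $s$ by exactly $s/p$.  Levels are measured
  from the average over the base, so that every level set considered lies strictly above it.
\<close>

theorem weak_type_from_oscillating_cells:
  assumes f: "f \<in> borel_measurable borel" "\<And>x. \<bar>f x\<bar> \<le> b"
    and w [measurable]: "w \<in> borel_measurable borel" and wfin: "(\<integral>\<^sup>+x\<in>base. w x \<partial>lborel) < top"
    and W: "1 \<le> W"
      "\<And>P. P \<in> cells \<Longrightarrow> (\<integral>\<^sup>+x\<in>P. cell_maximal w P x \<partial>lborel) \<le> ennreal W * (\<integral>\<^sup>+x\<in>P. w x \<partial>lborel)"
    and p: "1 \<le> p" and B: "0 \<le> B"
    and osc: "\<And>t. 0 < t \<Longrightarrow> (\<integral>\<^sup>+x\<in>\<Union>(oscillating f t). w x \<partial>lborel) \<le> ennreal (B / t powr p)"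
    and r: "0 < r"
  shows "(\<integral>\<^sup>+x\<in>{x\<in>base. mean f base + r < f x}. w x \<partial>lborel)
    \<le> ennreal (12 * ((9 * p * W * (\<theta> + 2)) powr p * B) / r powr p)"
proof -
  note [measurable] = f(1)
  define m where "m = mean f base"
  define X where "X = (9 * p * W * (\<theta> + 2)) powr p * B"
  define \<nu> where "\<nu> A = (\<integral>\<^sup>+x\<in>A. w x \<partial>lborel)" for A
  define F where "F s = enn2real (\<nu> (superlevel f (m + s)))" for s
  have mono: "\<nu> A \<le> \<nu> A'" if "A \<subseteq> A'" for A A'
    unfolding \<nu>_def using that by (intro nn_integral_mono) (auto split: split_indicator)
  have fin: "\<nu> (superlevel f c) < top" for c
    using mono[OF superlevel_subset_base, of f c] wfin by (auto simp: \<nu>_def intro: le_less_trans)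
  have F_eq: "\<nu> (superlevel f (m + s)) = ennreal (F s)" for s
    unfolding F_def using fin by simp
  define N where "N = nat \<lceil>8 * W\<rceil>"
  have N: "8 * W \<le> real N" "real N \<le> 9 * W" "0 < real N"
    unfolding N_def using W(1) by linarith+
  have step: "F (s * (1 + 1/p)) \<le> F s / 4 + X / s powr p" if s: "0 < s" for s
  proof -
    define t where "t = s / (p * real N * (\<theta> + 2))"
    have pos: "0 < p * real N * (\<theta> + 2)" using p N ratio_gt_1 by (intro mult_pos_pos) auto
    have t: "0 < t" unfolding t_def using pos s by simp
    have "\<theta> + 2 \<noteq> 0" using ratio_gt_1 by simp
    then have lev: "real N * ((\<theta> + 2) * t) = s / p"
      unfolding t_def using p N by simp
    have "(s * (1 + 1/p)) = s + s / p" by (simp add: algebra_simps)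
    then have Fs: "ennreal (F (s * (1 + 1/p))) = \<nu> (superlevel f ((m + s) + real N * ((\<theta> + 2) * t)))"
      by (simp add: F_eq[symmetric] lev add.assoc)
    let ?S = "superlevel f ((m + s) + real N * ((\<theta> + 2) * t))" and ?O = "\<Union>(oscillating f t)"
    have decay: "of_nat N * \<nu> (?S - ?O) \<le> 2 * ennreal W * \<nu> (superlevel f (m + s))"
      unfolding \<nu>_def
      by (rule weight_superlevel_decay[OF f w W(2) _ t]) (use s in \<open>auto simp: m_def\<close>)
    have finD: "\<nu> (?S - ?O) < top"
      using mono[of "?S - ?O" ?S] fin by (auto intro: le_less_trans)
    define D where "D = enn2real (\<nu> (?S - ?O))"
    have D: "\<nu> (?S - ?O) = ennreal D" "0 \<le> D" unfolding D_def using finD by auto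
    have "ennreal (real N * D) \<le> ennreal (2 * W * F s)"
      using decay W(1) unfolding D F_eq
      by (simp add: ennreal_mult'' ennreal_mult' ennreal_of_nat_eq_real_of_nat D)
    then have "real N * D \<le> 2 * W * F s"
      using W(1) by (subst (asm) ennreal_le_iff) (auto simp: F_def)
    moreover have "8 * W * D \<le> real N * D" using N D by (intro mult_right_mono) auto
    ultimately have "8 * W * D \<le> 2 * W * F s" by (rule order_trans[rotated])
    then have "(2 * W) * (4 * D) \<le> (2 * W) * F s" by (simp add: mult_ac)
    then have "4 * D \<le> F s" using W(1) by (subst (asm) mult_le_cancel_left_pos) auto
    then have D4: "D \<le> F s / 4" by simp
    have BX: "B / t powr p \<le> X / s powr p"
    proof -
      have "B / t powr p = (p * real N * (\<theta> + 2)) powr p * B / s powr p"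
        unfolding t_def using pos s by (simp add: powr_divide)
      also have "\<dots> \<le> X / s powr p"
        unfolding X_def using pos N p W ratio_gt_1 B
        by (intro divide_right_mono mult_right_mono powr_mono2) auto
      finally show ?thesis .
    qed
    have "\<nu> ?S \<le> \<nu> ((?S - ?O) \<union> ?O)" by (intro mono) auto
    also have "\<dots> \<le> \<nu> (?S - ?O) + \<nu> ?O"
      unfolding \<nu>_def by (subst nn_integral_add[symmetric]) (auto intro!: nn_integral_mono split: split_indicator)
    also have "\<dots> \<le> ennreal D + ennreal (B / t powr p)"
      using osc[OF t] D unfolding \<nu>_def by (intro add_mono) auto
    also have "\<dots> = ennreal (D + B / t powr p)" using B D t by (subst ennreal_plus) auto
    finally have "ennreal (F (s * (1 + 1/p))) \<le> ennreal (D + B / t powr p)" using Fs by simp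
    then have "F (s * (1 + 1/p)) \<le> D + B / t powr p"
      using B D t by (subst (asm) ennreal_le_iff) auto
    then show ?thesis using D4 BX by linarith
  qed
  have "r powr p * F r \<le> 12 * X"
  proof (rule good_lambda_iteration[where V = "enn2real (\<nu> base)" and L = "2 * b", OF p _ _ _ step r])
    show "F s \<le> enn2real (\<nu> base)" for s
      unfolding F_def using mono[OF superlevel_subset_base, of f "m+s"] wfin
      by (intro enn2real_mono) (auto simp: \<nu>_def)
    show "F s = 0" if "2 * b < s" for s
    proof -
      have "b < m + s" using abs_mean_le[OF base_in_cells f] that unfolding m_def by linarith
      then show ?thesis unfolding F_def using superlevel_bounded_eq_empty[OF f] by (simp add: \<nu>_def)
    qed
  qed (auto simp: F_def)
  then have Fr: "F r \<le> 12 * X / r powr p" using r by (simp add: field_simps)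
  have "(\<integral>\<^sup>+x\<in>{x\<in>base. m + r < f x}. w x \<partial>lborel) \<le> \<nu> (superlevel f (m + r))"
    unfolding \<nu>_def using AE_le_outside_superlevel[OF f, of "m + r"]
    by (intro nn_integral_mono_AE) (auto elim!: eventually_mono split: split_indicator)
  also have "\<dots> \<le> ennreal (12 * X / r powr p)" unfolding F_eq using Fr by (rule ennreal_leI)
  finally show ?thesis unfolding m_def X_def .
qed

end


section \<open>The fractional Poincare inequality on convex sets\<close>

lemma sum_powr_le:
  fixes a :: "nat \<Rightarrow> real"
  assumes "0 < K" "1 \<le> p" and a: "\<And>i. 0 \<le> a i"
  shows "(\<Sum>i<K. a i) powr p \<le> real K powr (p - 1) * (\<Sum>i<K. a i powr p)"
proof -
  \<comment> \<open>Convexity of the power function is available on the open half-line, hence the restriction to the nonzero terms.\<close>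
  define S where "S = {i\<in>{..<K}. a i \<noteq> 0}"
  have S: "finite S" "S \<subseteq> {..<K}" unfolding S_def by auto
  have sums: "(\<Sum>i<K. a i) = (\<Sum>i\<in>S. a i)" "(\<Sum>i<K. a i powr p) = (\<Sum>i\<in>S. a i powr p)"
    unfolding S_def by (rule sum.mono_neutral_right; auto)+
  show ?thesis
  proof (cases "S = {}")
    case False
    define N where "N = real (card S)"
    have N: "0 < N" "N \<le> real K"
      using False S card_mono[OF _ S(2)] by (auto simp: N_def card_gt_0_iff)
    have cx: "convex_on {0<..} (\<lambda>x::real. x powr p)" using assms(2) by (rule powr_convex)
    have "(\<lambda>x. x powr p) (\<Sum>i\<in>S. (1/N) *\<^sub>R a i) \<le> (\<Sum>i\<in>S. (1/N) * (a i powr p))"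
      by (rule convex_on_sum[OF S(1) False cx])
         (use N False S(1) a in \<open>auto simp: N_def S_def less_le\<close>)
    then have "((\<Sum>i\<in>S. a i) / N) powr p \<le> (\<Sum>i\<in>S. a i powr p) / N"
      by (simp add: sum_divide_distrib)
    then have "(\<Sum>i\<in>S. a i) powr p / N powr p \<le> (\<Sum>i\<in>S. a i powr p) / N"
      using N a by (simp add: powr_divide sum_nonneg)
    then have "(\<Sum>i\<in>S. a i) powr p \<le> N powr p * ((\<Sum>i\<in>S. a i powr p) / N)"
      using N by (simp add: pos_divide_le_eq mult.commute)
    also have "\<dots> = N powr (p - 1) * (\<Sum>i\<in>S. a i powr p)"
      using N by (simp add: powr_diff)
    also have "\<dots> \<le> real K powr (p - 1) * (\<Sum>i\<in>S. a i powr p)"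
      using N assms(2) by (intro mult_right_mono powr_mono2 sum_nonneg) auto
    finally show ?thesis by (simp add: sums)
  qed (simp add: sums sum_nonneg)
qed

lemma nn_integral_lborel_dilation:
  fixes g :: "'a::euclidean_space \<Rightarrow> ennreal"
  assumes [measurable]: "g \<in> borel_measurable borel" and c: "0 < c"
  shows "(\<integral>\<^sup>+y. g y \<partial>lborel) = ennreal (c ^ DIM('a)) * (\<integral>\<^sup>+h. g (x + c *\<^sub>R h) \<partial>lborel)"
proof -
  have "(\<integral>\<^sup>+y. g y \<partial>lborel) = (\<integral>\<^sup>+y. g y \<partial>density (distr lborel borel (\<lambda>h. x + c *\<^sub>R h)) (\<lambda>_. \<bar>c\<bar> ^ DIM('a)))"
    using lborel_affine[of c x] c by auto
  also have "\<dots> = (\<integral>\<^sup>+y. ennreal (\<bar>c\<bar> ^ DIM('a)) * g y \<partial>distr lborel borel (\<lambda>h. x + c *\<^sub>R h))"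
    by (subst nn_integral_density) auto
  also have "\<dots> = ennreal (\<bar>c\<bar> ^ DIM('a)) * (\<integral>\<^sup>+h. g (x + c *\<^sub>R h) \<partial>lborel)"
    by (subst nn_integral_cmult) (auto simp: nn_integral_distr)
  finally show ?thesis using c by simp
qed

lemma nn_integral_lborel_translation:
  fixes g :: "'a::euclidean_space \<Rightarrow> ennreal"
  assumes "g \<in> borel_measurable borel"
  shows "(\<integral>\<^sup>+y. g (x + y) \<partial>lborel) = (\<integral>\<^sup>+y. g y \<partial>lborel)"
  using nn_integral_lborel_dilation[OF assms, of 1 x] by simp

lemma swap_nn_integral_lborel:
  fixes f :: "'a::euclidean_space \<Rightarrow> 'b::euclidean_space \<Rightarrow> ennreal"
  assumes "(\<lambda>(x, y). f x y) \<in> borel_measurable (borel \<Otimes>\<^sub>M borel)"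
  shows "(\<integral>\<^sup>+x. (\<integral>\<^sup>+y. f x y \<partial>lborel) \<partial>lborel) = (\<integral>\<^sup>+y. (\<integral>\<^sup>+x. f x y \<partial>lborel) \<partial>lborel)"
proof -
  have "(\<lambda>(y, x). f x y) \<in> borel_measurable (borel \<Otimes>\<^sub>M borel)"
    using measurable_pair_swap[OF assms] by simp
  then show ?thesis using lborel_pair.Fubini'[of "\<lambda>y x. f x y"]
    by (simp add: measurable_cong_sets[OF sets_pair_measure_cong[OF sets_lborel sets_lborel]])
qed

text \<open>
  With $\Phi(h)$ for this quantity, both the double integral of $|v(x)-v(y)|^p$ and the Gagliardo integral
  are integrals of $\Phi$, with the weights $1$ and $|h|^{-n-\delta p}$.
\<close>

definition increment :: "('a::euclidean_space \<Rightarrow> real) \<Rightarrow> real \<Rightarrow> 'a set \<Rightarrow> 'a \<Rightarrow> ennreal" where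
  "increment v p R h = (\<integral>\<^sup>+z. ennreal (\<bar>v (z + h) - v z\<bar> powr p) * indicator R z * indicator R (z + h) \<partial>lborel)"

lemma increment_borel [measurable]:
  assumes [measurable]: "v \<in> borel_measurable borel" "R \<in> sets borel"
  shows "increment v p R \<in> borel_measurable borel"
  unfolding increment_def by measurable

lemma double_integral_eq_increment:
  fixes v :: "'a::euclidean_space \<Rightarrow> real" and q :: "'a \<Rightarrow> ennreal" and p :: real
  assumes [measurable]: "v \<in> borel_measurable borel" "R \<in> sets borel" "q \<in> borel_measurable borel"
  shows "(\<integral>\<^sup>+x\<in>R. (\<integral>\<^sup>+y\<in>R. ennreal (\<bar>v x - v y\<bar> powr p) * q (y - x) \<partial>lborel) \<partial>lborel)
    = (\<integral>\<^sup>+h. q h * increment v p R h \<partial>lborel)"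
proof -
  have "(\<integral>\<^sup>+x\<in>R. (\<integral>\<^sup>+y\<in>R. ennreal (\<bar>v x - v y\<bar> powr p) * q (y - x) \<partial>lborel) \<partial>lborel)
    = (\<integral>\<^sup>+x. (\<integral>\<^sup>+h. q h * (ennreal (\<bar>v (x + h) - v x\<bar> powr p) * indicator R x * indicator R (x + h)) \<partial>lborel) \<partial>lborel)"
  proof (intro nn_integral_cong)
    fix x
    have "(\<integral>\<^sup>+y\<in>R. ennreal (\<bar>v x - v y\<bar> powr p) * q (y - x) \<partial>lborel) * indicator R x
      = (\<integral>\<^sup>+y. q (y - x) * (ennreal (\<bar>v y - v x\<bar> powr p) * indicator R x * indicator R y) \<partial>lborel)"
      by (subst nn_integral_multc[symmetric])
         (auto intro!: nn_integral_cong simp: abs_minus_commute mult_ac)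
    also have "\<dots> = (\<integral>\<^sup>+h. q h * (ennreal (\<bar>v (x + h) - v x\<bar> powr p) * indicator R x * indicator R (x + h)) \<partial>lborel)"
      by (subst nn_integral_lborel_translation[symmetric, where x=x]) auto
    finally show "(\<integral>\<^sup>+y\<in>R. ennreal (\<bar>v x - v y\<bar> powr p) * q (y - x) \<partial>lborel) * indicator R x = \<dots>" .
  qed
  also have "\<dots> = (\<integral>\<^sup>+h. (\<integral>\<^sup>+x. q h * (ennreal (\<bar>v (x + h) - v x\<bar> powr p) * indicator R x * indicator R (x + h)) \<partial>lborel) \<partial>lborel)"
    by (rule swap_nn_integral_lborel) measurable
  also have "\<dots> = (\<integral>\<^sup>+h. q h * increment v p R h \<partial>lborel)"
    unfolding increment_def by (intro nn_integral_cong nn_integral_cmult) measurable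
  finally show ?thesis .
qed

text \<open>
  The points $x + ih$ for $0 \le i \le K$ stay in $R$ by convexity, and $K|h|$ is a distance in $R$.
\<close>

lemma subdivided_increment_le:
  fixes v :: "'a::euclidean_space \<Rightarrow> real" and p d :: real
  assumes R: "convex R" "\<And>x y. x \<in> R \<Longrightarrow> y \<in> R \<Longrightarrow> norm (x - y) \<le> d"
    and p: "1 \<le> p" and K: "0 < (K::nat)"
  shows "ennreal (\<bar>v (x + real K *\<^sub>R h) - v x\<bar> powr p) * indicator R x * indicator R (x + real K *\<^sub>R h)
    \<le> ennreal (real K powr (p - 1)) * (\<Sum>i<K. indicator {h. norm h \<le> d / K} h *
        (ennreal (\<bar>v ((x + real i *\<^sub>R h) + h) - v (x + real i *\<^sub>R h)\<bar> powr p)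
          * indicator R (x + real i *\<^sub>R h) * indicator R ((x + real i *\<^sub>R h) + h)))"
    (is "?L \<le> ?R")
proof (cases "x \<in> R \<and> x + real K *\<^sub>R h \<in> R")
  case True
  define a where "a i = \<bar>v ((x + real i *\<^sub>R h) + h) - v (x + real i *\<^sub>R h)\<bar>" for i :: nat
  have mem: "x + real i *\<^sub>R h \<in> R" if "i \<le> K" for i
  proof -
    have "(1 - real i / real K) *\<^sub>R x + (real i / real K) *\<^sub>R (x + real K *\<^sub>R h) \<in> R"
      using True that K by (intro convexD[OF R(1)]) auto
    also have "(1 - real i / real K) *\<^sub>R x + (real i / real K) *\<^sub>R (x + real K *\<^sub>R h) = x + real i *\<^sub>R h"
      using K by (simp add: algebra_simps)
    finally show ?thesis .
  qed
  have mem1: "(x + real i *\<^sub>R h) + h \<in> R" if "i < K" for i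
    using mem[of "Suc i"] that by (simp add: algebra_simps)
  have "real K * norm h \<le> d" using R(2)[of "x + real K *\<^sub>R h" x] True by simp
  then have h: "norm h \<le> d / K" using K by (simp add: field_simps)
  have "\<bar>v (x + real K *\<^sub>R h) - v x\<bar> = \<bar>\<Sum>i<K. v (x + real (Suc i) *\<^sub>R h) - v (x + real i *\<^sub>R h)\<bar>"
    using sum_lessThan_telescope[of "\<lambda>i. v (x + real i *\<^sub>R h)" K] by simp
  also have "\<dots> \<le> (\<Sum>i<K. \<bar>v (x + real (Suc i) *\<^sub>R h) - v (x + real i *\<^sub>R h)\<bar>)" by (rule sum_abs)
  also have "\<dots> = (\<Sum>i<K. a i)" unfolding a_def by (simp add: algebra_simps)
  finally have "\<bar>v (x + real K *\<^sub>R h) - v x\<bar> powr p \<le> (\<Sum>i<K. a i) powr p"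
    using p by (intro powr_mono2) auto
  also have "\<dots> \<le> real K powr (p - 1) * (\<Sum>i<K. a i powr p)"
    using K p by (intro sum_powr_le) (auto simp: a_def)
  finally have "?L \<le> ennreal (real K powr (p - 1) * (\<Sum>i<K. a i powr p))"
    using True by (simp add: ennreal_leI)
  also have "\<dots> = ennreal (real K powr (p - 1)) * (\<Sum>i<K. ennreal (a i powr p))"
    by (simp add: ennreal_mult' sum_ennreal)
  also have "(\<Sum>i<K. ennreal (a i powr p)) = (\<Sum>i<K. indicator {h. norm h \<le> d / K} h *
        (ennreal (\<bar>v ((x + real i *\<^sub>R h) + h) - v (x + real i *\<^sub>R h)\<bar> powr p)
          * indicator R (x + real i *\<^sub>R h) * indicator R ((x + real i *\<^sub>R h) + h)))"
    using mem mem1 h by (intro sum.cong) (auto simp: a_def)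
  finally show ?thesis .
qed auto

text \<open>
  Each of the $K$ terms of the subdivision has the same integral over $x$ by translation invariance; the
  factor $K^n$ comes from the substitution $y = x + Kh$ and $K^{p-1}\cdot K$ from the convexity of the power.
\<close>

lemma double_integral_le_small_increments:
  fixes v :: "'a::euclidean_space \<Rightarrow> real" and p d :: real
  assumes v [measurable]: "v \<in> borel_measurable borel" and Rb [measurable]: "R \<in> sets borel"
    and R: "convex R" "\<And>x y. x \<in> R \<Longrightarrow> y \<in> R \<Longrightarrow> norm (x - y) \<le> d"
    and p: "1 \<le> p" and K: "0 < (K::nat)"
  shows "(\<integral>\<^sup>+x\<in>R. (\<integral>\<^sup>+y\<in>R. ennreal (\<bar>v x - v y\<bar> powr p) \<partial>lborel) \<partial>lborel)
    \<le> ennreal (real K powr (DIM('a) + p)) * (\<integral>\<^sup>+h. indicator {h. norm h \<le> d / K} h * increment v p R h \<partial>lborel)"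
proof -
  let ?n = "DIM('a)"
  let ?\<phi> = "\<lambda>z h. ennreal (\<bar>v (z + h) - v z\<bar> powr p) * indicator R z * indicator R (z + h)"
  let ?D = "{h::'a. norm h \<le> d / K}"
  have D [measurable]: "?D \<in> sets borel" by measurable
  have Kr: "0 < real K" using K by simp
  have "(\<integral>\<^sup>+x\<in>R. (\<integral>\<^sup>+y\<in>R. ennreal (\<bar>v x - v y\<bar> powr p) \<partial>lborel) \<partial>lborel)
     = (\<integral>\<^sup>+h. 1 * increment v p R h \<partial>lborel)"
    using double_integral_eq_increment[OF v Rb, of "\<lambda>_. 1" p] by simp
  also have "\<dots> = ennreal (real K ^ ?n) * (\<integral>\<^sup>+h. increment v p R (real K *\<^sub>R h) \<partial>lborel)"
    using nn_integral_lborel_dilation[of "increment v p R" "real K" 0] K by simp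
  also have "(\<integral>\<^sup>+h. increment v p R (real K *\<^sub>R h) \<partial>lborel)
    \<le> (\<integral>\<^sup>+h. ennreal (real K powr p) * (indicator ?D h * increment v p R h) \<partial>lborel)"
  proof (intro nn_integral_mono)
    fix h
    have "increment v p R (real K *\<^sub>R h) \<le> (\<integral>\<^sup>+x. ennreal (real K powr (p - 1)) *
        (\<Sum>i<K. indicator ?D h * ?\<phi> (x + real i *\<^sub>R h) h) \<partial>lborel)"
      unfolding increment_def by (intro nn_integral_mono subdivided_increment_le R p K)
    also have "\<dots> = ennreal (real K powr (p - 1)) *
        (\<Sum>i<K. indicator ?D h * (\<integral>\<^sup>+x. ?\<phi> (x + real i *\<^sub>R h) h \<partial>lborel))"
      by (subst nn_integral_cmult, measurable, subst nn_integral_sum, measurable)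
         (simp add: nn_integral_cmult)
    also have "(\<lambda>i. \<integral>\<^sup>+x. ?\<phi> (x + real i *\<^sub>R h) h \<partial>lborel) = (\<lambda>i. increment v p R h)"
    proof
      fix i :: nat
      have "(\<integral>\<^sup>+x. ?\<phi> (real i *\<^sub>R h + x) h \<partial>lborel) = (\<integral>\<^sup>+x. ?\<phi> x h \<partial>lborel)"
        by (rule nn_integral_lborel_translation) measurable
      then show "(\<integral>\<^sup>+x. ?\<phi> (x + real i *\<^sub>R h) h \<partial>lborel) = increment v p R h"
        by (simp add: increment_def add.commute)
    qed
    also have "(\<Sum>i<K. indicator ?D h * increment v p R h) = ennreal (real K) * (indicator ?D h * increment v p R h)"
      by (simp add: ennreal_of_nat_eq_real_of_nat)
    also have "ennreal (real K powr (p - 1)) * (ennreal (real K) * (indicator ?D h * increment v p R h))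
       = ennreal (real K powr p) * (indicator ?D h * increment v p R h)"
      using Kr by (simp add: mult.assoc[symmetric] ennreal_mult''[symmetric] powr_diff)
    finally show "increment v p R (real K *\<^sub>R h) \<le> ennreal (real K powr p) * (indicator ?D h * increment v p R h)" .
  qed
  also have "\<dots> = ennreal (real K powr p) * (\<integral>\<^sup>+h. indicator ?D h * increment v p R h \<partial>lborel)"
    by (rule nn_integral_cmult) measurable
  also have "ennreal (real K ^ ?n) * (ennreal (real K powr p) * (\<integral>\<^sup>+h. indicator ?D h * increment v p R h \<partial>lborel))
     = ennreal (real K powr (?n + p)) * (\<integral>\<^sup>+h. indicator ?D h * increment v p R h \<partial>lborel)"
    using Kr by (simp add: mult.assoc[symmetric] ennreal_mult''[symmetric] powr_add powr_realpow)
  finally show ?thesis by (simp add: mult_left_mono)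
qed

text \<open>
  The ratio of the geometric series is $2^a \ge 2$, so the sum is at most twice its last term.
\<close>

lemma geometric_indicator_sum_le:
  fixes a T :: real
  assumes a: "1 \<le> a" and T: "0 \<le> T"
  shows "(\<Sum>k. ennreal ((2^k) powr a) * indicator {..T} (2^k)) \<le> ennreal (2 * T powr a)"
proof -
  define \<rho> where "\<rho> = 2 powr a"
  have \<rho>: "2 \<le> \<rho>" unfolding \<rho>_def using powr_mono[of 1 a 2] a by simp
  have pw: "((2::real)^k) powr a = \<rho> ^ k" for k
    unfolding \<rho>_def by (simp add: powr_power powr_realpow[symmetric] powr_powr mult.commute)
  have geo: "(\<Sum>k<Suc m. \<rho> ^ k) \<le> 2 * \<rho> ^ m" for m
  proof (induction m)
    case (Suc m)
    have "2 * \<rho> ^ m \<le> \<rho> * \<rho> ^ m" using \<rho> by (intro mult_right_mono) auto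
    then show ?case using Suc by simp
  qed simp
  have part: "(\<Sum>k<m. ennreal ((2^k) powr a) * indicator {..T} (2^k)) \<le> ennreal (2 * T powr a)" for m
  proof (induction m)
    case (Suc m)
    show ?case
    proof (cases "2 ^ m \<le> T")
      case True
      have "(\<Sum>k<Suc m. ennreal ((2^k) powr a) * indicator {..T} (2^k)) \<le> (\<Sum>k<Suc m. ennreal (\<rho> ^ k))"
        by (intro sum_mono) (auto simp: pw split: split_indicator)
      also have "\<dots> = ennreal (\<Sum>k<Suc m. \<rho> ^ k)" using \<rho> by (intro sum_ennreal) auto
      also have "\<dots> \<le> ennreal (2 * (2^m) powr a)" using geo[of m] by (intro ennreal_leI) (simp add: pw)
      also have "\<dots> \<le> ennreal (2 * T powr a)"
        using True a by (intro ennreal_leI mult_left_mono powr_mono2) auto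
      finally show ?thesis .
    qed (use Suc in simp)
  qed simp
  show ?thesis unfolding suminf_eq_SUP by (rule SUP_least) (rule part)
qed

text \<open>
  The double integral of $|v(x)-v(y)|^p$ is controlled at every scale $2^{-k}$ with the weights $q^k$, where
  $q = 2^{-p(1-\delta)}$.  Adding all scales improves the trivial one-scale bound by $1-q \le p(1-\delta)$.
\<close>

theorem fractional_poincare_convex:
  fixes v :: "'a::euclidean_space \<Rightarrow> real" and p d :: real
  assumes v [measurable]: "v \<in> borel_measurable borel" and Rb [measurable]: "R \<in> sets borel"
    and R: "convex R" "\<And>x y. x \<in> R \<Longrightarrow> y \<in> R \<Longrightarrow> norm (x - y) \<le> d"
    and p: "1 \<le> p" and \<delta>: "0 < \<delta>" "\<delta> < 1" and d: "0 < d"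
  shows "(\<integral>\<^sup>+x\<in>R. (\<integral>\<^sup>+y\<in>R. ennreal (\<bar>v x - v y\<bar> powr p) \<partial>lborel) \<partial>lborel)
    \<le> ennreal (2 * p * (1 - \<delta>) * d powr (DIM('a) + \<delta> * p)) *
      (\<integral>\<^sup>+x\<in>R. (\<integral>\<^sup>+y\<in>R. ennreal (\<bar>v x - v y\<bar> powr p / norm (x - y) powr (DIM('a) + \<delta> * p)) \<partial>lborel) \<partial>lborel)"
    (is "?D \<le> _ * ?G")
proof -
  define a where "a = DIM('a) + \<delta> * p"
  define s where "s = p * (1 - \<delta>)"
  define q where "q = 2 powr (- s)"
  have "0 \<le> \<delta> * p" using \<delta> p by simp
  then have a: "1 \<le> a" unfolding a_def using DIM_positive[where 'a='a] by linarith
  have s: "0 < s" unfolding s_def using p \<delta> by simp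
  have q: "0 < q" "q < 1" unfolding q_def using s using powr_less_mono[of "-s" 0 2] by auto
  have q_s: "1 - q \<le> s"
  proof -
    have "1 + (- s * ln 2) \<le> exp (- s * ln 2)" by (rule exp_ge_add_one_self)
    also have "exp (- s * ln 2) = q" by (simp add: q_def powr_def mult.commute)
    finally have "1 - q \<le> s * ln 2" by simp
    also have "\<dots> \<le> s * 1" using s ln_2_less_1 by (intro mult_left_mono) auto
    finally show ?thesis by simp
  qed
  let ?I = "increment v p R"
  let ?w = "\<lambda>h::'a. ennreal (1 / norm h powr a)"
  have G: "?G = (\<integral>\<^sup>+h. ?w h * ?I h \<partial>lborel)"
  proof -
    have "?G = (\<integral>\<^sup>+x\<in>R. (\<integral>\<^sup>+y\<in>R. ennreal (\<bar>v x - v y\<bar> powr p) * ?w (y - x) \<partial>lborel) \<partial>lborel)"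
      unfolding a_def by (simp add: ennreal_mult''[symmetric] norm_minus_commute)
    also have "\<dots> = (\<integral>\<^sup>+h. ?w h * ?I h \<partial>lborel)"
      by (rule double_integral_eq_increment) measurable
    finally show ?thesis .
  qed
  \<comment> \<open>The weight of scale $2^{-k}$ is $2^{k(n+\<delta>p)}$; against the factor $2^{k(n+p)}$ it leaves $q^k$.\<close>
  have each: "ennreal (q ^ k) * ?D
      \<le> (\<integral>\<^sup>+h. ennreal ((2^k) powr a) * indicator {h. norm h \<le> d / 2^k} h * ?I h \<partial>lborel)" for k
  proof -
    have "ennreal (q ^ k) * ?D \<le> ennreal (q ^ k) * (ennreal (real (2^k) powr (DIM('a) + p)) *
        (\<integral>\<^sup>+h. indicator {h. norm h \<le> d / real (2^k)} h * ?I h \<partial>lborel))"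
      by (intro mult_left_mono double_integral_le_small_increments v Rb R p) auto
    also have "\<dots> = ennreal ((2^k) powr a) * (\<integral>\<^sup>+h. indicator {h. norm h \<le> d / 2^k} h * ?I h \<partial>lborel)"
    proof -
      have "q ^ k = (2^k) powr (- s)"
        unfolding q_def by (simp add: powr_power powr_realpow[symmetric] powr_powr mult.commute)
      then have "q ^ k * real (2^k) powr (DIM('a) + p) = (2^k) powr (- s + (DIM('a) + p))"
        by (subst powr_add) simp
      also have "- s + (DIM('a) + p) = a" by (simp add: s_def a_def algebra_simps)
      finally show ?thesis
        using q by (simp add: mult.assoc[symmetric] ennreal_mult''[symmetric])
    qed
    also have "\<dots> = (\<integral>\<^sup>+h. ennreal ((2^k) powr a) * indicator {h. norm h \<le> d / 2^k} h * ?I h \<partial>lborel)"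
      by (subst nn_integral_cmult[symmetric]) (auto simp: mult.assoc)
    finally show ?thesis .
  qed
  have "ennreal (1 / (1 - q)) * ?D = (\<Sum>k. ennreal (q ^ k)) * ?D"
    using q by (subst suminf_ennreal2) (auto simp: suminf_geometric summable_geometric)
  also have "\<dots> = (\<Sum>k. ennreal (q ^ k) * ?D)" by simp
  also have "\<dots> \<le> (\<Sum>k. (\<integral>\<^sup>+h. ennreal ((2^k) powr a) * indicator {h. norm h \<le> d / 2^k} h * ?I h \<partial>lborel))"
    by (intro suminf_le each) auto
  also have "\<dots> = (\<integral>\<^sup>+h. (\<Sum>k. ennreal ((2^k) powr a) * indicator {h. norm h \<le> d / 2^k} h * ?I h) \<partial>lborel)"
    by (subst nn_integral_suminf) auto
  also have "\<dots> \<le> (\<integral>\<^sup>+h. ennreal (2 * d powr a) * (?w h * ?I h) \<partial>lborel)"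
  proof (intro nn_integral_mono)
    fix h :: 'a
    show "(\<Sum>k. ennreal ((2^k) powr a) * indicator {h. norm h \<le> d / 2^k} h * ?I h)
       \<le> ennreal (2 * d powr a) * (?w h * ?I h)"
    proof (cases "h = 0")
      case True
      then show ?thesis using p by (simp add: increment_def)
    next
      case False
      have ind: "indicator {h. norm h \<le> d / 2^k} h = (indicator {..d / norm h} (2^k::real) :: ennreal)" for k
        using False by (simp add: indicator_def field_simps)
      have "(\<Sum>k. ennreal ((2^k) powr a) * indicator {h. norm h \<le> d / 2^k} h * ?I h)
         = (\<Sum>k. ennreal ((2^k) powr a) * indicator {..d / norm h} (2^k)) * ?I h"
        unfolding ind by simp
      also have "\<dots> \<le> ennreal (2 * (d / norm h) powr a) * ?I h"
        using a d by (intro mult_right_mono geometric_indicator_sum_le) auto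
      also have "\<dots> = ennreal (2 * d powr a) * (?w h * ?I h)"
        using d by (simp add: powr_divide mult.assoc[symmetric] ennreal_mult''[symmetric])
      finally show ?thesis .
    qed
  qed
  also have "\<dots> = ennreal (2 * d powr a) * ?G"
    unfolding G by (rule nn_integral_cmult) measurable
  finally have main: "ennreal (1 / (1 - q)) * ?D \<le> ennreal (2 * d powr a) * ?G" .
  have "?D = ennreal (1 - q) * (ennreal (1 / (1 - q)) * ?D)"
    using q by (simp add: mult.assoc[symmetric] ennreal_mult''[symmetric])
  also have "\<dots> \<le> ennreal s * (ennreal (2 * d powr a) * ?G)"
    by (rule mult_mono[OF ennreal_leI[OF q_s] main]) auto
  also have "\<dots> = ennreal (s * (2 * d powr a)) * ?G"
    using s by (simp only: mult.assoc[symmetric] ennreal_mult'[OF less_imp_le])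
  also have "s * (2 * d powr a) = 2 * p * (1 - \<delta>) * d powr a" by (simp add: s_def)
  finally show ?thesis unfolding a_def .
qed


section \<open>Energy of oscillating cells\<close>

text \<open>
  An elementary form of the inequality of Jensen: averaged over $|v(x)-v(y)|$ with $t$ equal to half of a
  lower bound for the mean oscillation, it bounds the $p$-th power of that lower bound by the average of
  $|v(x)-v(y)|^p$, up to the factor $2^p$.
\<close>

lemma le_threshold_plus_powr:
  fixes x t p :: real
  assumes "0 \<le> x" "0 < t" "1 \<le> p"
  shows "x \<le> t + t powr (1 - p) * x powr p"
proof (cases "x \<le> t")
  case True
  then show ?thesis using assms by (simp add: add_increasing2)
next
  case False
  have "x = t powr (1 - p) * (x * t powr (p - 1))" using assms by (simp add: powr_diff)
  also have "\<dots> \<le> t powr (1 - p) * (x * x powr (p - 1))"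
    using False assms by (intro mult_left_mono powr_mono2) auto
  also have "\<dots> = t powr (1 - p) * x powr p" using False assms by (simp add: powr_diff)
  finally show ?thesis using assms by simp
qed

definition gagliardo :: "real \<Rightarrow> real \<Rightarrow> 'a::euclidean_space set \<Rightarrow> ('a \<Rightarrow> real) \<Rightarrow> 'a \<Rightarrow> ennreal" where
  "gagliardo p \<delta> R v x =
     (\<integral>\<^sup>+y\<in>R. ennreal (\<bar>v x - v y\<bar> powr p / norm (x - y) powr (real DIM('a) + \<delta> * p)) \<partial>lborel)"

lemma gagliardo_borel [measurable]:
  assumes [measurable]: "v \<in> borel_measurable borel" "R \<in> sets borel"
  shows "gagliardo p \<delta> R v \<in> borel_measurable borel"
  unfolding gagliardo_def by measurable

text \<open>
  Cells of bounded eccentricity: the diameter is comparable to the $n$-th root of the volume, which plays the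
  role of the side length.
\<close>

locale round_cell_tree = cell_tree base cell \<theta>
  for base :: "'a::euclidean_space set" and cell \<theta> +
  fixes \<Delta> :: real
  assumes cell_convex: "x \<in> base \<Longrightarrow> convex (cell k x)"
    and cell_diameter: "x \<in> base \<Longrightarrow> y \<in> cell k x \<Longrightarrow> z \<in> cell k x \<Longrightarrow>
      norm (y - z) \<le> \<Delta> * measure lborel (cell k x) powr (1 / DIM('a))"
    and \<Delta>_ge_1: "1 \<le> \<Delta>"
begin

text \<open>
  The $n$-th root of the volume of \<open>S\<close> is its side length when \<open>S\<close> is a cube, so the
  factor is $\ell(S)^\alpha$.
\<close>

definition fractional_cell_maximal :: "real \<Rightarrow> ('a \<Rightarrow> ennreal) \<Rightarrow> 'a \<Rightarrow> ennreal" where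
  "fractional_cell_maximal \<alpha> w x =
     (SUP S\<in>cells. ennreal (measure lborel S powr (\<alpha> / DIM('a))) * cell_average w S * indicator S x)"

lemma fractional_cell_maximal_borel [measurable]: "fractional_cell_maximal \<alpha> w \<in> borel_measurable borel"
  unfolding fractional_cell_maximal_def
proof (rule borel_measurable_SUP)
  show "countable cells" by (rule countable_cells)
  fix S assume "S \<in> cells"
  then have [measurable]: "S \<in> sets borel" using cellsD(1) by auto
  show "(\<lambda>x. ennreal (measure lborel S powr (\<alpha> / DIM('a))) * cell_average w S * indicator S x)
    \<in> borel_measurable borel" by measurable
qed

lemma fractional_cell_maximal_ge:
  "S \<in> cells \<Longrightarrow> x \<in> S \<Longrightarrow>
    ennreal (measure lborel S powr (\<alpha> / DIM('a))) * cell_average w S \<le> fractional_cell_maximal \<alpha> w x"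
  unfolding fractional_cell_maximal_def by (rule SUP_upper2[of S]) auto

definition energy :: "real \<Rightarrow> real \<Rightarrow> ('a \<Rightarrow> ennreal) \<Rightarrow> ('a \<Rightarrow> real) \<Rightarrow> ennreal" where
  "energy p \<delta> w v =
     (\<integral>\<^sup>+x\<in>base. gagliardo p \<delta> base v x * fractional_cell_maximal (\<delta> * p) w x \<partial>lborel)"

text \<open>
  Up to the factor $1-\delta$, the constant with which the Gagliardo integral of a cell controls the $p$-th
  power of its mean oscillation: $2^p$ from \<open>le_threshold_plus_powr\<close>, the rest from
  \<open>fractional_poincare_convex\<close> with $\delta$ replaced by $1$ in the exponent of \<open>\<Delta>\<close>.
\<close>

definition \<kappa> :: "real \<Rightarrow> real" where
  "\<kappa> p = 2 powr p * (2 * p * \<Delta> powr (real DIM('a) + p))"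

lemma double_integral_cell_le:
  assumes v [measurable]: "v \<in> borel_measurable borel" and R: "R \<in> cells"
    and p: "1 \<le> p" and \<delta>: "0 < \<delta>" "\<delta> < 1"
  shows "(\<integral>\<^sup>+x\<in>R. (\<integral>\<^sup>+y\<in>R. ennreal (\<bar>v x - v y\<bar> powr p) \<partial>lborel) \<partial>lborel)
    \<le> ennreal (2 * p * \<Delta> powr (real DIM('a) + p) * (1 - \<delta>) *
        (measure lborel R * measure lborel R powr (\<delta> * p / real DIM('a))))
      * (\<integral>\<^sup>+x\<in>R. gagliardo p \<delta> R v x \<partial>lborel)"
proof -
  let ?n = "real DIM('a)"
  let ?m = "measure lborel R"
  let ?d = "\<Delta> * ?m powr (1 / DIM('a))"
  note cR = cellsD[OF R]
  have d: "0 < ?d" using cR(4) \<Delta>_ge_1 by simp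
  have cvx: "convex R" "\<And>x y. x \<in> R \<Longrightarrow> y \<in> R \<Longrightarrow> norm (x - y) \<le> ?d"
    using R cell_convex cell_diameter by (auto simp: cells_def)
  have n: "0 < ?n" by simp
  have "?d powr (?n + \<delta> * p) = \<Delta> powr (?n + \<delta> * p) * ?m powr ((1 / ?n) * (?n + \<delta> * p))"
    using \<Delta>_ge_1 by (simp add: powr_mult powr_powr)
  also have "(1 / ?n) * (?n + \<delta> * p) = 1 + \<delta> * p / ?n" using n by (simp add: field_simps)
  also have "?m powr (1 + \<delta> * p / ?n) = ?m * ?m powr (\<delta> * p / ?n)"
    using cR(4) by (simp add: powr_add)
  also have "\<Delta> powr (?n + \<delta> * p) * (?m * ?m powr (\<delta> * p / ?n))
      \<le> \<Delta> powr (?n + p) * (?m * ?m powr (\<delta> * p / ?n))"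
    using \<Delta>_ge_1 \<delta> p by (intro mult_right_mono powr_mono) (auto simp: mult_left_le_one_le)
  finally have dle: "?d powr (?n + \<delta> * p) \<le> \<Delta> powr (?n + p) * (?m * ?m powr (\<delta> * p / ?n))" .
  have "(\<integral>\<^sup>+x\<in>R. (\<integral>\<^sup>+y\<in>R. ennreal (\<bar>v x - v y\<bar> powr p) \<partial>lborel) \<partial>lborel)
    \<le> ennreal (2 * p * (1 - \<delta>) * ?d powr (real DIM('a) + \<delta> * p)) * (\<integral>\<^sup>+x\<in>R. gagliardo p \<delta> R v x \<partial>lborel)"
    unfolding gagliardo_def using cR(1) by (intro fractional_poincare_convex v cvx p \<delta> d) auto
  also have "\<dots> \<le> ennreal (2 * p * (1 - \<delta>) * (\<Delta> powr (?n + p) * (?m * ?m powr (\<delta> * p / ?n))))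
      * (\<integral>\<^sup>+x\<in>R. gagliardo p \<delta> R v x \<partial>lborel)"
    using dle p \<delta> by (intro mult_right_mono ennreal_leI mult_left_mono) auto
  also have "2 * p * (1 - \<delta>) * (\<Delta> powr (?n + p) * (?m * ?m powr (\<delta> * p / ?n)))
      = 2 * p * \<Delta> powr (?n + p) * (1 - \<delta>) * (?m * ?m powr (\<delta> * p / ?n))"
    by (simp add: mult_ac)
  finally show ?thesis .
qed

lemma oscillating_cell_energy:
  assumes f: "f \<in> borel_measurable borel" "\<And>x. \<bar>f x\<bar> \<le> b" 
    and R: "R \<in> oscillating f t" and t: "0 < t"
    and p: "1 \<le> p" and \<delta>: "0 < \<delta>" "\<delta> < 1"
  shows "ennreal (t powr p * measure lborel R)
    \<le> ennreal (\<kappa> p * (1 - \<delta>) * measure lborel R powr (\<delta> * p / real DIM('a)))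
      * (\<integral>\<^sup>+x\<in>R. gagliardo p \<delta> R f x \<partial>lborel)"
proof -
  note [measurable] = f(1)
  have Rc: "R \<in> cells"
    and osc: "ennreal (t * measure lborel R) < (\<integral>\<^sup>+x\<in>R. ennreal \<bar>f x - mean f R\<bar> \<partial>lborel)"
    using R by (auto simp: oscillating_def)
  note cR = cellsD[OF Rc] and [measurable] = cellsD(1)[OF Rc]
  define m where "m = measure lborel R"
  have m: "0 < m" "emeasure lborel R = ennreal m" using cR by (auto simp: m_def)
  define D where "D = (\<integral>\<^sup>+x\<in>R. (\<integral>\<^sup>+y\<in>R. ennreal (\<bar>f x - f y\<bar> powr p) \<partial>lborel) \<partial>lborel)"
  define G where "G = (\<integral>\<^sup>+x\<in>R. gagliardo p \<delta> R f x \<partial>lborel)"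
  define s where "s = t / 2"
  have s: "0 < s" "t = 2 * s" unfolding s_def using t by auto
  define z where "z = s powr (1 - p)"
  have "ennreal (t * m) * ennreal m \<le> (\<integral>\<^sup>+x\<in>R. ennreal \<bar>f x - mean f R\<bar> \<partial>lborel) * ennreal m"
    using osc by (intro mult_right_mono) (auto simp: m_def)
  also have "\<dots> \<le> (\<integral>\<^sup>+x\<in>R. (\<integral>\<^sup>+y\<in>R. ennreal \<bar>f x - f y\<bar> \<partial>lborel) \<partial>lborel)"
    unfolding m_def using cR f by (intro mean_oscillation_le_double_integral) auto
  also have "\<dots> \<le> (\<integral>\<^sup>+x\<in>R. (\<integral>\<^sup>+y\<in>R. ennreal s + ennreal z * ennreal (\<bar>f x - f y\<bar> powr p) \<partial>lborel) \<partial>lborel)"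
  proof (intro nn_integral_mono mult_right_mono)
    fix x y
    have "\<bar>f x - f y\<bar> \<le> s + z * \<bar>f x - f y\<bar> powr p"
      unfolding z_def using s p by (intro le_threshold_plus_powr) auto
    then show "ennreal \<bar>f x - f y\<bar> \<le> ennreal s + ennreal z * ennreal (\<bar>f x - f y\<bar> powr p)"
      using s by (simp add: ennreal_leI z_def flip: ennreal_mult'' ennreal_plus)
  qed auto
  also have "\<dots> = (\<integral>\<^sup>+x. ennreal (s * m) * indicator R x + 
      ennreal z * ((\<integral>\<^sup>+y\<in>R. ennreal (\<bar>f x - f y\<bar> powr p) \<partial>lborel) * indicator R x) \<partial>lborel)"
  proof (intro nn_integral_cong)
    fix x
    have "(\<integral>\<^sup>+y\<in>R. ennreal s + ennreal z * ennreal (\<bar>f x - f y\<bar> powr p) \<partial>lborel)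
      = (\<integral>\<^sup>+y. ennreal s * indicator R y + ennreal z * (ennreal (\<bar>f x - f y\<bar> powr p) * indicator R y) \<partial>lborel)"
      by (intro nn_integral_cong) (auto split: split_indicator)
    also have "\<dots> = ennreal (s * m) + ennreal z * (\<integral>\<^sup>+y\<in>R. ennreal (\<bar>f x - f y\<bar> powr p) \<partial>lborel)"
      using s m by (subst nn_integral_add)
        (auto simp: nn_integral_cmult_indicator nn_integral_cmult ennreal_mult')
    finally show "(\<integral>\<^sup>+y\<in>R. ennreal s + ennreal z * ennreal (\<bar>f x - f y\<bar> powr p) \<partial>lborel) * indicator R x
      = ennreal (s * m) * indicator R x + 
      ennreal z * ((\<integral>\<^sup>+y\<in>R. ennreal (\<bar>f x - f y\<bar> powr p) \<partial>lborel) * indicator R x)"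
      by (auto split: split_indicator)
  qed
  also have "\<dots> = ennreal (s * m * m) + ennreal z * D"
    unfolding D_def using s m
    by (subst nn_integral_add) (auto simp: nn_integral_cmult_indicator nn_integral_cmult ennreal_mult'')
  finally have "ennreal (s * m * m) + ennreal (s * m * m) \<le> ennreal (s * m * m) + ennreal z * D"
    using s m by (simp add: algebra_simps flip: ennreal_mult'' ennreal_plus)
  then have "ennreal (s * m * m) \<le> ennreal z * D" by (simp add: ennreal_add_left_cancel_le)
  then have "ennreal (s powr (p - 1)) * ennreal (s * m * m) \<le> ennreal (s powr (p - 1)) * (ennreal z * D)"
    by (intro mult_left_mono) auto
  also have "\<dots> = D"
    using s by (simp add: z_def mult.assoc[symmetric] flip: ennreal_mult'' powr_add)
  also have "ennreal (s powr (p - 1)) * ennreal (s * m * m) = ennreal m * ennreal (s powr p * m)"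
    using s m by (simp add: powr_diff flip: ennreal_mult'')
  also have "D \<le> ennreal (2 * p * \<Delta> powr (real DIM('a) + p) * (1 - \<delta>) * (m * m powr (\<delta> * p / real DIM('a)))) * G"
    unfolding D_def G_def m_def by (rule double_integral_cell_le[OF f(1) Rc p \<delta>])
  also have "2 * p * \<Delta> powr (real DIM('a) + p) * (1 - \<delta>) * (m * m powr (\<delta> * p / DIM('a)))
      = m * (2 * p * \<Delta> powr (real DIM('a) + p) * (1 - \<delta>) * m powr (\<delta> * p / real DIM('a)))"
    by simp
  also have "ennreal \<dots> * G
      = ennreal m * (ennreal (2 * p * \<Delta> powr (real DIM('a) + p) * (1 - \<delta>) * m powr (\<delta> * p / real DIM('a))) * G)"
    using m by (subst ennreal_mult') (auto simp: mult.assoc)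
  finally have "ennreal (s powr p * m) \<le> ennreal (2 * p * \<Delta> powr (real DIM('a) + p) * (1 - \<delta>) * m powr (\<delta> * p / real DIM('a))) * G"
    using m by (simp add: ennreal_mult_le_mult_iff)
  then have "ennreal (2 powr p) * ennreal (s powr p * m) 
     \<le> ennreal (2 powr p) * (ennreal (2 * p * \<Delta> powr (real DIM('a) + p) * (1 - \<delta>) * m powr (\<delta> * p / real DIM('a))) * G)"
    by (intro mult_left_mono) auto
  also have "\<dots> = ennreal (\<kappa> p * (1 - \<delta>) * m powr (\<delta> * p / real DIM('a))) * G"
    using p \<delta> by (simp add: \<kappa>_def mult.assoc[symmetric] flip: ennreal_mult'')
  also have "ennreal (2 powr p) * ennreal (s powr p * m) = ennreal (t powr p * m)"
    using s m by (simp add: powr_mult mult.assoc flip: ennreal_mult'')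
  finally show ?thesis unfolding m_def G_def .
qed

lemma \<kappa>_pos: "1 \<le> p \<Longrightarrow> 0 < \<kappa> p"
  using \<Delta>_ge_1 by (simp add: \<kappa>_def)

text \<open>
  On an oscillating cell $R$ the average of $w$ times $|R|^{\delta p/n}$ is a lower bound for the fractional
  maximal function at every point of $R$.  The maximal oscillating cells are disjoint, which makes the sum
  of the local energies at most the total energy.
\<close>

lemma weight_oscillating_le_energy:
  assumes f: "f \<in> borel_measurable borel" "\<And>x. \<bar>f x\<bar> \<le> b" 
    and w [measurable]: "w \<in> borel_measurable borel"
    and t: "0 < t" and p: "1 \<le> p" and \<delta>: "0 < \<delta>" "\<delta> < 1"
  shows "ennreal (t powr p) * (\<integral>\<^sup>+x\<in>\<Union>(oscillating f t). w x \<partial>lborel)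
    \<le> ennreal (\<kappa> p * (1 - \<delta>)) * energy p \<delta> w f"
proof -
  note [measurable] = f(1)
  let ?M = "maximal_cells (oscillating f t)"
  let ?K = "ennreal (\<kappa> p * (1 - \<delta>))"
  let ?g = "\<lambda>x. ?K * (gagliardo p \<delta> base f x * fractional_cell_maximal (\<delta> * p) w x)"
  have sub: "oscillating f t \<subseteq> cells" by (auto simp: oscillating_def)
  have UM: "\<Union>?M = \<Union>(oscillating f t)" by (rule maximal_cells_Union[OF sub])
  have "(\<integral>\<^sup>+x\<in>\<Union>?M. ennreal (t powr p) * w x \<partial>lborel) \<le> (\<integral>\<^sup>+x\<in>\<Union>?M. ?g x \<partial>lborel)"
  proof (rule set_nn_integral_Union_mono_disjoint)
    fix R assume "R \<in> ?M"
    then have R: "R \<in> oscillating f t" "R \<in> cells" using sub maximal_cells_subset by auto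
    note cR = cellsD[OF R(2)] and [measurable] = cellsD(1)[OF R(2)]
    let ?m = "measure lborel R" and ?A = "cell_average w R"
    let ?F = "ennreal (?m powr (\<delta> * p / real DIM('a))) * ?A"
    have "(\<integral>\<^sup>+x\<in>R. ennreal (t powr p) * w x \<partial>lborel) = ennreal (t powr p) * (?A * emeasure lborel R)"
      by (simp add: nn_integral_cmult mult.assoc cell_average_mult[OF R(2)])
    also have "\<dots> = ennreal (t powr p * ?m) * ?A"
      unfolding cR(5) using t by (simp add: ennreal_mult'' mult_ac)
    also have "\<dots> \<le> (ennreal (\<kappa> p * (1 - \<delta>) * ?m powr (\<delta> * p / real DIM('a))) * (\<integral>\<^sup>+x\<in>R. gagliardo p \<delta> R f x \<partial>lborel)) * ?A"
      by (intro mult_right_mono oscillating_cell_energy[OF f R(1) t p \<delta>]) auto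
    also have "\<dots> = ?K * (\<integral>\<^sup>+x\<in>R. gagliardo p \<delta> R f x \<partial>lborel) * ?F"
      using \<kappa>_pos[OF p] \<delta> by (simp add: ennreal_mult'' mult_ac)
    also have "\<dots> = (\<integral>\<^sup>+x. ?K * ((gagliardo p \<delta> R f x * indicator R x) * ?F) \<partial>lborel)"
      by (subst nn_integral_cmult, measurable, subst nn_integral_multc, measurable) (simp add: mult.assoc)
    also have "\<dots> \<le> (\<integral>\<^sup>+x\<in>R. ?g x \<partial>lborel)"
    proof (intro nn_integral_mono)
      fix x
      show "?K * ((gagliardo p \<delta> R f x * indicator R x) * ?F) \<le> ?g x * indicator R x"
      proof (cases "x \<in> R")
        case True
        have "gagliardo p \<delta> R f x \<le> gagliardo p \<delta> base f x"
          unfolding gagliardo_def using cR(2)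
          by (intro nn_integral_mono) (auto split: split_indicator)
        then show ?thesis
          using True fractional_cell_maximal_ge[OF R(2) True, of "\<delta> * p" w]
          by (simp add: mult_left_mono mult_mono)
      qed simp
    qed
    finally show "(\<integral>\<^sup>+x\<in>R. ennreal (t powr p) * w x \<partial>lborel) \<le> (\<integral>\<^sup>+x\<in>R. ?g x \<partial>lborel)" .
  qed (use sub maximal_cells_countable maximal_cells_disjoint maximal_cells_borel in auto)
  also have "\<dots> \<le> (\<integral>\<^sup>+x\<in>base. ?g x \<partial>lborel)"
    unfolding UM using sub cellsD(2) by (intro nn_integral_mono) (auto split: split_indicator)
  also have "\<dots> = ?K * energy p \<delta> w f"
    unfolding energy_def by (simp add: nn_integral_cmult mult.assoc)
  also have "(\<integral>\<^sup>+x\<in>\<Union>?M. ennreal (t powr p) * w x \<partial>lborel)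
      = ennreal (t powr p) * (\<integral>\<^sup>+x\<in>\<Union>(oscillating f t). w x \<partial>lborel)"
    unfolding UM by (simp add: nn_integral_cmult mult.assoc)
  finally show ?thesis .
qed

end


section \<open>Truncation\<close>

definition clamp_to :: "real \<Rightarrow> real \<Rightarrow> real \<Rightarrow> real" where
  "clamp_to c s x = max c (min x (c + s))"

lemma clamp_to_borel [measurable]:
  assumes [measurable]: "u \<in> borel_measurable M"
  shows "(\<lambda>x. clamp_to c s (u x)) \<in> borel_measurable M"
  unfolding clamp_to_def by measurable

context round_cell_tree
begin

definition weak_const :: "real \<Rightarrow> real \<Rightarrow> real \<Rightarrow> real" where
  "weak_const p \<delta> W = 12 * ((9 * p * W * (\<theta> + 2)) powr p * (\<kappa> p * (1 - \<delta>)))"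

lemma weak_const_pos: "1 \<le> p \<Longrightarrow> \<delta> < 1 \<Longrightarrow> 1 \<le> W \<Longrightarrow> 0 < weak_const p \<delta> W"
  using \<kappa>_pos ratio_gt_1 by (simp add: weak_const_def)

lemma weak_type_energy:
  assumes f: "f \<in> borel_measurable borel" "\<And>x. \<bar>f x\<bar> \<le> b"
    and w [measurable]: "w \<in> borel_measurable borel" and wfin: "(\<integral>\<^sup>+x\<in>base. w x \<partial>lborel) < top"
    and W: "1 \<le> W"
      "\<And>P. P \<in> cells \<Longrightarrow> (\<integral>\<^sup>+x\<in>P. cell_maximal w P x \<partial>lborel) \<le> ennreal W * (\<integral>\<^sup>+x\<in>P. w x \<partial>lborel)"
    and p: "1 \<le> p" and \<delta>: "0 < \<delta>" "\<delta> < 1" and r: "0 < r"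
  shows "ennreal (r powr p) * (\<integral>\<^sup>+x\<in>{x\<in>base. mean f base + r < f x}. w x \<partial>lborel)
    \<le> ennreal (weak_const p \<delta> W) * energy p \<delta> w f"
proof (cases "energy p \<delta> w f = top")
  case True
  then show ?thesis using weak_const_pos[OF p \<delta>(2) W(1)] by (simp add: ennreal_mult_top)
next
  case False
  define E where "E = enn2real (energy p \<delta> w f)"
  have E: "energy p \<delta> w f = ennreal E" "0 \<le> E" unfolding E_def using False by (auto simp: less_top)
  define B where "B = \<kappa> p * (1 - \<delta>) * E"
  have B: "0 \<le> B" unfolding B_def using \<kappa>_pos[OF p] \<delta> E by simp
  have osc: "(\<integral>\<^sup>+x\<in>\<Union>(oscillating f t). w x \<partial>lborel) \<le> ennreal (B / t powr p)" if t: "0 < t" for t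
  proof -
    have "ennreal (t powr p) * (\<integral>\<^sup>+x\<in>\<Union>(oscillating f t). w x \<partial>lborel) \<le> ennreal (\<kappa> p * (1 - \<delta>)) * energy p \<delta> w f"
      by (rule weight_oscillating_le_energy[OF f w t p \<delta>])
    also have "\<dots> = ennreal B" unfolding B_def E using E(2) by (simp add: ennreal_mult'')
    also have "B = t powr p * (B / t powr p)" using t by simp
    also have "ennreal \<dots> = ennreal (t powr p) * ennreal (B / t powr p)" by (rule ennreal_mult') simp
    finally show ?thesis using t by (simp add: ennreal_mult_le_mult_iff)
  qed
  have "ennreal (r powr p) * (\<integral>\<^sup>+x\<in>{x\<in>base. mean f base + r < f x}. w x \<partial>lborel)
     \<le> ennreal (r powr p) * ennreal (12 * ((9 * p * W * (\<theta> + 2)) powr p * B) / r powr p)"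
    by (intro mult_left_mono weak_type_from_oscillating_cells[OF f w wfin W p B osc r]) auto
  also have "\<dots> = ennreal (12 * ((9 * p * W * (\<theta> + 2)) powr p * B))"
    using r by (simp flip: ennreal_mult')
  also have "\<dots> = ennreal (weak_const p \<delta> W) * energy p \<delta> w f"
    unfolding E B_def weak_const_def using E(2) by (simp add: mult.assoc flip: ennreal_mult'')
  finally show ?thesis .
qed

lemma energy_uminus: "energy p \<delta> w (\<lambda>x. - f x) = energy p \<delta> w f"
  by (simp add: energy_def gagliardo_def abs_minus_commute add.commute[of "- f _"])

lemma mean_uminus: "mean (\<lambda>x. - f x) R = - mean f R"
  by (simp add: mean_def set_lebesgue_integral_def)

text \<open>
  The truncation takes its extreme values $c$ and $c+s$ on the two sets in the hypothesis.  Its average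
  is at distance at least $s/2$ from one of them.  If that is $c+s$, the weak type inequality bounds the upper
  set; if it is $c$, it bounds the lower set, which carries at least as much weight.
\<close>

lemma truncation_level_estimate:
  assumes u [measurable]: "u \<in> borel_measurable borel"
    and w [measurable]: "w \<in> borel_measurable borel" and wfin: "(\<integral>\<^sup>+x\<in>base. w x \<partial>lborel) < top"
    and W: "1 \<le> W"
      "\<And>P. P \<in> cells \<Longrightarrow> (\<integral>\<^sup>+x\<in>P. cell_maximal w P x \<partial>lborel) \<le> ennreal W * (\<integral>\<^sup>+x\<in>P. w x \<partial>lborel)"
    and p: "1 \<le> p" and \<delta>: "0 < \<delta>" "\<delta> < 1" and s: "0 < s"
    and half: "(\<integral>\<^sup>+x\<in>{x\<in>base. c + s \<le> u x}. w x \<partial>lborel) \<le> (\<integral>\<^sup>+x\<in>{x\<in>base. u x \<le> c}. w x \<partial>lborel)"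
  shows "ennreal ((s / 4) powr p) * (\<integral>\<^sup>+x\<in>{x\<in>base. c + s \<le> u x}. w x \<partial>lborel)
    \<le> ennreal (weak_const p \<delta> W) * energy p \<delta> w (\<lambda>x. clamp_to c s (u x))"
proof -
  let ?v = "\<lambda>x. clamp_to c s (u x)"
  have bd: "\<bar>?v x\<bar> \<le> \<bar>c\<bar> + s" for x using s unfolding clamp_to_def by linarith
  have v: "?v \<in> borel_measurable borel" by measurable
  have s4: "0 < s / 4" using s by simp
  show ?thesis
  proof (cases "mean ?v base \<le> c + s / 2")
    case True
    have "(\<integral>\<^sup>+x\<in>{x\<in>base. c + s \<le> u x}. w x \<partial>lborel)
      \<le> (\<integral>\<^sup>+x\<in>{x\<in>base. mean ?v base + s / 4 < ?v x}. w x \<partial>lborel)"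
      using True s by (intro nn_integral_mono) (auto split: split_indicator simp: clamp_to_def)
    then show ?thesis
      by (intro order_trans[OF mult_left_mono weak_type_energy[OF v bd w wfin W p \<delta> s4]]) auto
  next
    case False
    let ?v' = "\<lambda>x. - ?v x"
    have bd': "\<bar>?v' x\<bar> \<le> \<bar>c\<bar> + s" for x using bd by simp
    have v': "?v' \<in> borel_measurable borel" by measurable
    have "(\<integral>\<^sup>+x\<in>{x\<in>base. c + s \<le> u x}. w x \<partial>lborel)
      \<le> (\<integral>\<^sup>+x\<in>{x\<in>base. mean ?v' base + s / 4 < ?v' x}. w x \<partial>lborel)"
      using False s
      by (intro order_trans[OF half] nn_integral_mono) (auto split: split_indicator simp: clamp_to_def mean_uminus)
    then have "ennreal ((s / 4) powr p) * (\<integral>\<^sup>+x\<in>{x\<in>base. c + s \<le> u x}. w x \<partial>lborel)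
      \<le> ennreal (weak_const p \<delta> W) * energy p \<delta> w ?v'"
      by (intro order_trans[OF mult_left_mono weak_type_energy[OF v' bd' w wfin W p \<delta> s4]]) auto
    then show ?thesis by (simp add: energy_uminus)
  qed
qed

end

lemma sum_powr_superadditive:
  fixes a :: "nat \<Rightarrow> real"
  assumes p: "1 \<le> p" and a: "\<And>k. 0 \<le> a k"
  shows "(\<Sum>k<m. a k powr p) \<le> (\<Sum>k<m. a k) powr p"
proof -
  let ?S = "\<Sum>k<m. a k"
  have "a k powr p \<le> a k * ?S powr (p - 1)" if k: "k < m" for k
  proof (cases "a k = 0")
    case False
    then have "a k powr p = a k * a k powr (p - 1)" using a[of k] by (simp add: powr_diff)
    also have "\<dots> \<le> a k * ?S powr (p - 1)"
      using a p k by (intro mult_left_mono powr_mono2 member_le_sum) auto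
    finally show ?thesis .
  qed simp
  then have "(\<Sum>k<m. a k powr p) \<le> (\<Sum>k<m. a k * ?S powr (p - 1))" by (intro sum_mono) auto
  also have "\<dots> = ?S * ?S powr (p - 1)" by (simp add: sum_distrib_right)
  also have "\<dots> = ?S powr p" using a by (cases "?S = 0") (auto simp: powr_diff sum_nonneg less_le)
  finally show ?thesis .
qed

text \<open>
  For $y \le x$ the increment of the $k$-th truncation is $T_{k+1} - T_k$ with
  $T_k = \min(x, c+\varepsilon 2^k) - \min(y, c+\varepsilon 2^k)$, so the sum telescopes.
\<close>

lemma clamp_increments_sum_le:
  assumes \<epsilon>: "0 < \<epsilon>"
  shows "(\<Sum>k<m. \<bar>clamp_to (c + \<epsilon> * 2^k) (\<epsilon> * 2^k) x - clamp_to (c + \<epsilon> * 2^k) (\<epsilon> * 2^k) y\<bar>) \<le> \<bar>x - y\<bar>"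
proof -
  have main: "(\<Sum>k<m. \<bar>clamp_to (c + \<epsilon> * 2^k) (\<epsilon> * 2^k) x - clamp_to (c + \<epsilon> * 2^k) (\<epsilon> * 2^k) y\<bar>)
      \<le> x - y" if "y \<le> x" for x y
  proof -
    define T where "T k = min x (c + \<epsilon> * 2^k) - min y (c + \<epsilon> * 2^k)" for k :: nat
    have "\<bar>clamp_to (c + \<epsilon> * 2^k) (\<epsilon> * 2^k) x - clamp_to (c + \<epsilon> * 2^k) (\<epsilon> * 2^k) y\<bar> = T (Suc k) - T k" for k
    proof -
      have pos: "0 < \<epsilon> * 2^k" using \<epsilon> by simp
      have two: "\<epsilon> * 2^Suc k = \<epsilon> * 2^k + \<epsilon> * 2^k" by simp
      show ?thesis unfolding T_def clamp_to_def two using pos that by (auto simp: max_def min_def)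
    qed
    then have "(\<Sum>k<m. \<bar>clamp_to (c + \<epsilon> * 2^k) (\<epsilon> * 2^k) x - clamp_to (c + \<epsilon> * 2^k) (\<epsilon> * 2^k) y\<bar>)
       = T m - T 0" by (simp add: sum_lessThan_telescope)
    also have "\<dots> \<le> x - y" using that by (auto simp: T_def min_def)
    finally show ?thesis .
  qed
  show ?thesis
  proof (cases "y \<le> x")
    case True then show ?thesis using main[OF True] by simp
  next
    case False
    then show ?thesis using main[of x y] by (simp add: abs_minus_commute)
  qed
qed

lemma dyadic_level_exists:
  fixes \<epsilon> t :: real
  assumes "0 < \<epsilon>" "2 * \<epsilon> \<le> t"
  obtains k :: nat where "\<epsilon> * 2^k + \<epsilon> * 2^k \<le> t" "t \<le> 4 * (\<epsilon> * 2^k)"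
proof -
  obtain n :: nat where "t / (4 * \<epsilon>) < 2 ^ n" using real_arch_pow[of 2] by auto
  then have ex: "\<exists>k::nat. t \<le> 4 * (\<epsilon> * 2^k)" 
    using assms by (intro exI[of _ n]) (simp add: field_simps)
  define k where "k = (LEAST k::nat. t \<le> 4 * (\<epsilon> * 2^k))"
  have k: "t \<le> 4 * (\<epsilon> * 2^k)" unfolding k_def using ex by (rule LeastI_ex)
  have "\<epsilon> * 2^k + \<epsilon> * 2^k \<le> t"
  proof (cases k)
    case 0 then show ?thesis using assms by simp
  next
    case (Suc j)
    then have "\<not> t \<le> 4 * (\<epsilon> * 2^j)" using not_less_Least[of j "\<lambda>k. t \<le> 4 * (\<epsilon> * 2^k)"] by (simp add: k_def)
    then show ?thesis using Suc by simp
  qed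
  then show thesis using that k by blast
qed

context round_cell_tree
begin

lemma sum_energy_clamp_le:
  assumes u [measurable]: "u \<in> borel_measurable borel"
    and w [measurable]: "w \<in> borel_measurable borel" and p: "1 \<le> p" and \<epsilon>: "0 < \<epsilon>"
  shows "(\<Sum>k. energy p \<delta> w (\<lambda>x. clamp_to (c + \<epsilon> * 2^k) (\<epsilon> * 2^k) (u x))) \<le> energy p \<delta> w u"
proof -
  let ?v = "\<lambda>k x. clamp_to (c + \<epsilon> * 2^k) (\<epsilon> * 2^k) (u x)"
  let ?a = "real DIM('a) + \<delta> * p"
  have pw: "(\<Sum>k. ennreal (\<bar>?v k x - ?v k y\<bar> powr p / norm (x - y) powr ?a))
      \<le> ennreal (\<bar>u x - u y\<bar> powr p / norm (x - y) powr ?a)" for x y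
    unfolding suminf_eq_SUP
  proof (rule SUP_least)
    fix m
    have "(\<Sum>k<m. \<bar>?v k x - ?v k y\<bar> powr p) \<le> (\<Sum>k<m. \<bar>?v k x - ?v k y\<bar>) powr p"
      using p by (intro sum_powr_superadditive) auto
    also have "\<dots> \<le> \<bar>u x - u y\<bar> powr p"
      using p clamp_increments_sum_le[OF \<epsilon>] by (intro powr_mono2 sum_nonneg) auto
    finally have "(\<Sum>k<m. \<bar>?v k x - ?v k y\<bar> powr p) / norm (x - y) powr ?a \<le> \<bar>u x - u y\<bar> powr p / norm (x - y) powr ?a"
      by (intro divide_right_mono) auto
    then have "ennreal (\<Sum>k<m. \<bar>?v k x - ?v k y\<bar> powr p / norm (x - y) powr ?a)
       \<le> ennreal (\<bar>u x - u y\<bar> powr p / norm (x - y) powr ?a)"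
      by (intro ennreal_leI) (simp add: sum_divide_distrib)
    then show "(\<Sum>k<m. ennreal (\<bar>?v k x - ?v k y\<bar> powr p / norm (x - y) powr ?a))
       \<le> ennreal (\<bar>u x - u y\<bar> powr p / norm (x - y) powr ?a)"
      by (subst sum_ennreal) auto
  qed
  have g: "(\<Sum>k. gagliardo p \<delta> base (?v k) x) \<le> gagliardo p \<delta> base u x" for x
  proof -
    let ?h = "\<lambda>k y. ennreal (\<bar>?v k x - ?v k y\<bar> powr p / norm (x - y) powr ?a) * indicator base y"
    have "(\<integral>\<^sup>+y. (\<Sum>k. ?h k y) \<partial>lborel) = (\<Sum>k. \<integral>\<^sup>+y. ?h k y \<partial>lborel)"
      by (rule nn_integral_suminf) measurable
    then have "(\<Sum>k. gagliardo p \<delta> base (?v k) x) = (\<integral>\<^sup>+y. (\<Sum>k. ?h k y) \<partial>lborel)"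
      by (simp only: gagliardo_def)
    also have "\<dots> \<le> gagliardo p \<delta> base u x"
      unfolding gagliardo_def ennreal_suminf_multc by (intro nn_integral_mono mult_right_mono pw) simp
    finally show ?thesis .
  qed
  let ?H = "\<lambda>k x. gagliardo p \<delta> base (?v k) x * fractional_cell_maximal (\<delta> * p) w x * indicator base x"
  have "(\<integral>\<^sup>+x. (\<Sum>k. ?H k x) \<partial>lborel) = (\<Sum>k. \<integral>\<^sup>+x. ?H k x \<partial>lborel)"
    by (rule nn_integral_suminf) measurable
  then have "(\<Sum>k. energy p \<delta> w (?v k)) = (\<integral>\<^sup>+x. (\<Sum>k. ?H k x) \<partial>lborel)"
    by (simp only: energy_def)
  also have "\<dots> \<le> energy p \<delta> w u"
    unfolding energy_def ennreal_suminf_multc by (intro nn_integral_mono mult_right_mono g) simp_all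
  finally show ?thesis .
qed

text \<open>
  Above $2\varepsilon$ the function $(u-c)_+$ is at most $4 s_k$ on a set where it is at least $2 s_k$, with
  $s_k = \varepsilon 2^k$.  The truncation of $u$ between $c+s_k$ and $c+2s_k$ estimates the weight of
  that set: it is at its minimum where $u \le c$, and this is at least half of the total weight.  Letting
  $\varepsilon$ tend to $0$ removes the contribution $(2\varepsilon)^p w(Q)$ of the small values.
\<close>

lemma upper_half_estimate:
  assumes u [measurable]: "u \<in> borel_measurable borel"
    and w [measurable]: "w \<in> borel_measurable borel" and wfin: "(\<integral>\<^sup>+x\<in>base. w x \<partial>lborel) < top"
    and W: "1 \<le> W"
      "\<And>P. P \<in> cells \<Longrightarrow> (\<integral>\<^sup>+x\<in>P. cell_maximal w P x \<partial>lborel) \<le> ennreal W * (\<integral>\<^sup>+x\<in>P. w x \<partial>lborel)"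
    and p: "1 \<le> p" and \<delta>: "0 < \<delta>" "\<delta> < 1"
    and half: "(\<integral>\<^sup>+x\<in>{x\<in>base. c < u x}. w x \<partial>lborel) \<le> (\<integral>\<^sup>+x\<in>{x\<in>base. u x \<le> c}. w x \<partial>lborel)"
  shows "(\<integral>\<^sup>+x\<in>base. ennreal (max 0 (u x - c) powr p) * w x \<partial>lborel)
    \<le> ennreal (16 powr p * weak_const p \<delta> W) * energy p \<delta> w u"
proof -
  define K where "K = weak_const p \<delta> W"
  have K: "0 < K" unfolding K_def by (rule weak_const_pos[OF p \<delta>(2) W(1)])
  let ?\<nu> = "\<lambda>A. \<integral>\<^sup>+x\<in>A. w x \<partial>lborel"
  have mono: "?\<nu> A \<le> ?\<nu> A'" if "A \<subseteq> A'" for A A'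
    using that by (intro nn_integral_mono) (auto split: split_indicator)
  have approx: "(\<integral>\<^sup>+x\<in>base. ennreal (max 0 (u x - c) powr p) * w x \<partial>lborel)
      \<le> ennreal ((2 * \<epsilon>) powr p) * ?\<nu> base + ennreal (16 powr p * K) * energy p \<delta> w u" if \<epsilon>: "0 < \<epsilon>" for \<epsilon>
  proof -
    define s where "s k = \<epsilon> * 2^k" for k :: nat
    have s: "0 < s k" for k using \<epsilon> by (simp add: s_def)
    let ?L = "\<lambda>k. {x\<in>base. (c + s k) + s k \<le> u x}"
    let ?E = "\<lambda>k. energy p \<delta> w (\<lambda>x. clamp_to (c + s k) (s k) (u x))"
    have level: "ennreal ((4 * s k) powr p) * ?\<nu> (?L k) \<le> ennreal (16 powr p * K) * ?E k" for k
    proof -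
      have "?\<nu> (?L k) \<le> ?\<nu> {x\<in>base. c < u x}" using s[of k] by (intro mono) auto
      also note half
      also have "?\<nu> {x\<in>base. u x \<le> c} \<le> ?\<nu> {x\<in>base. u x \<le> c + s k}" using s[of k] by (intro mono) auto
      finally have "ennreal ((s k / 4) powr p) * ?\<nu> (?L k) \<le> ennreal K * ?E k"
        unfolding K_def by (intro truncation_level_estimate[OF u w wfin W p \<delta> s])
      then have "ennreal (16 powr p) * (ennreal ((s k / 4) powr p) * ?\<nu> (?L k)) \<le> ennreal (16 powr p) * (ennreal K * ?E k)"
        by (intro mult_left_mono) auto
      moreover have "16 powr p * (s k / 4) powr p = (4 * s k) powr p"
        using s[of k] by (subst powr_mult[symmetric]) auto
      ultimately show ?thesis by (simp add: mult.assoc[symmetric] flip: ennreal_mult')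
    qed
    have pw: "ennreal (max 0 (t - c) powr p)
      \<le> ennreal ((2 * \<epsilon>) powr p) + (\<Sum>k. ennreal ((4 * s k) powr p) * indicator {(c + s k) + s k..} t)" for t
    proof (cases "2 * \<epsilon> \<le> t - c")
      case True
      obtain k where k: "s k + s k \<le> t - c" "t - c \<le> 4 * s k"
        using dyadic_level_exists[OF \<epsilon> True] unfolding s_def by blast
      have "ennreal (max 0 (t - c) powr p) \<le> ennreal ((4 * s k) powr p)"
        using k True \<epsilon> p s[of k] by (intro ennreal_leI powr_mono2) auto
      also have "\<dots> = (\<Sum>i\<in>{k}. ennreal ((4 * s i) powr p) * indicator {(c + s i) + s i..} t)"
        using k by simp
      also have "\<dots> \<le> (\<Sum>k. ennreal ((4 * s k) powr p) * indicator {(c + s k) + s k..} t)"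
        by (rule sum_le_suminf) auto
      finally show ?thesis by (rule order_trans) (simp add: add_increasing)
    next
      case False
      then have "ennreal (max 0 (t - c) powr p) \<le> ennreal ((2 * \<epsilon>) powr p)"
        using p \<epsilon> by (intro ennreal_leI powr_mono2) auto
      then show ?thesis by (rule order_trans) simp
    qed
    have "(\<integral>\<^sup>+x\<in>base. ennreal (max 0 (u x - c) powr p) * w x \<partial>lborel)
      \<le> (\<integral>\<^sup>+x. ennreal ((2 * \<epsilon>) powr p) * (w x * indicator base x)
          + (\<Sum>k. ennreal ((4 * s k) powr p) * (w x * indicator (?L k) x)) \<partial>lborel)"
    proof (intro nn_integral_mono)
      fix x
      have ind: "indicator {(c + s k) + s k..} (u x) * w x = w x * (indicator (?L k) x)" if "x \<in> base" for k
        using that by (auto split: split_indicator)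
      show "ennreal (max 0 (u x - c) powr p) * w x * indicator base x
        \<le> ennreal ((2 * \<epsilon>) powr p) * (w x * indicator base x)
          + (\<Sum>k. ennreal ((4 * s k) powr p) * (w x * indicator (?L k) x))"
      proof (cases "x \<in> base")
        case True
        have "ennreal (max 0 (u x - c) powr p) * w x
          \<le> (ennreal ((2 * \<epsilon>) powr p) + (\<Sum>k. ennreal ((4 * s k) powr p) * indicator {(c + s k) + s k..} (u x))) * w x"
          by (intro mult_right_mono pw) auto
        also have "\<dots> = ennreal ((2 * \<epsilon>) powr p) * w x
            + (\<Sum>k. (ennreal ((4 * s k) powr p) * indicator {(c + s k) + s k..} (u x)) * w x)"
          by (simp only: distrib_right ennreal_suminf_multc)
        also have "\<dots> = ennreal ((2 * \<epsilon>) powr p) * w x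
            + (\<Sum>k. ennreal ((4 * s k) powr p) * (w x * indicator (?L k) x))"
          by (simp only: mult.assoc ind[OF True])
        finally show ?thesis using True by simp
      qed simp
    qed
    also have "\<dots> = ennreal ((2 * \<epsilon>) powr p) * ?\<nu> base + (\<Sum>k. ennreal ((4 * s k) powr p) * ?\<nu> (?L k))"
      by (subst nn_integral_add, measurable, measurable) (simp add: nn_integral_cmult nn_integral_suminf)
    also have "(\<Sum>k. ennreal ((4 * s k) powr p) * ?\<nu> (?L k)) \<le> (\<Sum>k. ennreal (16 powr p * K) * ?E k)"
      by (intro suminf_le level) auto
    also have "\<dots> = ennreal (16 powr p * K) * (\<Sum>k. ?E k)" by simp
    also have "\<dots> \<le> ennreal (16 powr p * K) * energy p \<delta> w u"
      unfolding s_def by (intro mult_left_mono sum_energy_clamp_le[OF u w p \<epsilon>]) auto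
    finally show ?thesis by (simp add: add_left_mono)
  qed
  define V where "V = enn2real (?\<nu> base)"
  have V: "?\<nu> base = ennreal V" "0 \<le> V" unfolding V_def using wfin by auto
  show ?thesis unfolding K_def[symmetric]
  proof (rule ennreal_le_epsilon)
    fix e :: real assume e: "0 < e"
    define \<epsilon> where "\<epsilon> = (e / (V + 1)) powr (1 / p) / 2"
    have \<epsilon>: "0 < \<epsilon>" unfolding \<epsilon>_def using e V by simp
    have "(2 * \<epsilon>) powr p = e / (V + 1)" unfolding \<epsilon>_def using e V p by (simp add: powr_powr)
    then have "ennreal ((2 * \<epsilon>) powr p) * ?\<nu> base = ennreal (e / (V + 1) * V)"
      using V e by (simp add: ennreal_mult'' del: times_divide_eq_left)
    also have "\<dots> \<le> ennreal e" using V e by (intro ennreal_leI) (simp add: field_simps)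
    finally have le: "ennreal ((2 * \<epsilon>) powr p) * ?\<nu> base + ennreal (16 powr p * K) * energy p \<delta> w u
       \<le> ennreal e + ennreal (16 powr p * K) * energy p \<delta> w u" by (rule add_right_mono)
    then show "(\<integral>\<^sup>+x\<in>base. ennreal (max 0 (u x - c) powr p) * w x \<partial>lborel)
       \<le> ennreal (16 powr p * K) * energy p \<delta> w u + ennreal e"
      using order_trans[OF approx[OF \<epsilon>] le] by (subst add.commute)
  qed
qed

end

text \<open>
  Take the infimum of the points where the distribution function has reached half of the total mass, and
  use its right continuity there and its left limit.
\<close>

lemma median_exists:
  fixes N :: "real measure"
  assumes "finite_borel_measure N"
  obtains c where "measure N {c<..} \<le> measure N {..c}" "measure N {..<c} \<le> measure N {c..}"
proof -
  interpret finite_borel_measure N by fact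
  have sp: "space N = UNIV" by (rule borel_UNIV)
  define T where "T = measure N UNIV"
  have split1: "measure N {c<..} = T - cdf N c" for c
    using finite_measure_compl[of "{..c}"] by (simp add: cdf_def T_def sp sets_M Compl_eq_Diff_UNIV[symmetric])
  have split2: "measure N {c..} = T - measure N {..<c}" for c
    using finite_measure_compl[of "{..<c}"] by (simp add: T_def sp sets_M Compl_eq_Diff_UNIV[symmetric])
  show thesis
  proof (cases "T = 0")
    case True
    then have "measure N A = 0" for A
      using bounded_measure[of A] measure_nonneg[of N A] by (simp add: T_def sp)
    then show thesis using that[of 0] by simp
  next
    case False
    then have T: "0 < T" using measure_nonneg[of N UNIV] unfolding T_def by linarith
    define A where "A = {c. T / 2 \<le> cdf N c}"
    have "\<forall>\<^sub>F x in at_top. T / 2 < cdf N x"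
      using order_tendstoD(1)[OF cdf_lim_at_top, of "T / 2"] T by (simp add: T_def sp)
    then obtain x1 where "T / 2 < cdf N x1" using eventually_happens trivial_limit_at_top_linorder by blast
    then have ne: "A \<noteq> {}" by (auto simp: A_def intro: less_imp_le)
    have "\<forall>\<^sub>F x in at_bot. cdf N x < T / 2"
      using order_tendstoD(2)[OF cdf_lim_at_bot, of "T / 2"] T by simp
    then obtain x0 where x0: "cdf N x0 < T / 2" using eventually_happens trivial_limit_at_bot_linorder by blast
    have bdd: "bdd_below A"
    proof (rule bdd_belowI)
      fix c assume "c \<in> A"
      then show "x0 \<le> c" using x0 cdf_nondecreasing[of c x0] by (force simp: A_def)
    qed
    define c where "c = Inf A"
    have right: "T / 2 \<le> cdf N x" if x: "c < x" for x
    proof -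
      obtain y where "y \<in> A" "y < x" using x cInf_less_iff[OF ne bdd, of x] by (auto simp: c_def)
      then show ?thesis using cdf_nondecreasing[of y x] by (auto simp: A_def)
    qed
    have left: "cdf N x \<le> T / 2" if "x < c" for x
      using that cInf_lower[OF _ bdd, of x] by (force simp: A_def c_def)
    have "(cdf N \<longlongrightarrow> cdf N c) (at_right c)"
      using cdf_is_right_cont by (simp add: continuous_within)
    then have 1: "T / 2 \<le> cdf N c"
    proof (rule tendsto_lowerbound)
      show "\<forall>\<^sub>F x in at_right c. T / 2 \<le> cdf N x"
        using eventually_at_right_less[of c] by eventually_elim (rule right)
    qed simp
    have 2: "measure N {..<c} \<le> T / 2"
      using cdf_at_left
    proof (rule tendsto_upperbound)
      show "\<forall>\<^sub>F x in at_left c. cdf N x \<le> T / 2"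
        using eventually_at_left_real[of "c - 1" c] by (auto elim!: eventually_mono dest: left)
    qed simp
    show thesis using that[of c] 1 2 split1[of c] split2[of c] by (simp add: cdf_def)
  qed
qed

context round_cell_tree
begin

text \<open>
  The median balances both tails, so \<open>upper_half_estimate\<close> applies to $u$ and to $-u$.
\<close>

theorem weighted_poincare:
  assumes u [measurable]: "u \<in> borel_measurable borel"
    and w [measurable]: "w \<in> borel_measurable borel" and wfin: "(\<integral>\<^sup>+x\<in>base. w x \<partial>lborel) < top"
    and W: "1 \<le> W"
      "\<And>P. P \<in> cells \<Longrightarrow> (\<integral>\<^sup>+x\<in>P. cell_maximal w P x \<partial>lborel) \<le> ennreal W * (\<integral>\<^sup>+x\<in>P. w x \<partial>lborel)"
    and p: "1 \<le> p" and \<delta>: "0 < \<delta>" "\<delta> < 1"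
  obtains c where "(\<integral>\<^sup>+x\<in>base. ennreal (\<bar>u x - c\<bar> powr p) * w x \<partial>lborel)
    \<le> ennreal (2 * (16 powr p * weak_const p \<delta> W)) * energy p \<delta> w u"
proof -
  let ?\<nu> = "\<lambda>A. \<integral>\<^sup>+x\<in>A. w x \<partial>lborel"
  let ?K = "16 powr p * weak_const p \<delta> W"
  define M where "M = density lborel (\<lambda>x. w x * indicator base x)"
  define N where "N = distr M borel u"
  have uM: "u \<in> borel_measurable M" unfolding M_def by simp
  have Mfin: "finite_measure M"
    by (rule finite_measureI) (use wfin in \<open>simp add: M_def emeasure_density\<close>)
  then interpret M: finite_measure M .
  have N: "finite_borel_measure N"
    unfolding N_def finite_borel_measure_def finite_borel_measure_axioms_def
    using M.finite_measure_distr[OF uM] by simp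
  then interpret N: finite_borel_measure N .
  have NA: "ennreal (measure N A) = ?\<nu> {x\<in>base. u x \<in> A}" if [measurable]: "A \<in> sets borel" for A
  proof -
    have "emeasure N A = emeasure M (u -` A)"
      unfolding N_def using uM by (subst emeasure_distr) (auto simp: M_def)
    also have "\<dots> = (\<integral>\<^sup>+x. w x * indicator base x * indicator (u -` A) x \<partial>lborel)"
      unfolding M_def by (rule emeasure_density) (auto intro!: measurable_sets_borel[OF u])
    also have "\<dots> = ?\<nu> {x\<in>base. u x \<in> A}"
      by (intro nn_integral_cong) (auto split: split_indicator)
    finally show ?thesis by (simp add: N.emeasure_eq_measure)
  qed
  obtain c where c: "measure N {c<..} \<le> measure N {..c}" "measure N {..<c} \<le> measure N {c..}"
    using median_exists[OF N] .
  have up: "?\<nu> {x\<in>base. c < u x} \<le> ?\<nu> {x\<in>base. u x \<le> c}"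
    using ennreal_leI[OF c(1)] by (simp add: NA)
  have down: "?\<nu> {x\<in>base. - c < - u x} \<le> ?\<nu> {x\<in>base. - u x \<le> - c}"
    using ennreal_leI[OF c(2)] by (simp add: NA)
  have "(\<integral>\<^sup>+x\<in>base. ennreal (\<bar>u x - c\<bar> powr p) * w x \<partial>lborel)
     \<le> (\<integral>\<^sup>+x. ennreal (max 0 (u x - c) powr p) * w x * indicator base x
          + ennreal (max 0 (- u x - - c) powr p) * w x * indicator base x \<partial>lborel)"
    using p by (intro nn_integral_mono) (auto split: split_indicator simp: abs_if max_def)
  also have "\<dots> = (\<integral>\<^sup>+x\<in>base. ennreal (max 0 (u x - c) powr p) * w x \<partial>lborel)
      + (\<integral>\<^sup>+x\<in>base. ennreal (max 0 (- u x - - c) powr p) * w x \<partial>lborel)"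
    by (rule nn_integral_add) measurable
  also have "\<dots> \<le> ennreal ?K * energy p \<delta> w u + ennreal ?K * energy p \<delta> w (\<lambda>x. - u x)"
    by (intro add_mono upper_half_estimate w wfin W p \<delta> up down) auto
  also have "\<dots> = ennreal (2 * ?K) * energy p \<delta> w u"
  proof -
    have "ennreal (2 * ?K) = 2 * ennreal ?K" by (simp add: ennreal_mult')
    then show ?thesis by (simp only: energy_uminus mult_2 distrib_right)
  qed
  finally show thesis by (rule that)
qed

end


context round_cell_tree
begin

text \<open>
  The fractional maximal function is bounded below by a positive constant on the base, so vanishing energy
  forces the Gagliardo integral to vanish, and with it the double integral of $|u(x)-u(y)|^p$.
\<close>

lemma zero_energy_imp_constant:
  assumes u [measurable]: "u \<in> borel_measurable borel"
    and w [measurable]: "w \<in> borel_measurable borel" and wpos: "(\<integral>\<^sup>+x\<in>base. w x \<partial>lborel) \<noteq> 0"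
    and p: "1 \<le> p" and \<delta>: "0 < \<delta>" "\<delta> < 1"
    and zero: "energy p \<delta> w u = 0"
  obtains c where "AE x in lborel. x \<in> base \<longrightarrow> u x = c"
proof -
  note cb = cellsD[OF base_in_cells]
  let ?F = "ennreal (measure lborel base powr (\<delta> * p / real DIM('a))) * cell_average w base"
  have "cell_average w base \<noteq> 0"
    using wpos cell_average_mult[OF base_in_cells, of w] by auto
  then have F: "?F \<noteq> 0" using cb(4) by simp
  have "(\<integral>\<^sup>+x\<in>base. gagliardo p \<delta> base u x \<partial>lborel) * ?F
      = (\<integral>\<^sup>+x. gagliardo p \<delta> base u x * indicator base x * ?F \<partial>lborel)"
    by (rule nn_integral_multc[symmetric]) measurable
  also have "\<dots> \<le> energy p \<delta> w u"
    unfolding energy_def using fractional_cell_maximal_ge[OF base_in_cells, of _ "\<delta> * p" w]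
    by (intro nn_integral_mono) (auto split: split_indicator intro!: mult_left_mono)
  finally have G0: "(\<integral>\<^sup>+x\<in>base. gagliardo p \<delta> base u x \<partial>lborel) = 0" using zero F by simp
  have "(\<integral>\<^sup>+x\<in>base. (\<integral>\<^sup>+y\<in>base. ennreal (\<bar>u x - u y\<bar> powr p) \<partial>lborel) \<partial>lborel) = 0"
    using double_integral_cell_le[OF u base_in_cells p \<delta>] by (simp add: G0)
  then have ae: "AE x in lborel. (\<integral>\<^sup>+y\<in>base. ennreal (\<bar>u x - u y\<bar> powr p) \<partial>lborel) * indicator base x = 0"
    by (subst (asm) nn_integral_0_iff_AE) auto
  have "\<exists>x\<in>base. (\<integral>\<^sup>+y\<in>base. ennreal (\<bar>u x - u y\<bar> powr p) \<partial>lborel) = 0"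
  proof (rule ccontr)
    assume neg: "\<not> ?thesis"
    from ae have "AE x in lborel. x \<notin> base"
      by eventually_elim (use neg in \<open>auto split: split_indicator_asm\<close>)
    then have "base \<in> null_sets lborel" by (subst AE_iff_null_sets) auto
    then have "emeasure lborel base = 0" by auto
    then show False using cb(4) by (simp add: measure_def)
  qed
  then obtain z where z: "(\<integral>\<^sup>+y\<in>base. ennreal (\<bar>u z - u y\<bar> powr p) \<partial>lborel) = 0" by auto
  then have "AE y in lborel. ennreal (\<bar>u z - u y\<bar> powr p) * indicator base y = 0"
    by (subst (asm) nn_integral_0_iff_AE) auto
  then have "AE y in lborel. y \<in> base \<longrightarrow> u y = u z"
    by eventually_elim (use p in \<open>auto split: split_indicator_asm\<close>)
  then show thesis by (rule that)
qed

end

section \<open>Cubes and their dyadic cells\<close>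

lemma is_interval_squeeze:
  fixes J :: "real set"
  assumes J: "is_interval J" "emeasure lborel J = ennreal l" and l: "0 < l"
  shows "\<exists>a. {a<..<a+l} \<subseteq> J \<and> J \<subseteq> {a..a+l}"
proof -
  have J0: "emeasure lborel J \<noteq> 0" unfolding J(2) using l by (simp add: ennreal_eq_0_iff)
  then have Jb: "J \<in> sets lborel" by (rule emeasure_neq_0_sets)
  have len: "y - x \<le> l" if "x \<in> J" "y \<in> J" for x y
  proof (cases "x \<le> y")
    case True
    have "{x..y} \<subseteq> J" using mem_is_interval_1_I[OF J(1) that] by auto
    then have "emeasure lborel {x..y} \<le> emeasure lborel J" using Jb by (rule emeasure_mono)
    then show ?thesis using True J(2) l by (simp add: ennreal_le_iff)
  qed (use l in simp)
  have ne: "J \<noteq> {}" using J0 by auto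
  then obtain z where z: "z \<in> J" by auto
  have bdd: "bdd_below J" "bdd_above J"
    using len[OF z] len[OF _ z] by (auto intro!: bdd_belowI[of _ "z - l"] bdd_aboveI[of _ "z + l"] simp: algebra_simps)
  define a where "a = Inf J"
  define b where "b = Sup J"
  have out: "J \<subseteq> {a..b}" using bdd by (auto simp: a_def b_def intro: cInf_lower cSup_upper)
  have inn: "{a<..<b} \<subseteq> J"
  proof
    fix x assume x: "x \<in> {a<..<b}"
    obtain y where "y \<in> J" "y < x" using x cInf_less_iff[OF ne bdd(1), of x] by (auto simp: a_def)
    moreover obtain y' where "y' \<in> J" "x < y'" using x less_cSup_iff[OF ne bdd(2), of x] by (auto simp: b_def)
    ultimately show "x \<in> J" using x mem_is_interval_1_I[OF J(1), of y y' x] by simp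
  qed
  have ab: "a \<le> b" using z out by auto
  have "ennreal (b - a) \<le> ennreal l"
    using emeasure_mono[OF inn, of lborel] Jb ab J(2) by simp
  moreover have "ennreal l \<le> ennreal (b - a)"
    using emeasure_mono[OF out, of lborel] ab J(2) by simp
  ultimately have "b = a + l" using ab l by (simp add: ennreal_le_iff)
  then show ?thesis using inn out by blast
qed

lemma is_interval_of_squeeze:
  fixes J :: "real set"
  assumes "{a<..<a+l} \<subseteq> J" "J \<subseteq> {a..a+l}" "0 < l"
  shows "is_interval J" "J \<in> sets borel" "emeasure lborel J = ennreal l"
proof -
  show "is_interval J" unfolding is_interval_1
  proof (intro ballI allI impI)
    fix x y t assume xy: "x \<in> J" "y \<in> J" "x \<le> t \<and> t \<le> y"
    then have "a \<le> x" "y \<le> a + l" using assms(2) by auto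
    then consider "t = x" | "t = y" | "t \<in> {a<..<a+l}" using xy by force
    then show "t \<in> J" using xy assms(1) by cases auto
  qed
  have "J = {a<..<a+l} \<union> (J \<inter> {a, a+l})" using assms by force
  moreover have "J \<inter> {a, a+l} \<in> sets borel"
    by (intro borel_closed finite_imp_closed) simp
  ultimately show Jb: "J \<in> sets borel" by (metis borel_open open_greaterThanLessThan sets.Un)
  show "emeasure lborel J = ennreal l"
  proof (rule antisym)
    show "emeasure lborel J \<le> ennreal l" using emeasure_mono[OF assms(2), of lborel] assms(3) by simp
    show "ennreal l \<le> emeasure lborel J" using emeasure_mono[OF assms(1), of lborel] Jb assms(3) by simp
  qed
qed

definition open_cube :: "real ^ 'n::finite \<Rightarrow> real \<Rightarrow> (real ^ 'n) set" where
  "open_cube a l = {x. \<forall>i. a $ i < x $ i \<and> x $ i < a $ i + l}"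

definition closed_cube :: "real ^ 'n::finite \<Rightarrow> real \<Rightarrow> (real ^ 'n) set" where
  "closed_cube a l = {x. \<forall>i. a $ i \<le> x $ i \<and> x $ i \<le> a $ i + l}"

lemma open_cube_eq_box: "open_cube a l = box a (\<chi> i. a $ i + l)"
  by (auto simp: open_cube_def mem_box_cart)

lemma closed_cube_eq_cbox: "closed_cube a l = cbox a (\<chi> i. a $ i + l)"
  by (auto simp: closed_cube_def mem_box_cart)

lemma emeasure_cubes:
  fixes a :: "real ^ 'n::finite"
  assumes l: "0 < l"
  shows "emeasure lborel (open_cube a l) = ennreal (l ^ CARD('n))"
    and "emeasure lborel (closed_cube a l) = ennreal (l ^ CARD('n))"
proof -
  let ?b = "(\<chi> i. a $ i + l)"
  have diff: "(?b - a) \<bullet> b = l" if "b \<in> Basis" for b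
    using that by (auto simp: Basis_vec_def inner_axis)
  then have le: "a \<bullet> b \<le> ?b \<bullet> b" if "b \<in> Basis" for b
    using diff[OF that] l unfolding inner_diff_left by linarith
  have prod: "(\<Prod>b\<in>Basis. (?b - a) \<bullet> b) = l ^ CARD('n)" using diff by simp
  show "emeasure lborel (open_cube a l) = ennreal (l ^ CARD('n))"
    unfolding open_cube_eq_box by (subst emeasure_lborel_box[OF le]) (simp_all only: prod)
  show "emeasure lborel (closed_cube a l) = ennreal (l ^ CARD('n))"
    unfolding closed_cube_eq_cbox by (subst emeasure_lborel_cbox[OF le]) (simp_all only: prod)
qed

lemma cubeE:
  fixes Q :: "(real ^ 'n::finite) set"
  assumes "cube l Q"
  obtains a where "0 < l" "open_cube a l \<subseteq> Q" "Q \<subseteq> closed_cube a l" "Q \<in> sets borel" "convex Q"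
proof -
  have l: "0 < l" using assms by (simp add: cube_def)
  obtain J where "\<forall>i. is_interval (J i) \<and> emeasure lborel (J i) = ennreal l"
    and Q: "Q = {x. \<forall>i. x $ i \<in> J i}" using assms unfolding cube_def by (elim conjE exE)
  then have J: "is_interval (J i)" "emeasure lborel (J i) = ennreal l" for i by auto
  have "\<exists>a. {a<..<a+l} \<subseteq> J i \<and> J i \<subseteq> {a..a+l}" for i
    by (rule is_interval_squeeze[OF J l])
  then have "\<forall>i. \<exists>a. {a<..<a+l} \<subseteq> J i \<and> J i \<subseteq> {a..a+l}" by (rule allI)
  then have "\<exists>a. \<forall>i. {a i<..<a i + l} \<subseteq> J i \<and> J i \<subseteq> {a i..a i + l}" by (rule choice)
  then obtain a where "\<forall>i. {a i<..<a i + l} \<subseteq> J i \<and> J i \<subseteq> {a i..a i + l}" by (elim exE)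
  then have a: "{a i<..<a i + l} \<subseteq> J i" "J i \<subseteq> {a i..a i + l}" for i by auto
  have [measurable]: "J i \<in> sets borel" for i using is_interval_of_squeeze(2)[OF a l] .
  have [measurable]: "(\<lambda>x::real^'n. x $ i) \<in> borel_measurable borel" for i
    by (intro borel_measurable_continuous_onI continuous_intros)
  have 1: "Q \<in> sets borel" unfolding Q by measurable
  have 2: "convex Q" unfolding Q
  proof (rule convexI)
    fix x y :: "real^'n" and s t :: real
    assume *: "x \<in> {x. \<forall>i. x $ i \<in> J i}" "y \<in> {x. \<forall>i. x $ i \<in> J i}" "0 \<le> s" "0 \<le> t" "s + t = 1"
    have "s * x $ i + t * y $ i \<in> J i" for i
      using is_interval_convex[OF J(1), of i] * by (auto dest: convexD)
    then show "s *\<^sub>R x + t *\<^sub>R y \<in> {x. \<forall>i. x $ i \<in> J i}" by simp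
  qed
  have 3: "open_cube (\<chi> i. a i) l \<subseteq> Q"
  proof
    fix x assume "x \<in> open_cube (\<chi> i. a i) l"
    then have "x $ i \<in> {a i<..<a i + l}" for i by (simp add: open_cube_def)
    then show "x \<in> Q" using a(1) unfolding Q by blast
  qed
  have 4: "Q \<subseteq> closed_cube (\<chi> i. a i) l"
  proof
    fix x assume "x \<in> Q"
    then have "x $ i \<in> {a i..a i + l}" for i using a(2) unfolding Q by blast
    then show "x \<in> closed_cube (\<chi> i. a i) l" by (simp add: closed_cube_def)
  qed
  show thesis by (rule that[OF l 3 4 1 2])
qed

lemma cube_emeasure:
  fixes Q :: "(real ^ 'n::finite) set"
  assumes "cube l Q"
  shows "emeasure lborel Q = ennreal (l ^ CARD('n))"
proof -
  obtain a where a: "0 < l" "open_cube a l \<subseteq> Q" "Q \<subseteq> closed_cube a l" "Q \<in> sets borel" "convex Q"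
    using cubeE[OF assms] .
  have cc: "closed_cube a l \<in> sets borel" by (simp add: closed_cube_eq_cbox)
  have "emeasure lborel Q \<le> emeasure lborel (closed_cube a l)"
    by (rule emeasure_mono[OF a(3)]) (simp add: cc)
  moreover have "emeasure lborel (open_cube a l) \<le> emeasure lborel Q"
    by (rule emeasure_mono[OF a(2)]) (simp add: a(4))
  ultimately show ?thesis unfolding emeasure_cubes[OF a(1)] by (rule antisym)
qed

lemma cube_diameter:
  fixes Q :: "(real ^ 'n::finite) set"
  assumes "cube l Q" "x \<in> Q" "y \<in> Q"
  shows "norm (x - y) \<le> real CARD('n) * l"
proof -
  obtain a where a: "0 < l" "open_cube a l \<subseteq> Q" "Q \<subseteq> closed_cube a l" by (rule cubeE[OF assms(1)])
  have "norm (x - y) \<le> (\<Sum>i\<in>UNIV. \<bar>(x - y) $ i\<bar>)" by (rule norm_le_l1_cart)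
  also have "\<dots> \<le> (\<Sum>i\<in>(UNIV::'n set). l)"
  proof (rule sum_mono)
    fix i
    have "a $ i \<le> x $ i" "x $ i \<le> a $ i + l" "a $ i \<le> y $ i" "y $ i \<le> a $ i + l"
      using assms(2,3) a(3) by (auto simp: closed_cube_def)
    then show "\<bar>(x - y) $ i\<bar> \<le> l" by simp
  qed
  finally show ?thesis by simp
qed

text \<open>
  Working in the open cube keeps the cells inside every cube with the same closure, whichever of its faces
  it contains.  The cells touching a lower face of the cube lack that face; the others are half-open.
\<close>

definition dyadic_cell :: "real ^ 'n::finite \<Rightarrow> real \<Rightarrow> nat \<Rightarrow> real ^ 'n \<Rightarrow> (real ^ 'n) set" where
  "dyadic_cell a l k x =
     {y \<in> open_cube a l. \<forall>i. \<lfloor>2^k * ((y $ i - a $ i) / l)\<rfloor> = \<lfloor>2^k * ((x $ i - a $ i) / l)\<rfloor>}"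

lemma dyadic_cell_cube:
  assumes l: "0 < l" and x: "x \<in> open_cube a l"
  shows "cube (l / 2^k) (dyadic_cell a l k x)"
proof -
  define J where "J i = {t. a $ i < t \<and> t < a $ i + l \<and> 
     \<lfloor>2^k * ((t - a $ i) / l)\<rfloor> = \<lfloor>2^k * ((x $ i - a $ i) / l)\<rfloor>}" for i
  have h: "0 < l / 2^k" using l by simp
  have sq: "\<exists>b. {b<..<b + l / 2^k} \<subseteq> J i \<and> J i \<subseteq> {b..b + l / 2^k}" for i
  proof -
    define m where "m = \<lfloor>2^k * ((x $ i - a $ i) / l)\<rfloor>"
    have xi: "a $ i < x $ i" "x $ i < a $ i + l" using x by (auto simp: open_cube_def)
    have m0: "0 \<le> m" using xi l by (simp add: m_def)
    have "2^k * ((x $ i - a $ i) / l) < 2^k * 1"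
      using xi l by (intro mult_strict_left_mono) (auto simp: field_simps)
    then have "real_of_int m < 2^k" unfolding m_def by linarith
    then have "real_of_int m < real_of_int (2^k)" by simp
    then have "m < 2^k" by (simp only: of_int_less_iff)
    then have "m + 1 \<le> 2^k" by simp
    then have "real_of_int (m + 1) \<le> real_of_int (2^k)" by (simp only: of_int_le_iff)
    then have m1: "real_of_int m + 1 \<le> 2^k" by simp
    let ?b = "a $ i + real_of_int m * (l / 2^k)"
    have fl: "\<lfloor>2^k * ((t - a $ i) / l)\<rfloor> = m \<longleftrightarrow> ?b \<le> t \<and> t < ?b + l / 2^k" for t
    proof -
      have "\<lfloor>2^k * ((t - a $ i) / l)\<rfloor> = m \<longleftrightarrow> m \<le> 2^k * ((t - a $ i) / l) \<and> 2^k * ((t - a $ i) / l) < m + 1"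
        by (auto simp: floor_eq_iff)
      also have "m \<le> 2^k * ((t - a $ i) / l) \<longleftrightarrow> ?b \<le> t"
        using l by (simp add: field_simps)
      also have "2^k * ((t - a $ i) / l) < m + 1 \<longleftrightarrow> t < ?b + l / 2^k"
        using l by (simp add: field_simps)
      finally show ?thesis .
    qed
    have bounds: "a $ i \<le> ?b" "?b + l / 2^k \<le> a $ i + l"
    proof -
      show "a $ i \<le> ?b" using m0 l by simp
      have "(real_of_int m + 1) * (l / 2^k) \<le> 2^k * (l / 2^k)" using m1 l by (intro mult_right_mono) auto
      then show "?b + l / 2^k \<le> a $ i + l" by (simp add: add_divide_distrib distrib_right)
    qed
    define b h where "b = ?b" and "h = l / 2^k"
    have J: "J i = {t. a $ i < t \<and> t < a $ i + l \<and> b \<le> t \<and> t < b + h}"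
      unfolding J_def m_def[symmetric] fl b_def h_def ..
    have bh: "a $ i \<le> b" "b + h \<le> a $ i + l" using bounds unfolding b_def h_def by simp_all
    have "t \<in> J i" if "b < t" "t < b + h" for t
      unfolding J mem_Collect_eq using that bh by (intro conjI; linarith)
    moreover have "b \<le> t \<and> t \<le> b + h" if "t \<in> J i" for t
      using that unfolding J mem_Collect_eq by (intro conjI; linarith)
    ultimately have "{b<..<b + h} \<subseteq> J i \<and> J i \<subseteq> {b..b + h}"
      unfolding subset_iff greaterThanLessThan_iff atLeastAtMost_iff by blast
    then show ?thesis unfolding h_def by (rule exI)
  qed
  have "is_interval (J i) \<and> emeasure lborel (J i) = ennreal (l / 2^k)" for i
  proof -
    obtain b where b: "{b<..<b + l / 2^k} \<subseteq> J i" "J i \<subseteq> {b..b + l / 2^k}" using sq[of i] by (elim exE conjE)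
    show ?thesis using is_interval_of_squeeze(1,3)[OF b h] by (intro conjI)
  qed
  moreover have "dyadic_cell a l k x = {y. \<forall>i. y $ i \<in> J i}"
    by (auto simp: dyadic_cell_def J_def open_cube_def)
  ultimately show ?thesis using h unfolding cube_def by blast
qed

lemma floor_double_eq:
  fixes s t :: real
  assumes "\<lfloor>2 * s\<rfloor> = \<lfloor>2 * t\<rfloor>" shows "\<lfloor>s\<rfloor> = \<lfloor>t\<rfloor>"
proof -
  have "\<lfloor>s\<rfloor> = \<lfloor>2 * s\<rfloor> div 2" for s :: real
    using floor_divide_real_eq_div[of 2 "2 * s"] by simp
  then show ?thesis using assms by metis
qed

lemma dyadic_round_cell_tree:
  fixes a :: "real ^ 'n::finite"
  assumes l: "0 < l"
  shows "round_cell_tree (open_cube a l) (dyadic_cell a l) (2 ^ CARD('n)) (real CARD('n))"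
proof -
  let ?B = "open_cube a l" and ?c = "dyadic_cell a l"
  let ?n = "CARD('n)"
  note cb = dyadic_cell_cube[OF l]
  have meas: "emeasure lborel (?c k x) = ennreal ((l / 2^k) ^ ?n)" if "x \<in> ?B" for x k
    using cube_emeasure[OF cb[OF that]] .
  have meas': "measure lborel (?c k x) = (l / 2^k) ^ ?n" if "x \<in> ?B" for x k
    using meas[OF that, of k] l by (simp add: measure_def)
  show ?thesis
  proof (unfold_locales)
    have "(\<chi> i. a $ i + l / 2) \<in> ?B" using l by (simp add: open_cube_def)
    then show "?B \<noteq> {}" by auto
    show "?c 0 x = ?B" if "x \<in> ?B" for x
    proof -
      have "\<lfloor>(y $ i - a $ i) / l\<rfloor> = 0" if "y \<in> ?B" for y i
      proof -
        have "a $ i < y $ i" "y $ i < a $ i + l" using that by (auto simp: open_cube_def)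
        then have "0 \<le> (y $ i - a $ i) / l" "(y $ i - a $ i) / l < 1" using l by auto
        then show ?thesis by (simp add: floor_eq_iff)
      qed
      then show ?thesis using that by (auto simp: dyadic_cell_def)
    qed
    show "x \<in> ?c k x" if "x \<in> ?B" for x k using that by (simp add: dyadic_cell_def)
    show "?c (Suc k) x \<subseteq> ?c k x" if "x \<in> ?B" for x k
    proof
      fix y assume y: "y \<in> ?c (Suc k) x"
      have "\<lfloor>2^k * ((y $ i - a $ i) / l)\<rfloor> = \<lfloor>2^k * ((x $ i - a $ i) / l)\<rfloor>" for i
      proof (rule floor_double_eq)
        have "2 ^ Suc k * t = 2 * (2^k * t)" for t :: real by simp
        then show "\<lfloor>2 * (2^k * ((y $ i - a $ i) / l))\<rfloor> = \<lfloor>2 * (2^k * ((x $ i - a $ i) / l))\<rfloor>"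
          using y unfolding dyadic_cell_def mem_Collect_eq by metis
      qed
      then show "y \<in> ?c k x" using y unfolding dyadic_cell_def mem_Collect_eq by blast
    qed
    show "?c k y = ?c k x" if "x \<in> ?B" "y \<in> ?c k x" for x y k
      using that unfolding dyadic_cell_def mem_Collect_eq by auto
    show "countable {?c k x |k x. x \<in> ?B}"
    proof (rule countable_subset)
      let ?f = "\<lambda>(k, m :: 'n \<Rightarrow> int). {y \<in> ?B. \<forall>i. \<lfloor>2^k * ((y $ i - a $ i) / l)\<rfloor> = m i}"
      show "{?c k x |k x. x \<in> ?B} \<subseteq> range ?f"
      proof
        fix S assume "S \<in> {?c k x |k x. x \<in> ?B}"
        then obtain k x where "S = ?c k x" by auto
        then have "S = ?f (k, \<lambda>i. \<lfloor>2^k * ((x $ i - a $ i) / l)\<rfloor>)" by (simp add: dyadic_cell_def)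
        then show "S \<in> range ?f" by blast
      qed
      show "countable (range ?f)" by (rule countable_image) simp
    qed
    show "?c k x \<in> sets borel" if "x \<in> ?B" for x k by (rule cubeE[OF cb[OF that]])
    show "emeasure lborel ?B < top" using emeasure_cubes[OF l, of a] by simp
    show "0 < measure lborel (?c k x)" if "x \<in> ?B" for x k using meas'[OF that] l by simp
    show "measure lborel (?c k x) = 2 ^ ?n * measure lborel (?c (Suc k) x)" if "x \<in> ?B" for x k
      unfolding meas'[OF that] power_mult_distrib[symmetric] by simp
    show "(1::real) < 2 ^ ?n" by (rule one_less_power) auto
    show "\<exists>k. ?c k x \<subseteq> U" if x: "x \<in> ?B" and U: "open U" "x \<in> U" for x U
    proof -
      obtain e where e: "0 < e" "ball x e \<subseteq> U" using U open_contains_ball by blast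
      obtain k where k: "real ?n * l / e < 2 ^ k" using real_arch_pow[of 2] by auto
      have "?c k x \<subseteq> U"
      proof
        fix y assume y: "y \<in> ?c k x"
        have "norm (x - y) \<le> real ?n * (l / 2^k)"
          using cube_diameter[OF cb[OF x]] y x by (simp add: dyadic_cell_def)
        also have "\<dots> < e" using k e by (simp add: field_simps)
        finally show "y \<in> U" using e by (auto simp: dist_norm)
      qed
      then show ?thesis by blast
    qed
    show "convex (?c k x)" if "x \<in> ?B" for x k by (rule cubeE[OF cb[OF that]])
    show "norm (y - z) \<le> real ?n * measure lborel (?c k x) powr (1 / real DIM(real ^ 'n))"
      if "x \<in> ?B" "y \<in> ?c k x" "z \<in> ?c k x" for x y z k
    proof -
      have "((l / 2^k) ^ ?n) powr (1 / real ?n) = l / 2^k"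
        using l by (simp add: powr_realpow[symmetric] powr_powr)
      then show ?thesis using cube_diameter[OF cb[OF that(1)] that(2,3)] meas'[OF that(1)] by simp
    qed
    show "1 \<le> real ?n" by simp
  qed
qed


section \<open>The inequality on cubes\<close>

lemma locally_integrable_borel_measurable:
  fixes f :: "real ^ 'n::finite \<Rightarrow> real"
  assumes "locally_integrable f"
  shows "f \<in> borel_measurable lebesgue"
proof (rule borel_measurable_LIMSEQ_real)
  show "(\<lambda>x. indicator (cball 0 (real k)) x *\<^sub>R f x) \<in> borel_measurable lebesgue" for k
    using assms compact_cball[of 0 "real k"]
    unfolding locally_integrable_def set_integrable_def by (blast dest: borel_measurable_integrable)
  show "(\<lambda>k. indicator (cball 0 (real k)) x *\<^sub>R f x) \<longlonglongrightarrow> f x" for x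
  proof (rule tendsto_eventually)
    obtain K where K: "norm x < real K" using reals_Archimedean2 by blast
    show "\<forall>\<^sub>F k in sequentially. indicator (cball 0 (real k)) x *\<^sub>R f x = f x"
      using eventually_ge_at_top[of K] by eventually_elim (use K in simp)
  qed
qed

lemma epowr_mono:
  assumes "x \<le> y" "0 < a"
  shows "epowr x a \<le> epowr y a"
proof (cases "y = top")
  case False
  then have "x \<noteq> top" using assms(1) by (auto simp: top_unique)
  then show ?thesis
    using False assms unfolding epowr_def
    by (auto intro!: ennreal_leI powr_mono2 enn2real_mono simp: less_top)
qed (simp add: epowr_def)

lemma epowr_cmult:
  assumes k: "0 \<le> k" and a: "0 < a" and x: "x \<noteq> top"
  shows "epowr (ennreal k * x) a = ennreal (k powr a) * epowr x a"
  using x k by (simp add: epowr_def ennreal_mult_eq_top_iff enn2real_mult powr_mult ennreal_mult')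

lemma epowr_eq_0_iff: "0 < a \<Longrightarrow> epowr x a = 0 \<longleftrightarrow> x = 0"
  by (auto simp: epowr_def enn2real_eq_0_iff)

text \<open>
  The numerical factors are those of \<open>poincare_const_bound\<close>, each raised to the power $p$ there: $24$
  and $6$ absorb the factors $24$ and $2p$, and $2^n+2$ is \<open>\<theta> + 2\<close> for dyadic cells.
\<close>

definition poincare_const :: "real \<Rightarrow> real" where
  "poincare_const n = 24 * 16 * 9 * (2 powr n + 2) * 2 * 6 * n powr (n + 1)"

lemma two_mult_le_6_powr:
  fixes p :: real assumes "1 \<le> p" shows "2 * p \<le> 6 powr p"
proof -
  have "p \<le> exp p" using exp_ge_add_one_self[of p] by linarith
  then have "p \<le> exp 1 powr p" by (simp add: powr_def)
  also have "\<dots> \<le> 3 powr p" using assms exp_le by (intro powr_mono2) auto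
  finally have "p \<le> 3 powr p" .
  moreover have "2 powr 1 \<le> 2 powr p" using assms by (intro powr_mono) auto
  ultimately have "2 * p \<le> 2 powr p * 3 powr p" using assms by (intro mult_mono) auto
  also have "\<dots> = 6 powr p" by (simp flip: powr_mult)
  finally show ?thesis .
qed

lemma (in round_cell_tree) poincare_const_bound:
  assumes p: "1 \<le> p" and \<delta>: "\<delta> < 1" and W: "1 \<le> W"
    and n: "real DIM('a) = n" "\<theta> = 2 powr n" "\<Delta> = n"
  shows "2 * (16 powr p * weak_const p \<delta> W) \<le> (poincare_const n * p * W) powr p * (1 - \<delta>)"
proof -
  have n1: "1 \<le> n" using \<Delta>_ge_1 n(3) by simp
  have th: "0 < 2 powr n + 2" by (intro add_pos_pos) auto
  have "n + p \<le> n * p + p" using n1 p by (simp add: mult_le_cancel_left1)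
  then have "n powr (n + p) \<le> n powr ((n + 1) * p)"
    using n1 by (intro powr_mono) (auto simp: algebra_simps)
  also have "\<dots> = (n powr (n + 1)) powr p" by (simp add: powr_powr)
  finally have npow: "n powr (n + p) \<le> (n powr (n + 1)) powr p" .
  have p24: "24 \<le> 24 powr p" using powr_mono[of 1 p 24] p by simp
  have "2 * (16 powr p * weak_const p \<delta> W)
    = 24 * (16 powr p * ((9 * p * W * (2 powr n + 2)) powr p * (2 powr p * ((2 * p) * n powr (n + p))))) * (1 - \<delta>)"
    unfolding weak_const_def \<kappa>_def unfolding n by simp
  also have "\<dots> \<le> 24 powr p * (16 powr p * ((9 * p * W * (2 powr n + 2)) powr p * (2 powr p * (6 powr p * (n powr (n + 1)) powr p)))) * (1 - \<delta>)"
    using p24 npow two_mult_le_6_powr[OF p] p W \<delta> n1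
    by (intro mult_right_mono mult_mono) (auto intro!: mult_nonneg_nonneg)
  also have "24 powr p * (16 powr p * ((9 * p * W * (2 powr n + 2)) powr p * (2 powr p * (6 powr p * (n powr (n + 1)) powr p))))
    = (24 * (16 * ((9 * p * W * (2 powr n + 2)) * (2 * (6 * n powr (n + 1)))))) powr p"
    using p W n1 th by (simp only: powr_mult[symmetric])
  also have "24 * (16 * ((9 * p * W * (2 powr n + 2)) * (2 * (6 * n powr (n + 1))))) = poincare_const n * p * W"
    by (simp add: poincare_const_def)
  finally show ?thesis .
qed

lemma open_cube_AE_closed_cube:
  fixes a :: "real ^ 'n::finite"
  assumes l: "0 < l"
  shows "AE x in lborel. x \<in> closed_cube a l \<longrightarrow> x \<in> open_cube a l"
proof -
  have b: "open_cube a l \<in> sets borel" "closed_cube a l \<in> sets borel"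
    by (simp_all add: open_cube_eq_box closed_cube_eq_cbox)
  have sub: "open_cube a l \<subseteq> closed_cube a l"
    by (auto simp: open_cube_def closed_cube_def intro: less_imp_le)
  have "emeasure lborel (closed_cube a l - open_cube a l)
      = emeasure lborel (closed_cube a l) - emeasure lborel (open_cube a l)"
    using b sub emeasure_cubes[OF l, of a] by (intro emeasure_Diff) auto
  then have "closed_cube a l - open_cube a l \<in> null_sets lborel"
    using b by (intro null_setsI) (auto simp: emeasure_cubes[OF l])
  then have "AE x in lborel. x \<notin> closed_cube a l - open_cube a l" by (rule AE_not_in)
  then show ?thesis by eventually_elim blast
qed

text \<open>
  Passage from cells to cubes.  After $u$ and $w$ have been replaced by Borel functions, the dyadic cells are
  cubes contained in $Q$, so the dyadic maximal functions lie below the given ones: the hypothesis on the weight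
  holds with $W = [w]_{A_\infty}$ (at least $1$ because the maximal function of $w\chi_Q$ is at least the
  average of $w$), and the energy is at most the double integral on the right-hand side.
\<close>

theorem weighted_fractional_poincare:
  fixes u w :: "real ^ 'n::finite \<Rightarrow> real" and Q :: "(real ^ 'n) set"
  assumes \<delta>: "0 < \<delta>" "\<delta> < 1" and p: "1 \<le> p" and w: "weight w"
    and u: "u \<in> borel_measurable lebesgue" and Q: "cube l Q"
  shows "(INF a::real. epowr (\<integral>\<^sup>+x\<in>Q. ennreal (\<bar>u x - a\<bar> powr p * w x) \<partial>lebesgue) (1 / p))
    \<le> ennreal (poincare_const (real CARD('n)) * p * (1 - \<delta>) powr (1 / p)) * A_infinity_const w *
       epowr (\<integral>\<^sup>+x\<in>Q.
           (\<integral>\<^sup>+y\<in>Q. ennreal (\<bar>u x - u y\<bar> powr p / norm (x - y) powr (real CARD('n) + \<delta> * p)) \<partial>lebesgue)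
             * local_fractional_maximal (\<delta> * p) Q w x \<partial>lebesgue) (1 / p)"
    (is "?L \<le> ennreal ?K * ?A * epowr ?I (1 / p)")
proof -
  obtain a where l: "0 < l" and Qa: "open_cube a l \<subseteq> Q" "Q \<subseteq> closed_cube a l" 
    and "Q \<in> sets borel" "convex Q"
    by (rule cubeE[OF Q])
  let ?B = "open_cube a l" and ?n = "real CARD('n)"
  interpret T: round_cell_tree ?B "dyadic_cell a l" "2 ^ CARD('n)" "real CARD('n)"
    by (rule dyadic_round_cell_tree[OF l])
  obtain u' where u' [measurable]: "u' \<in> borel_measurable borel" and uu': "AE x in lborel. u x = u' x"
    using completion_ex_borel_measurable_real[OF u] by auto
  have wm: "w \<in> borel_measurable lebesgue" "AE x in lebesgue. 0 < w x" "locally_integrable w"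
    using w locally_integrable_borel_measurable by (auto simp: weight_def)
  obtain w' where w' [measurable]: "w' \<in> borel_measurable borel" and ww': "AE x in lborel. w x = w' x"
    using completion_ex_borel_measurable_real[OF wm(1)] by auto
  have wpos: "AE x in lborel. 0 < w x" using wm(2) by (simp add: AE_completion_iff)
  define v where "v x = ennreal (w' x)" for x
  have v [measurable]: "v \<in> borel_measurable borel" unfolding v_def by measurable
  have vw: "AE x in lborel. v x = ennreal (w x) \<and> 0 < w x"
    using ww' wpos by eventually_elim (simp add: v_def)

  have cells: "\<exists>k. cube (l / 2^k) S" if "S \<in> T.cells" for S
    using that dyadic_cell_cube[OF l] by (auto simp: T.cells_def)
  have wint: "weight_measure w S = (\<integral>\<^sup>+x\<in>S. v x \<partial>lborel)" for S
    unfolding weight_measure_def nn_integral_completion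
  proof (rule nn_integral_cong_AE)
    show "AE x in lborel. ennreal (w x) * indicator S x = v x * indicator S x"
      using vw by eventually_elim simp
  qed
  have avg: "average S (\<lambda>x. ennreal \<bar>g x\<bar>) = T.cell_average v S"
    if S: "S \<in> T.cells" and g: "\<And>x. x \<in> S \<Longrightarrow> g x = w x" for S g
  proof -
    have "emeasure lebesgue S = emeasure lborel S" using T.cellsD(1)[OF S] by simp
    moreover have "(\<integral>\<^sup>+x\<in>S. ennreal \<bar>g x\<bar> \<partial>lborel) = (\<integral>\<^sup>+x\<in>S. v x \<partial>lborel)"
    proof (rule nn_integral_cong_AE)
      show "AE x in lborel. ennreal \<bar>g x\<bar> * indicator S x = v x * indicator S x"
        using vw by eventually_elim (auto simp: g split: split_indicator)
    qed
    ultimately show ?thesis by (simp only: average_def T.cell_average_def nn_integral_completion)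
  qed
  have vfin: "(\<integral>\<^sup>+x\<in>S. v x \<partial>lborel) < top" if "S \<subseteq> closed_cube a l" for S
  proof -
    have "compact (closed_cube a l)" by (simp add: closed_cube_eq_cbox)
    then have "set_integrable lebesgue (closed_cube a l) w" using wm(3) by (auto simp: locally_integrable_def)
    then have "(\<integral>\<^sup>+x. ennreal (norm (indicator (closed_cube a l) x *\<^sub>R w x)) \<partial>lborel) < top"
      unfolding set_integrable_def integrable_iff_bounded nn_integral_completion by simp
    moreover have "(\<integral>\<^sup>+x\<in>S. v x \<partial>lborel) \<le> (\<integral>\<^sup>+x. ennreal (norm (indicator (closed_cube a l) x *\<^sub>R w x)) \<partial>lborel)"
    proof (rule nn_integral_mono_AE)
      show "AE x in lborel. v x * indicator S x \<le> ennreal (norm (indicator (closed_cube a l) x *\<^sub>R w x))"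
        using vw by eventually_elim (use that in \<open>auto split: split_indicator\<close>)
    qed
    ultimately show ?thesis by (rule le_less_trans[rotated])
  qed
  have vpos: "(\<integral>\<^sup>+x\<in>S. v x \<partial>lborel) \<noteq> 0" if S: "S \<in> T.cells" for S
  proof
    note [measurable] = T.cellsD(1)[OF S]
    assume "(\<integral>\<^sup>+x\<in>S. v x \<partial>lborel) = 0"
    then have "AE x in lborel. v x * indicator S x = 0" by (subst (asm) nn_integral_0_iff_AE) auto
    then have "AE x in lborel. x \<notin> S"
      using vw by eventually_elim (auto split: split_indicator_asm simp: ennreal_eq_0_iff)
    then have "S \<in> null_sets lborel" by (subst AE_iff_null_sets) auto
    then have "emeasure lborel S = 0" by auto
    then show False using T.cellsD(4)[OF S] by (simp add: measure_def)
  qed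
  have sub: "S \<subseteq> ?B" if "S \<in> T.cells" for S using T.cellsD(2)[OF that] .

  have fujii_wilson: "(\<integral>\<^sup>+x\<in>P. T.cell_maximal v P x \<partial>lborel) \<le> ?A * (\<integral>\<^sup>+x\<in>P. v x \<partial>lborel)"
    if P: "P \<in> T.cells" for P
  proof -
    have "(\<integral>\<^sup>+x\<in>P. T.cell_maximal v P x \<partial>lborel) \<le> (\<integral>\<^sup>+x\<in>P. maximal (\<lambda>y. w y * indicator P y) x \<partial>lborel)"
    proof (intro nn_integral_mono mult_right_mono)
      fix x
      show "T.cell_maximal v P x \<le> maximal (\<lambda>y. w y * indicator P y) x"
        unfolding T.cell_maximal_def
      proof (rule SUP_least)
        fix S assume S: "S \<in> {S \<in> T.cells. S \<subseteq> P}"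
        show "T.cell_average v S * indicator S x \<le> maximal (\<lambda>y. w y * indicator P y) x"
        proof (cases "x \<in> S")
          case True
          have "T.cell_average v S = average S (\<lambda>y. ennreal \<bar>w y * indicator P y\<bar>)"
            using S by (intro avg[symmetric]) (auto split: split_indicator)
          also have "\<dots> \<le> maximal (\<lambda>y. w y * indicator P y) x"
            unfolding maximal_def using S True cells[of S] by (intro SUP_upper) (auto simp: cubes_def)
          finally show ?thesis using True by simp
        qed simp
      qed
    qed simp
    also have "\<dots> = (\<integral>\<^sup>+x\<in>P. maximal (\<lambda>y. w y * indicator P y) x \<partial>lborel) / weight_measure w P * weight_measure w P"
    proof -
      have "weight_measure w P \<noteq> 0" "weight_measure w P \<noteq> top"
        using vpos[OF P] vfin[of P] order_trans[OF sub[OF P] order_trans[OF Qa]] by (simp_all add: wint less_top)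
      then show ?thesis by (simp add: ennreal_divide_times less_top)
    qed
    also have "\<dots> \<le> ?A * weight_measure w P"
      unfolding A_infinity_const_def nn_integral_completion using cells[OF P]
      by (intro mult_right_mono SUP_upper) (auto simp: cubes_def)
    finally show ?thesis by (simp only: wint)
  qed
  have A1: "1 \<le> ?A"
  proof -
    let ?V = "\<integral>\<^sup>+x\<in>?B. v x \<partial>lborel"
    have "?V * 1 = T.cell_average v ?B * emeasure lborel ?B"
      by (simp add: T.cell_average_mult[OF T.base_in_cells])
    also have "\<dots> = (\<integral>\<^sup>+x\<in>?B. T.cell_average v ?B \<partial>lborel)"
      by (simp add: nn_integral_cmult_indicator)
    also have "\<dots> \<le> (\<integral>\<^sup>+x\<in>?B. T.cell_maximal v ?B x \<partial>lborel)"
      using T.cell_maximal_ge[OF T.base_in_cells order_refl, of _ v]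
      by (intro nn_integral_mono) (auto split: split_indicator)
    also have "\<dots> \<le> ?A * ?V" by (rule fujii_wilson[OF T.base_in_cells])
    finally have "?V * 1 \<le> ?V * ?A" by (simp add: mult.commute)
    moreover have "?V \<noteq> 0" "?V < top" using vpos[OF T.base_in_cells] vfin[of ?B] Qa by auto
    ultimately show ?thesis by (subst (asm) ennreal_mult_le_mult_iff) auto
  qed

  have E: "T.energy p \<delta> v u' \<le> ?I"
    unfolding T.energy_def nn_integral_completion
  proof (rule nn_integral_mono_AE)
    show "AE x in lborel. gagliardo p \<delta> ?B u' x * T.fractional_cell_maximal (\<delta> * p) v x * indicator ?B x
      \<le> (\<integral>\<^sup>+y\<in>Q. ennreal (\<bar>u x - u y\<bar> powr p / norm (x - y) powr (?n + \<delta> * p)) \<partial>lborel)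
             * local_fractional_maximal (\<delta> * p) Q w x * indicator Q x"
      using uu'
    proof eventually_elim
      fix x assume x: "u x = u' x"
      have g: "gagliardo p \<delta> ?B u' x \<le> (\<integral>\<^sup>+y\<in>Q. ennreal (\<bar>u x - u y\<bar> powr p / norm (x - y) powr (?n + \<delta> * p)) \<partial>lborel)"
        unfolding gagliardo_def using uu' Qa x
        by (intro nn_integral_mono_AE) (auto elim!: eventually_mono split: split_indicator)
      have m: "T.fractional_cell_maximal (\<delta> * p) v x \<le> local_fractional_maximal (\<delta> * p) Q w x"
        unfolding T.fractional_cell_maximal_def
      proof (rule SUP_least)
        fix S assume S: "S \<in> T.cells"
        obtain k where k: "cube (l / 2^k) S" using cells[OF S] by auto
        have "measure lborel S = (l / 2^k) ^ CARD('n)"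
          unfolding measure_def cube_emeasure[OF k] using l by simp
        then have side: "measure lborel S powr (\<delta> * p / real DIM(real ^ 'n)) = (l / 2^k) powr (\<delta> * p)"
          using l by (simp add: powr_realpow[symmetric] powr_powr)
        show "ennreal (measure lborel S powr (\<delta> * p / real DIM(real ^ 'n))) * T.cell_average v S * indicator S x
          \<le> local_fractional_maximal (\<delta> * p) Q w x"
        proof (cases "x \<in> S")
          case True
          have "ennreal ((l / 2^k) powr (\<delta> * p)) * average S (\<lambda>y. ennreal \<bar>w y\<bar>) \<le> local_fractional_maximal (\<delta> * p) Q w x"
            unfolding local_fractional_maximal_def using k True sub[OF S] Qa
            by (intro Sup_upper) blast
          then show ?thesis unfolding side using avg[OF S, of w] True by simp
        qed simp
      qed
      show "gagliardo p \<delta> ?B u' x * T.fractional_cell_maximal (\<delta> * p) v x * indicator ?B x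
      \<le> (\<integral>\<^sup>+y\<in>Q. ennreal (\<bar>u x - u y\<bar> powr p / norm (x - y) powr (?n + \<delta> * p)) \<partial>lborel)
             * local_fractional_maximal (\<delta> * p) Q w x * indicator Q x"
        using Qa by (intro mult_mono[OF mult_mono[OF g m]]) (auto split: split_indicator)
    qed
  qed

  have onB: "AE x in lborel. x \<in> Q \<longleftrightarrow> x \<in> ?B"
    using open_cube_AE_closed_cube[OF l, of a] by eventually_elim (use Qa in blast)
  have lhs: "(\<integral>\<^sup>+x\<in>Q. ennreal (\<bar>u x - c\<bar> powr p * w x) \<partial>lebesgue)
      = (\<integral>\<^sup>+x\<in>?B. ennreal (\<bar>u' x - c\<bar> powr p) * v x \<partial>lborel)" for c
    unfolding nn_integral_completion
  proof (rule nn_integral_cong_AE)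
    show "AE x in lborel. ennreal (\<bar>u x - c\<bar> powr p * w x) * indicator Q x
        = ennreal (\<bar>u' x - c\<bar> powr p) * v x * indicator ?B x"
      using onB uu' vw by eventually_elim (simp add: ennreal_mult' indicator_def)
  qed

  have p': "0 < 1 / p" using p by simp
  have K: "0 < ?K"
    using p \<delta> by (simp add: poincare_const_def add_pos_pos)
  show ?thesis
  proof (cases "?I = 0")
    case True
    then have "T.energy p \<delta> v u' = 0" using E by simp
    then obtain c where c: "AE x in lborel. x \<in> ?B \<longrightarrow> u' x = c"
      using T.zero_energy_imp_constant[OF u' v vpos[OF T.base_in_cells] p \<delta>] by blast
    have "(\<integral>\<^sup>+x\<in>?B. ennreal (\<bar>u' x - c\<bar> powr p) * v x \<partial>lborel) = (\<integral>\<^sup>+x. 0 \<partial>(lborel :: (real ^ 'n) measure))"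
    proof (rule nn_integral_cong_AE)
      show "AE x in lborel. ennreal (\<bar>u' x - c\<bar> powr p) * v x * indicator ?B x = 0"
        using c by eventually_elim (auto split: split_indicator)
    qed
    then have "epowr (\<integral>\<^sup>+x\<in>Q. ennreal (\<bar>u x - c\<bar> powr p * w x) \<partial>lebesgue) (1 / p)
        \<le> ennreal ?K * ?A * epowr ?I (1 / p)"
      unfolding lhs using iffD2[OF epowr_eq_0_iff[OF p', of 0]] by simp
    then show ?thesis by (rule INF_lower2[OF UNIV_I])
  next
    case I0: False
    show ?thesis
    proof (cases "?A = top \<or> ?I = top")
      case True
      have "epowr ?I (1 / p) \<noteq> 0" using I0 epowr_eq_0_iff[OF p'] by simp
      moreover have "?A \<noteq> 0" using A1 by auto
      moreover have "?I = top \<Longrightarrow> epowr ?I (1 / p) = top" by (simp add: epowr_def)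
      ultimately have "ennreal ?K * ?A * epowr ?I (1 / p) = top"
        using True K by (auto simp: ennreal_mult_eq_top_iff)
      then show ?thesis by (simp only: top_greatest)
    next
      case False
      then have fin: "?A \<noteq> top" "?I \<noteq> top" by auto
      define W where "W = enn2real ?A"
      have W: "?A = ennreal W" "1 \<le> W"
        unfolding W_def using fin(1) enn2real_mono[OF A1] by (auto simp: less_top)
      have base_fin: "(\<integral>\<^sup>+x\<in>?B. v x \<partial>lborel) < top" using vfin[of ?B] Qa by auto
      let ?k = "(poincare_const ?n * p * W) powr p * (1 - \<delta>)"
      obtain c where "(\<integral>\<^sup>+x\<in>?B. ennreal (\<bar>u' x - c\<bar> powr p) * v x \<partial>lborel)
          \<le> ennreal (2 * (16 powr p * T.weak_const p \<delta> W)) * T.energy p \<delta> v u'"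
        using T.weighted_poincare[OF u' v base_fin W(2) fujii_wilson[unfolded W(1)] p \<delta>] .
      also have "\<dots> \<le> ennreal ?k * ?I"
        by (intro mult_mono ennreal_leI E T.poincare_const_bound p \<delta> W(2)) (auto simp: powr_realpow)
      finally have "epowr (\<integral>\<^sup>+x\<in>Q. ennreal (\<bar>u x - c\<bar> powr p * w x) \<partial>lebesgue) (1 / p)
          \<le> epowr (ennreal ?k * ?I) (1 / p)"
        unfolding lhs by (rule epowr_mono[OF _ p'])
      also have "\<dots> = ennreal (?k powr (1 / p)) * epowr ?I (1 / p)"
        using \<delta> fin p' by (intro epowr_cmult) auto
      also have "?k powr (1 / p) = ?K * W"
        using p \<delta> W K by (simp add: powr_mult powr_powr poincare_const_def)
      also have "ennreal (?K * W) = ennreal ?K * ?A"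
        unfolding W(1) using K by (simp add: ennreal_mult')
      finally show ?thesis by (rule INF_lower2[OF UNIV_I])
    qed
  qed
qed

theorem theorem2p4:
  shows "\<exists>c>0. \<forall>(\<delta>::real) (p::real) (w :: real ^ 'n::finite \<Rightarrow> real) (u :: real ^ 'n \<Rightarrow> real) (Q :: (real ^ 'n) set).
    0 < \<delta> \<and> \<delta> < 1 \<and> 1 \<le> p \<and> w \<in> A_infinity \<and> locally_integrable u \<and> Q \<in> cubes \<longrightarrow>
    (INF a::real. epowr (\<integral>\<^sup>+x\<in>Q. ennreal (\<bar>u x - a\<bar> powr p * w x) \<partial>lebesgue) (1 / p))
    \<le> ennreal (c * p * (1 - \<delta>) powr (1 / p)) * A_infinity_const w *
       epowr (\<integral>\<^sup>+x\<in>Q.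
           (\<integral>\<^sup>+y\<in>Q. ennreal (\<bar>u x - u y\<bar> powr p / norm (x - y) powr (real CARD('n) + \<delta> * p)) \<partial>lebesgue)
             * local_fractional_maximal (\<delta> * p) Q w x \<partial>lebesgue) (1 / p)"
proof (intro exI[of _ "poincare_const (real CARD('n))"] conjI allI impI, goal_cases)
  case 1
  show ?case by (simp add: poincare_const_def add_pos_pos)
next
  case (2 \<delta> p w u Q)
  then have "weight w" by (auto simp: A_infinity_def A1_class_def Aq_class_def)
  moreover obtain l where "cube l Q" using 2 by (auto simp: cubes_def)
  ultimately show ?case
    using 2 by (intro weighted_fractional_poincare locally_integrable_borel_measurable) auto
qed

end
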